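(* Let $f^{\pm},g^{\pm}:\mathbb{R}^2\to\mathbb{R}$, $H:\mathbb{R}^2\times\mathbb{R}\to\mathbb{R}$ be $C^2$ and consider, for $\varepsilon>0$, the Filippov system $(\dot x,\dot y)=(f^{+},g^{+})(x,y)$ if $H(x,y,\varepsilon)>0$, $(\dot x,\dot y)=(f^{-},g^{-})(x,y)$ if $H(x,y,\varepsilon)<0$. Assume $f^-(0)=g^-(0)=0$, $H(0)=0$, $H_x(0)=0$, $H_y(0)\neq0$, $H_y(0)g^+(0)<0$, $g_x^-(0)\ne0$, $(f^-_x(0),g^-_x(0))\nparallel(f^+(0),g^+(0))$, and condition $$\big(f^-_x(0)A'(0)+f^-_y(0)B'(0)\big)(A'(0)-a'(0))\lambda'(0)<0,$$ where $$(A'(0),B'(0))=\frac{H_\varepsilon(0)}{H_y(0)}\Big(\frac{g^-_y(0)}{g^-_x(0)},-1\Big),$$ $$a'(0)=\frac{H_\varepsilon(0)}{H_y(0)}\cdot\frac{f^-_y(0)g^+(0)-g^-_y(0)f^+(0)}{f^-_x(0)g^+(0)-g^-_x(0)f^+(0)},\qquad \lambda'(0)=-\frac{H_\varepsilon(0)}{H_y(0)}\cdot\frac{f^-_x(0)g^-_y(0)-f^-_y(0)g^-_x(0)}{f^-_x(0)g^+(0)-g^-_x(0)f^+(0)}.$$ Assume the linear system $\dot u=f^-_x(0)u+f^-_y(0)v$, $\dot v=g^-_x(0)u+g^-_y(0)v$ has a solution $(u_0,v_0)$ with $(u_0(0),v_0(0))=(A'(0),B'(0))$, $H_y(0)v_0(t)+H_\varepsilon(0)<0$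 for $t\in(0,T_0)$ and $v_0(T_0)=B'(0)$ for some $T_0>0$. If $$u_0(T_0)\in\big(\min\{a'(0),A'(0)\},\max\{a'(0),A'(0)\}\big)\ \text{ when }\lambda'(0)<0,\qquad u_0(T_0)\neq A'(0)\ \text{ when }\lambda'(0)>0,$$ then for all sufficiently small $\varepsilon>0$ the Filippov system admits a finite-time stable stick-slip limit cycle $(x_\varepsilon(t),y_\varepsilon(t))$ which tends to the origin as $\varepsilon\to0$.
   Context: Solutions are Filippov solutions (with sliding along the switching curve $\{H(\cdot,\cdot,\varepsilon)=0\}$ governed by the Filippov sliding vector field). A stick-slip cycle is a periodic solution containing a segment of sliding motion along the switching curve. A periodic orbit is finite-time stable if every trajectory starting in a sufficiently small neighborhood of it coincides with the periodic orbit (up to a time shift) after finite time. Subscripts denote partial derivatives evaluated at the origin (and $\varepsilon=0$ for $H$). *)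

theory Defs
  imports "HOL-Analysis.Analysis"
begin

definition C2 :: "('a::euclidean_space \<Rightarrow> 'b::euclidean_space) \<Rightarrow> bool" where
  "C2 F \<longleftrightarrow> (\<exists>D D2. (\<forall>x. (F has_derivative blinfun_apply (D x)) (at x)) \<and>
                      (\<forall>x. (D has_derivative blinfun_apply (D2 x)) (at x)) \<and>
                      continuous_on UNIV D2)"

definition px :: "(real \<times> real \<Rightarrow> real) \<Rightarrow> real" where
  "px F = deriv (\<lambda>x. F (x, 0)) 0"
definition py :: "(real \<times> real \<Rightarrow> real) \<Rightarrow> real" where
  "py F = deriv (\<lambda>y. F (0, y)) 0"

definition Hx :: "(real \<times> real \<Rightarrow> real \<Rightarrow> real) \<Rightarrow> real" where
  "Hx H = deriv (\<lambda>x. H (x, 0) 0) 0"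
definition Hy :: "(real \<times> real \<Rightarrow> real \<Rightarrow> real) \<Rightarrow> real" where
  "Hy H = deriv (\<lambda>y. H (0, y) 0) 0"
definition He :: "(real \<times> real \<Rightarrow> real \<Rightarrow> real) \<Rightarrow> real" where
  "He H = deriv (\<lambda>e. H (0, 0) e) 0"

definition filippov_map ::
  "(real \<times> real \<Rightarrow> real) \<Rightarrow> (real \<times> real \<Rightarrow> real) \<Rightarrow> (real \<times> real \<Rightarrow> real) \<Rightarrow>
   (real \<times> real \<Rightarrow> real) \<Rightarrow> (real \<times> real \<Rightarrow> real \<Rightarrow> real) \<Rightarrow> real \<Rightarrow>
   real \<times> real \<Rightarrow> (real \<times> real) set" where
  "filippov_map fp gp fm gm H \<epsilon> z =
     (if H z \<epsilon> > 0 then {(fp z, gp z)}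
      else if H z \<epsilon> < 0 then {(fm z, gm z)}
      else closed_segment (fp z, gp z) (fm z, gm z))"

text \<open>Forward Filippov solution on [0,\<infinity>): z absolutely continuous, i.e. an
  indefinite Lebesgue integral of w, with w(s) in the Filippov set a.e.\<close>
definition filippov_sol ::
  "(real \<times> real \<Rightarrow> real) \<Rightarrow> (real \<times> real \<Rightarrow> real) \<Rightarrow> (real \<times> real \<Rightarrow> real) \<Rightarrow>
   (real \<times> real \<Rightarrow> real) \<Rightarrow> (real \<times> real \<Rightarrow> real \<Rightarrow> real) \<Rightarrow> real \<Rightarrow>
   (real \<Rightarrow> real \<times> real) \<Rightarrow> bool" where
  "filippov_sol fp gp fm gm H \<epsilon> z \<longleftrightarrow>
     (\<exists>w. (\<forall>t\<ge>0. w absolutely_integrable_on {0..t} \<and> (w has_integral (z t - z 0)) {0..t}) \<and>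
          (AE s in lebesgue. 0 \<le> s \<longrightarrow> w s \<in> filippov_map fp gp fm gm H \<epsilon> (z s)))"

definition periodic_sol where
  "periodic_sol fp gp fm gm H \<epsilon> \<gamma> \<longleftrightarrow>
     filippov_sol fp gp fm gm H \<epsilon> \<gamma> \<and>
     (\<exists>p>0. \<forall>t\<ge>0. \<gamma> (t + p) = \<gamma> t) \<and> (\<exists>t\<ge>0. \<gamma> t \<noteq> \<gamma> 0)"

definition orbit :: "(real \<Rightarrow> real \<times> real) \<Rightarrow> (real \<times> real) set" where
  "orbit \<gamma> = \<gamma> ` {0..}"

definition stick_slip_cycle where
  "stick_slip_cycle fp gp fm gm H \<epsilon> \<gamma> \<longleftrightarrow>
     periodic_sol fp gp fm gm H \<epsilon> \<gamma> \<and>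
     (\<exists>t1 t2. 0 \<le> t1 \<and> t1 < t2 \<and> (\<forall>t\<in>{t1..t2}. H (\<gamma> t) \<epsilon> = 0))"

definition limit_cycle where
  "limit_cycle fp gp fm gm H \<epsilon> \<gamma> \<longleftrightarrow>
     periodic_sol fp gp fm gm H \<epsilon> \<gamma> \<and>
     (\<exists>\<delta>>0. \<forall>\<zeta>. periodic_sol fp gp fm gm H \<epsilon> \<zeta> \<and>
                 orbit \<zeta> \<subseteq> {q. infdist q (orbit \<gamma>) < \<delta>} \<longrightarrow> orbit \<zeta> = orbit \<gamma>)"

definition finite_time_stable where
  "finite_time_stable fp gp fm gm H \<epsilon> \<gamma> \<longleftrightarrow>
     (\<exists>\<delta>>0. \<forall>z. filippov_sol fp gp fm gm H \<epsilon> z \<and> infdist (z 0) (orbit \<gamma>) < \<delta> \<longrightarrow>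
        (\<exists>t0\<ge>0. \<exists>s\<ge>0. \<forall>t\<ge>t0. z t = \<gamma> (t + s)))"

end

theory Submission
  imports Defs
begin

text \<open>At scale \<open>\<epsilon>\<close> around the origin the lower flow is a small perturbation of the linear flow, the
  switching curve of a horizontal line, and the sliding flow of an affine flow on that line. The linear flow
  leaves the visible fold \<open>(A'(0), B'(0))\<close> and lands in the sliding region at \<open>u\<^sub>0(T\<^sub>0)\<close>, from where the affine
  flow returns to the fold in finite time; by Gronwall's inequality both pieces persist for small \<open>\<epsilon>\<close>. The
  fold of the perturbed system is locally the only point where \<open>H\<close> and its derivative along the lower field
  vanish, so the perturbed pieces close up exactly to a periodic solution.

  Because the upper field points strictly towards the switching curve, forward solutions depend Lipschitz
  continuously on their initial values; in particular they are unique. Hence every solution that starts near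
  the cycle gets close to its landing point, reaches the switching curve there, slides into the fold, and
  coincides with the cycle from then on.\<close>

section \<open>Gronwall estimates and ordinary differential equations\<close>

text \<open>The sign conditions decide whether the limit sliding motion reaches the fold. On the
  line \<open>v = B'(0)\<close> this motion reads \<open>u' = \<mu> (u - a'(0))\<close>, where
  \<open>\<mu>\<close> is the denominator of \<open>a'(0)\<close> divided by the second component of
  the upper field at the origin. So \<open>a'(0)\<close> is a pseudo-equilibrium, and
  \<open>\<mu>\<close> has the sign opposite to \<open>\<lambda>'(0)\<close>. For
  \<open>\<lambda>'(0) < 0\<close> it repels and lies in the sliding region, so the landing point
  has to lie between it and the fold. For \<open>\<lambda>'(0) > 0\<close> it attracts but lies
  beyond the fold, so every landing point in the sliding region is carried to the fold.

  The obstacle to a plain perturbation argument is the start of the slip: at the fold both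
  \<open>H\<close> and its derivative along the lower field vanish, and closeness to the limit up to
  an error of order \<open>\<epsilon>\<close> does not tell to which side the orbit leaves.
  Estimates for the difference of two nearby points do, since their errors are proportional to the
  distance of the points. For this reason smoothness enters as strict differentiability at the
  origin.\<close>

lemma dini_gronwall:
  fixes f :: "real \<Rightarrow> real"
  assumes cont: "continuous_on {0..T} f" and C: "C \<ge> 0" and b: "b \<ge> 0" and f0: "f 0 \<ge> 0"
    and dini: "\<And>t \<eta>. 0 \<le> t \<Longrightarrow> t < T \<Longrightarrow> \<eta> > 0 \<Longrightarrow>
      \<exists>h0>0. \<forall>h. 0 < h \<and> h < h0 \<longrightarrow> f (t + h) \<le> f t + h * (C * f t + b + \<eta>)"
    and t: "0 \<le> t" "t \<le> T"
  shows "f t \<le> (f 0 + b * t) * exp (C * t)"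
proof -
  \<comment> \<open>Enlarging the initial value and the slope by \<open>e\<close> gives room: the
    comparison function starts strictly above \<open>f\<close>, and its extra slope absorbs the
    error \<open>\<eta> = e\<close> of the Dini bound. In the end \<open>e\<close> tends to
    0.\<close>
  have less: "f t \<le> (f 0 + e + (b + e) * t) * exp (C * t)" if e: "e > 0" for e
  proof (rule ccontr)
    define g where "g s = (f 0 + e + (b + e) * s) * exp (C * s)" for s
    assume "\<not> ?thesis"
    then have gt: "f t > g t" by (simp add: g_def)
    have contg: "continuous_on {0..t} (\<lambda>s. f s - g s)"
      unfolding g_def using continuous_on_subset[OF cont] t by (intro continuous_intros) auto
    \<comment> \<open>Leaving the region below \<^term>\<open>g\<close> at the infimum \<^term>\<open>u\<close> contradicts the Dini bound there.\<close>
    show False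
    proof -
      define U where "U = {r \<in> {0..t}. f r > g r}"
      have Une: "U \<noteq> {}" using gt t unfolding U_def by force
      have Ubd: "bdd_below U" unfolding U_def by (rule bdd_belowI[of _ 0]) auto
      define u where "u = Inf U"
      have u0: "0 \<le> u" unfolding u_def by (rule cInf_greatest[OF Une]) (auto simp: U_def)
      have ut: "u \<le> t" unfolding u_def using cInf_lower[OF _ Ubd, of t] gt t by (auto simp: U_def)
      have le: "f r \<le> g r" if "0 \<le> r" "r < u" for r
        using that cInf_lower[OF _ Ubd, of r] ut unfolding U_def u_def by force
      have g0: "f 0 < g 0" unfolding g_def using e by simp
      have fu: "f u \<le> g u"
      proof (cases "u = 0")
        case True then show ?thesis using g0 by simp
      next
        case False
        then have "u > 0" using u0 by simp
        have "((\<lambda>s. f s - g s) \<longlongrightarrow> f u - g u) (at_left u)"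
        proof -
          have "((\<lambda>s. f s - g s) \<longlongrightarrow> f u - g u) (at u within {0..t})"
            using contg u0 ut by (simp add: continuous_on)
          then have "((\<lambda>s. f s - g s) \<longlongrightarrow> f u - g u) (at u within {0..u})"
            by (rule tendsto_within_subset) (use ut in auto)
          then show ?thesis
            using \<open>u > 0\<close> by (simp add: at_within_Icc_at_left)
        qed
        moreover have "eventually (\<lambda>s. f s - g s \<le> 0) (at_left u)"
          using eventually_at_left_real[OF \<open>u > 0\<close>] by eventually_elim (use le in force)
        ultimately have "f u - g u \<le> 0"
          by (intro tendsto_upperbound) auto
        then show ?thesis by simp
      qed
      have "u < t" using fu gt ut by (cases "u = t") auto
      then obtain h0 where h0: "h0 > 0"
        "\<And>h. 0 < h \<Longrightarrow> h < h0 \<Longrightarrow> f (u + h) \<le> f u + h * (C * f u + b + e)"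
        using dini[of u e] u0 t e by force
      have step: "f (u + h) \<le> g (u + h)" if h: "0 < h" "h < h0" for h
      proof -
        have "f (u + h) \<le> f u + h * (C * f u + b + e)" using h0(2) h by blast
        also have "\<dots> \<le> g u + h * (C * g u + b + e)"
          by (intro add_mono mult_left_mono fu order_refl) (use C h in simp_all)
        also have "\<dots> \<le> (g u + (b + e) * h) * (1 + C * h)"
        proof -
          have "0 \<le> (b + e) * h * (C * h)" using C b e h by simp
          then show ?thesis by (simp add: algebra_simps)
        qed
        also have "\<dots> \<le> (g u + (b + e) * h * exp (C * u)) * exp (C * h)"
        proof -
          have "(b + e) * h \<le> (b + e) * h * exp (C * u)"
            using mult_left_mono[of 1 "exp (C * u)" "(b + e) * h"] b e h C u0 by simp
          moreover have "0 \<le> g u" unfolding g_def using f0 b e u0 by simp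
          moreover have "0 \<le> (b + e) * h * exp (C * u)" using b e h by simp
          moreover have "0 \<le> 1 + C * h" using C h by simp
          ultimately show ?thesis by (intro mult_mono exp_ge_add_one_self) linarith+
        qed
        also have "\<dots> = g (u + h)" unfolding g_def distrib_left exp_add by (simp add: algebra_simps)
        finally show ?thesis .
      qed
      define u' where "u' = u + h0"
      have "u' \<le> r" if "r \<in> U" for r
      proof (rule ccontr)
        assume "\<not> u' \<le> r"
        then have r: "r < u + h0" by (simp add: u'_def)
        have "u \<le> r" unfolding u_def using cInf_lower[OF that Ubd] .
        then have "f r \<le> g r" using step[of "r - u"] r fu by (cases "r = u") auto
        then show False using that by (simp add: U_def)
      qed
      then have "u' \<le> u" unfolding u_def by (intro cInf_greatest[OF Une])
      then show False using h0(1) by (simp add: u'_def)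
    qed
  qed
  have "((\<lambda>e. (f 0 + e + (b + e) * t) * exp (C * t)) \<longlongrightarrow> (f 0 + 0 + (b + 0) * t) * exp (C * t)) (at_right 0)"
    by (intro tendsto_intros)
  moreover have "eventually (\<lambda>e. f t \<le> (f 0 + e + (b + e) * t) * exp (C * t)) (at_right 0)"
    using less by (auto simp: eventually_at_right_less eventually_at_filter intro!: eventuallyI)
  ultimately show ?thesis
    by (intro tendsto_lowerbound[where F = "at_right 0"]) auto
qed

text \<open>The norm need not be differentiable, but the expansion of \<open>x - y\<close> at
  \<open>t\<close> and the triangle inequality give a one-sided growth bound, which is all that the
  Dini form of Gronwall's inequality asks for.\<close>

lemma norm_diff_gronwall:
  fixes x y :: "real \<Rightarrow> 'a::real_normed_vector"
  assumes x: "\<And>t. t \<in> {0..T} \<Longrightarrow> (x has_vector_derivative x' t) (at t within {0..T})"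
    and y: "\<And>t. t \<in> {0..T} \<Longrightarrow> (y has_vector_derivative y' t) (at t within {0..T})"
    and bd: "\<And>t. t \<in> {0..T} \<Longrightarrow> norm (x' t - y' t) \<le> C * norm (x t - y t) + b"
    and C: "C \<ge> 0" and b: "b \<ge> 0" and t: "t \<in> {0..T}"
  shows "norm (x t - y t) \<le> (norm (x 0 - y 0) + b * t) * exp (C * t)"
proof (rule dini_gronwall[where T = T])
  have d: "((\<lambda>t. x t - y t) has_vector_derivative (x' t - y' t)) (at t within {0..T})" if "t \<in> {0..T}" for t
    using x[OF that] y[OF that] by (rule has_vector_derivative_diff)
  then show "continuous_on {0..T} (\<lambda>t. norm (x t - y t))"
    by (intro continuous_on_norm continuous_on_vector_derivative) auto
  fix t \<eta> :: real assume t: "0 \<le> t" "t < T" and \<eta>: "\<eta> > 0"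
  have "((\<lambda>t. x t - y t) has_derivative (\<lambda>h. h *\<^sub>R (x' t - y' t))) (at t within {0..T})"
    using d[of t] t unfolding has_vector_derivative_def by simp
  then obtain d0 where d0: "d0 > 0" "\<And>s. s \<in> {0..T} \<Longrightarrow> norm (s - t) < d0 \<Longrightarrow>
      norm ((x s - y s) - (x t - y t) - (s - t) *\<^sub>R (x' t - y' t)) \<le> \<eta> * norm (s - t)"
    using \<eta> unfolding has_derivative_within_alt by meson
  show "\<exists>h0>0. \<forall>h. 0 < h \<and> h < h0 \<longrightarrow>
     norm (x (t + h) - y (t + h)) \<le> norm (x t - y t) + h * (C * norm (x t - y t) + b + \<eta>)"
  proof (intro exI[of _ "min d0 (T - t)"] conjI allI impI)
    fix h assume h: "0 < h \<and> h < min d0 (T - t)"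
    have "norm ((x (t+h) - y (t+h)) - (x t - y t) - h *\<^sub>R (x' t - y' t)) \<le> \<eta> * h"
      using d0(2)[of "t + h"] h t by simp
    moreover have "norm (x (t+h) - y (t+h)) \<le> norm ((x (t+h) - y (t+h)) - (x t - y t) - h *\<^sub>R (x' t - y' t))
       + norm (x t - y t) + norm (h *\<^sub>R (x' t - y' t))"
      using norm_triangle_ineq[of "(x (t+h) - y (t+h)) - (x t - y t) - h *\<^sub>R (x' t - y' t)" "(x t - y t) + h *\<^sub>R (x' t - y' t)"]
        norm_triangle_ineq[of "x t - y t" "h *\<^sub>R (x' t - y' t)"] by (simp add: algebra_simps)
    moreover have "norm (h *\<^sub>R (x' t - y' t)) \<le> h * (C * norm (x t - y t) + b)"
      using bd[of t] t h by simp
    ultimately show "norm (x (t + h) - y (t + h)) \<le> norm (x t - y t) + h * (C * norm (x t - y t) + b + \<eta>)"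
      by (simp add: algebra_simps)
  qed (use d0 t in auto)
qed (use C b t in auto)

text \<open>The interval may be arbitrarily long because the Lipschitz bound is global. A field that
  is Lipschitz only on a ball is brought into this form in \<open>perturbed_flow\<close> by
  composing it with the projection onto the ball.\<close>

lemma ode_exists:
  fixes f :: "'a::euclidean_space \<Rightarrow> 'a"
  assumes L: "\<And>x y. norm (f x - f y) \<le> L * norm (x - y)" and T: "T \<ge> 0"
  shows "\<exists>x. x 0 = x0 \<and> (\<forall>t\<in>{0..T}. (x has_vector_derivative f (x t)) (at t within {0..T}))"
proof -
  have L0: "L \<ge> 0"
  proof (rule ccontr)
    obtain e :: 'a where "e \<in> Basis" using nonempty_Basis by blast
    moreover assume "\<not> L \<ge> 0"
    ultimately show False using L[of e 0] norm_ge_zero[of "f e - f 0"] by (simp add: norm_Basis)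
  qed
  \<comment> \<open>This choice gives \<open>K > 0\<close> even for \<open>L = 0\<close>, and a
    contraction factor \<open>L / K\<close> below 1.\<close>
  define K where "K = 2 * L + 1"
  have K: "K > 0" "L / K < 1" "L / K \<ge> 0" using L0 by (auto simp: K_def field_simps)
  have contf: "continuous_on UNIV f"
    by (rule lipschitz_on_continuous_on[of L], rule lipschitz_onI) (use L L0 in \<open>auto simp: dist_norm\<close>)
  \<comment> \<open>Freezing the time outside \<open>{0..T}\<close> makes the iterates bounded
    continuous functions on the whole line, which form a complete space.\<close>
  define cl where "cl t = max 0 (min T t)" for t :: real
  have cl: "cl t \<in> {0..T}" for t using T by (auto simp: cl_def)
  have cl_id: "t \<in> {0..T} \<Longrightarrow> cl t = t" for t by (auto simp: cl_def)
  have contcl: "continuous_on UNIV cl" unfolding cl_def by (intro continuous_intros)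
  \<comment> \<open>The weight \<^term>\<open>exp (K * t)\<close> makes the Picard operator a contraction on an interval of any length.\<close>
  define F where "F x s = f (exp (K * s) *\<^sub>R apply_bcontfun x s)" for x :: "real \<Rightarrow>\<^sub>C 'a" and s
  have contF: "continuous_on S (F x)" for x S
    unfolding F_def
    by (rule continuous_on_compose2[OF contf]) (auto intro!: continuous_intros continuous_on_subset[OF continuous_on_apply_bcontfun])
  have int: "F x integrable_on {0..t}" for x t
    by (rule integrable_continuous_interval[OF contF])
  define P where "P x t = exp (- K * cl t) *\<^sub>R (x0 + integral {0..cl t} (F x))" for x t
  have contP: "continuous_on UNIV (P x)" for x
  proof -
    have "continuous_on {0..T} (\<lambda>t. integral {0..t} (F x))"
      by (rule indefinite_integral_continuous_1[OF int])
    then have "continuous_on UNIV (\<lambda>t. integral {0..cl t} (F x))"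
      by (rule continuous_on_compose2[OF _ contcl]) (use cl in auto)
    then show ?thesis unfolding P_def by (intro continuous_intros contcl)
  qed
  have PB: "P x \<in> bcontfun" for x
  proof -
    have "compact (P x ` {0..T})"
      by (rule compact_continuous_image[OF continuous_on_subset[OF contP]]) auto
    then obtain B where B: "\<And>t. t \<in> {0..T} \<Longrightarrow> norm (P x t) \<le> B"
      using compact_imp_bounded bounded_iff by (metis imageI)
    have "P x t = P x (cl t)" for t unfolding P_def using cl_id[OF cl] by simp
    then have "norm (P x t) \<le> B" for t using B cl by metis
    then show ?thesis using contP by (auto simp: bcontfun_def bounded_iff)
  qed
  have "\<exists>!x. Bcontfun (P x) = x"
  proof (rule banach_fix_type)
    show "0 \<le> L / K" "L / K < 1" using K by auto
    show "\<forall>x y. dist (Bcontfun (P x)) (Bcontfun (P y)) \<le> L / K * dist x y"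
    proof (intro allI dist_bound)
      fix x y :: "real \<Rightarrow>\<^sub>C 'a" and t
      have expint: "((\<lambda>s. L * dist x y * exp (K * s)) has_integral (L * dist x y / K * exp (K * cl t) - L * dist x y / K * exp (K * 0))) {0..cl t}"
        using cl[of t] K by (intro fundamental_theorem_of_calculus)
          (auto intro!: derivative_eq_intros simp: has_real_derivative_iff_has_vector_derivative[symmetric])
      have "norm (integral {0..cl t} (\<lambda>s. F x s - F y s)) \<le> integral {0..cl t} (\<lambda>s. L * dist x y * exp (K * s))"
      proof (rule integral_norm_bound_integral)
        show "(\<lambda>s. F x s - F y s) integrable_on {0..cl t}" by (intro integrable_diff int)
        show "(\<lambda>s. L * dist x y * exp (K * s)) integrable_on {0..cl t}" using expint by blast
        fix s
        have "norm (F x s - F y s) \<le> L * (exp (K * s) * dist (apply_bcontfun x s) (apply_bcontfun y s))"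
          unfolding F_def by (rule order_trans[OF L]) (simp add: scaleR_diff_right[symmetric] dist_norm)
        also have "\<dots> \<le> L * (exp (K * s) * dist x y)"
          using L0 by (intro mult_left_mono dist_bounded) auto
        finally show "norm (F x s - F y s) \<le> L * dist x y * exp (K * s)" by (simp add: mult_ac)
      qed
      also have "\<dots> = L * dist x y / K * exp (K * cl t) - L * dist x y / K"
        using integral_unique[OF expint] by simp
      also have "\<dots> \<le> L * dist x y / K * exp (K * cl t)" using L0 K by simp
      finally have "exp (- K * cl t) * norm (integral {0..cl t} (\<lambda>s. F x s - F y s)) \<le> exp (- K * cl t) * (L * dist x y / K * exp (K * cl t))"
        by (intro mult_left_mono) auto
      also have "\<dots> = L / K * dist x y" by (simp add: exp_minus field_simps)
      finally show "dist (apply_bcontfun (Bcontfun (P x)) t) (apply_bcontfun (Bcontfun (P y)) t) \<le> L / K * dist x y"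
        using int by (simp add: Bcontfun_inverse PB P_def dist_norm integral_diff scaleR_diff_right[symmetric])
    qed
  qed
  then obtain x where x: "Bcontfun (P x) = x" by blast
  then have xt: "apply_bcontfun x t = P x t" for t using Bcontfun_inverse[OF PB[of x]] by metis
  have eq: "x0 + integral {0..t} (F x) = exp (K * t) *\<^sub>R apply_bcontfun x t" if "t \<in> {0..T}" for t
    unfolding xt P_def using cl_id[OF that] by (simp add: exp_minus)
  show ?thesis
  proof (intro exI[of _ "\<lambda>t. exp (K * t) *\<^sub>R apply_bcontfun x t"] conjI ballI)
    show "exp (K * 0) *\<^sub>R apply_bcontfun x 0 = x0" using eq[of 0] T by simp
    fix t assume t: "t \<in> {0..T}"
    have "((\<lambda>t. integral {0..t} (F x)) has_vector_derivative F x t) (at t within {0..T})"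
      by (rule integral_has_vector_derivative[OF contF t])
    then have "((\<lambda>t. x0 + integral {0..t} (F x)) has_vector_derivative F x t) (at t within {0..T})"
      by (auto intro!: derivative_eq_intros)
    then show "((\<lambda>t. exp (K * t) *\<^sub>R apply_bcontfun x t) has_vector_derivative
        f (exp (K * t) *\<^sub>R apply_bcontfun x t)) (at t within {0..T})"
      unfolding F_def[symmetric]
      by (rule has_vector_derivative_transform[OF t, rotated]) (simp add: eq)
  qed
qed

text \<open>A mean value outside the set would be strictly separated from it by a hyperplane, and
  integrating the separating functional gives a contradiction. This turns an inclusion for almost
  all velocities into one for difference quotients.\<close>

lemma average_in_closed_convex:
  fixes w :: "real \<Rightarrow> 'a::euclidean_space"
  assumes C: "convex C" "closed C" "C \<noteq> {}" and ab: "a < b" and w: "(w has_integral v) {a..b}"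
    and ae: "AE s in lebesgue. s \<in> {a..b} \<longrightarrow> w s \<in> C"
  shows "(1 / (b - a)) *\<^sub>R v \<in> C"
proof (rule ccontr)
  assume "\<not> ?thesis"
  then obtain n c where n: "inner n ((1 / (b - a)) *\<^sub>R v) < c" "\<And>x. x \<in> C \<Longrightarrow> inner n x > c"
    using separating_hyperplane_closed_point[OF C(1,2)] by blast
  define N where "N = {s. \<not> (s \<in> {a..b} \<longrightarrow> w s \<in> C)}"
  have N: "negligible N"
    using ae unfolding N_def by (simp add: eventually_ae_filter_negligible) (meson negligible_subset)
  have "((\<lambda>s. inner n (w s)) has_integral inner n v) {a..b}"
    using has_integral_linear[OF w bounded_linear_inner_right[of n]] by (simp add: o_def)
  moreover have "((\<lambda>s. c) has_integral c * (b - a)) {a..b}"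
    using has_integral_const_real[of c a b] ab by (simp add: mult.commute)
  ultimately have nw: "((\<lambda>s. inner n (w s)) has_integral inner n v) {a..b}"
    and c: "((\<lambda>s. c) has_integral c * (b - a)) {a..b}" by auto
  \<comment> \<open>Setting the integrand to \<open>c\<close> on the exceptional null set makes the
    inequality hold at every point.\<close>
  have "((\<lambda>s. if s \<in> N then c else inner n (w s)) has_integral inner n v) {a..b}"
    by (rule has_integral_spike[OF N _ nw]) simp
  then have "c * (b - a) \<le> inner n v"
    by (rule has_integral_le[OF c]) (use n in \<open>auto simp: N_def less_imp_le\<close>)
  moreover have "inner n v < c * (b - a)" using n(1) ab by (simp add: field_simps)
  ultimately show False by simp
qed

section \<open>Strict differentiability at the origin\<close>

text \<open>Two nearby points are compared, not one point with the origin. Hence the nonlinear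
  remainder has a small Lipschitz constant near 0, and \<open>q = 0\<close> gives the usual
  differentiability. The notion is stable under products and quotients and suits fields like the
  sliding field, which contain the first derivative of \<open>H\<close>.\<close>

definition strict_deriv :: "('a::real_normed_vector \<Rightarrow> 'b::real_normed_vector) \<Rightarrow> ('a \<Rightarrow> 'b) \<Rightarrow> bool" where
  "strict_deriv f A \<longleftrightarrow> bounded_linear A \<and>
     (\<forall>\<eta>>0. \<exists>r>0. \<forall>p q. norm p \<le> r \<and> norm q \<le> r \<longrightarrow> norm (f p - f q - A (p - q)) \<le> \<eta> * norm (p - q))"

lemma strict_derivD:
  assumes "strict_deriv f A" "\<eta> > 0"
  obtains r where "r > 0"
    "\<And>p q. norm p \<le> r \<Longrightarrow> norm q \<le> r \<Longrightarrow> norm (f p - f q - A (p - q)) \<le> \<eta> * norm (p - q)"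
  using assms unfolding strict_deriv_def by meson

lemma strict_deriv_lipschitz:
  assumes "strict_deriv f A"
  obtains r K where "r > 0" "K > 0"
    "\<And>p q. norm p \<le> r \<Longrightarrow> norm q \<le> r \<Longrightarrow> norm (f p - f q) \<le> K * norm (p - q)"
proof -
  obtain B where B: "B > 0" "\<And>v. norm (A v) \<le> norm v * B"
    using assms bounded_linear.pos_bounded unfolding strict_deriv_def by blast
  obtain r where r: "r > 0"
    "\<And>p q. norm p \<le> r \<Longrightarrow> norm q \<le> r \<Longrightarrow> norm (f p - f q - A (p - q)) \<le> 1 * norm (p - q)"
    using strict_derivD[OF assms, of 1] by auto
  show ?thesis
  proof (rule that[of r "B + 1"])
    fix p q :: 'a assume pq: "norm p \<le> r" "norm q \<le> r"
    show "norm (f p - f q) \<le> (B + 1) * norm (p - q)"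
      using r(2)[OF pq] B(2)[of "p - q"] norm_triangle_ineq[of "f p - f q - A (p - q)" "A (p - q)"]
      by (simp add: algebra_simps)
  qed (use r B in auto)
qed

lemma strict_deriv_compose_linear:
  fixes f :: "'a::real_normed_vector \<Rightarrow> 'b::real_normed_vector" and B :: "'c::real_normed_vector \<Rightarrow> 'a"
  assumes f: "strict_deriv f A" and B: "bounded_linear B"
  shows "strict_deriv (\<lambda>p. f (B p)) (\<lambda>v. A (B v))"
proof -
  obtain M where M: "M > 0" "\<And>v. norm (B v) \<le> norm v * M"
    using B bounded_linear.pos_bounded by blast
  note lin = bounded_linear.linear[OF B]
  show ?thesis unfolding strict_deriv_def
  proof (intro conjI allI impI)
    show "bounded_linear (\<lambda>v. A (B v))"
      using bounded_linear_compose B f unfolding strict_deriv_def by blast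
    fix \<eta> :: real assume \<eta>: "\<eta> > 0"
    then have "\<eta> / M > 0" using M by simp
    then obtain r where r: "r > 0" "\<And>p q. norm p \<le> r \<Longrightarrow> norm q \<le> r \<Longrightarrow> norm (f p - f q - A (p - q)) \<le> \<eta> / M * norm (p - q)"
      using strict_derivD[OF f] by metis
    show "\<exists>r>0. \<forall>p q. norm p \<le> r \<and> norm q \<le> r \<longrightarrow> norm (f (B p) - f (B q) - A (B (p - q))) \<le> \<eta> * norm (p - q)"
    proof (intro exI[of _ "r / M"] conjI allI impI)
      fix p q :: 'c assume pq: "norm p \<le> r / M \<and> norm q \<le> r / M"
      have pq': "norm p * M \<le> r" "norm q * M \<le> r"
        using pq M(1) by (simp_all add: pos_le_divide_eq)
      have "norm (f (B p) - f (B q) - A (B p - B q)) \<le> \<eta> / M * norm (B p - B q)"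
        by (rule r(2)) (use M(2) pq' order_trans in blast)+
      also have "\<dots> \<le> \<eta> / M * (norm (p - q) * M)"
        using M(2)[of "p - q"] \<eta> M(1) unfolding linear_diff[OF lin]
        by (intro mult_left_mono) simp_all
      also have "\<dots> = \<eta> * norm (p - q)" using M(1) by simp
      finally show "norm (f (B p) - f (B q) - A (B (p - q))) \<le> \<eta> * norm (p - q)"
        unfolding linear_diff[OF lin] .
    qed (use r M in auto)
  qed
qed

lemma strict_deriv_linear_compose:
  fixes f :: "'a::real_normed_vector \<Rightarrow> 'b::real_normed_vector" and B :: "'b \<Rightarrow> 'c::real_normed_vector"
  assumes f: "strict_deriv f A" and B: "bounded_linear B"
  shows "strict_deriv (\<lambda>p. B (f p)) (\<lambda>v. B (A v))"
proof -
  obtain M where M: "M > 0" "\<And>v. norm (B v) \<le> norm v * M"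
    using B bounded_linear.pos_bounded by blast
  note lin = bounded_linear.linear[OF B]
  show ?thesis unfolding strict_deriv_def
  proof (intro conjI allI impI)
    show "bounded_linear (\<lambda>v. B (A v))"
      using bounded_linear_compose B f unfolding strict_deriv_def by blast
    fix \<eta> :: real assume \<eta>: "\<eta> > 0"
    then have "\<eta> / M > 0" using M by simp
    then obtain r where r: "r > 0" "\<And>p q. norm p \<le> r \<Longrightarrow> norm q \<le> r \<Longrightarrow> norm (f p - f q - A (p - q)) \<le> \<eta> / M * norm (p - q)"
      using strict_derivD[OF f] by metis
    show "\<exists>r>0. \<forall>p q. norm p \<le> r \<and> norm q \<le> r \<longrightarrow> norm (B (f p) - B (f q) - B (A (p - q))) \<le> \<eta> * norm (p - q)"
    proof (intro exI[of _ r] conjI allI impI)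
      fix p q :: 'a assume pq: "norm p \<le> r \<and> norm q \<le> r"
      have "norm (B (f p - f q - A (p - q))) \<le> norm (f p - f q - A (p - q)) * M" by (rule M)
      also have "\<dots> \<le> (\<eta> / M * norm (p - q)) * M"
        by (rule mult_right_mono[OF r(2)]) (use pq M in simp_all)
      also have "\<dots> = \<eta> * norm (p - q)" using M by simp
      finally show "norm (B (f p) - B (f q) - B (A (p - q))) \<le> \<eta> * norm (p - q)"
        by (simp add: linear_diff[OF lin])
    qed (use r in auto)
  qed
qed

lemma strict_deriv_add:
  fixes f :: "'a::real_normed_vector \<Rightarrow> 'b::real_normed_vector"
  assumes f: "strict_deriv f A" and g: "strict_deriv g B"
  shows "strict_deriv (\<lambda>p. f p + g p) (\<lambda>v. A v + B v)"
  unfolding strict_deriv_def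
proof (intro conjI allI impI)
  show "bounded_linear (\<lambda>v. A v + B v)"
    using f g bounded_linear_add unfolding strict_deriv_def by blast
  fix \<eta> :: real assume \<eta>: "\<eta> > 0"
  then have \<eta>2: "\<eta> / 2 > 0" by simp
  obtain r1 where r1: "r1 > 0" "\<And>p q. norm p \<le> r1 \<Longrightarrow> norm q \<le> r1 \<Longrightarrow> norm (f p - f q - A (p - q)) \<le> \<eta> / 2 * norm (p - q)"
    using strict_derivD[OF f \<eta>2] by metis
  obtain r2 where r2: "r2 > 0" "\<And>p q. norm p \<le> r2 \<Longrightarrow> norm q \<le> r2 \<Longrightarrow> norm (g p - g q - B (p - q)) \<le> \<eta> / 2 * norm (p - q)"
    using strict_derivD[OF g \<eta>2] by metis
  show "\<exists>r>0. \<forall>p q. norm p \<le> r \<and> norm q \<le> r \<longrightarrow> norm (f p + g p - (f q + g q) - (A (p - q) + B (p - q))) \<le> \<eta> * norm (p - q)"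
  proof (intro exI[of _ "min r1 r2"] conjI allI impI)
    fix p q :: 'a assume pq: "norm p \<le> min r1 r2 \<and> norm q \<le> min r1 r2"
    have eq: "f p + g p - (f q + g q) - (A (p - q) + B (p - q)) = (f p - f q - A (p - q)) + (g p - g q - B (p - q))"
      by simp
    show "norm (f p + g p - (f q + g q) - (A (p - q) + B (p - q))) \<le> \<eta> * norm (p - q)"
      unfolding eq
      using r1(2)[of p q] r2(2)[of p q] pq
        norm_triangle_ineq[of "f p - f q - A (p - q)" "g p - g q - B (p - q)"]
      by linarith
  qed (use r1 r2 in auto)
qed

lemma strict_deriv_Pair:
  assumes f: "strict_deriv f A" and g: "strict_deriv g B"
  shows "strict_deriv (\<lambda>p. (f p, g p)) (\<lambda>v. (A v, B v))"
  using strict_deriv_add[OF strict_deriv_linear_compose[OF f, of "\<lambda>x. (x, 0)"]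
      strict_deriv_linear_compose[OF g, of "\<lambda>x. (0, x)"]]
  by (simp add: bounded_linear_Pair bounded_linear_ident bounded_linear_zero)

text \<open>The product rule for a general bilinear map serves three purposes: the evaluation of the
  derivative of \<open>H\<close> at a vector field, products of real functions, and scaling of
  vectors.\<close>

lemma (in bounded_bilinear) strict_deriv:
  fixes f :: "'d::real_normed_vector \<Rightarrow> 'a" and g :: "'d \<Rightarrow> 'b"
  assumes f: "strict_deriv f A" and g: "strict_deriv g B"
  shows "strict_deriv (\<lambda>p. prod (f p) (g p)) (\<lambda>v. prod (f 0) (B v) + prod (A v) (g 0))"
proof -
  have A: "bounded_linear A" and B: "bounded_linear B" using f g by (auto simp: strict_deriv_def)
  obtain M where M: "M > 0" "\<And>a b. norm (prod a b) \<le> norm a * norm b * M"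
    using pos_bounded by blast
  have le: "norm (prod a b) \<le> x * y * M" if "norm a \<le> x" "norm b \<le> y" for a b x y
    using that M(1)
    by (intro order_trans[OF M(2)] mult_right_mono mult_mono) (auto intro: order_trans[OF norm_ge_zero])
  obtain r1 K where r1: "r1 > 0" "K > 0"
    "\<And>p q. norm p \<le> r1 \<Longrightarrow> norm q \<le> r1 \<Longrightarrow> norm (f p - f q) \<le> K * norm (p - q)"
    using strict_deriv_lipschitz[OF f] by metis
  obtain r2 N where r2: "r2 > 0" "N > 0"
    "\<And>p q. norm p \<le> r2 \<Longrightarrow> norm q \<le> r2 \<Longrightarrow> norm (g p - g q) \<le> N * norm (p - q)"
    using strict_deriv_lipschitz[OF g] by metis
  show ?thesis unfolding strict_deriv_def
  proof (intro conjI allI impI)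
    show "bounded_linear (\<lambda>v. prod (f 0) (B v) + prod (A v) (g 0))"
      by (intro bounded_linear_add bounded_linear_compose[OF bounded_linear_right B]
          bounded_linear_compose[OF bounded_linear_left A])
    fix \<eta> :: real assume \<eta>: "\<eta> > 0"
    \<comment> \<open>\<open>\<kappa>\<close> pays for the two linear remainders, which are
      multiplied by the fixed values \<open>f 0\<close> and \<open>g 0\<close>; \<open>s3\<close>
      pays for the two products of increments. Each pair costs \<open>\<eta> / 2\<close>. The
      summand 1 keeps the divisor positive if both values vanish.\<close>
    define c where "c = norm (f 0) + norm (g 0) + 1"
    have c: "c > 0" unfolding c_def by (simp add: add_nonneg_pos)
    define \<kappa> where "\<kappa> = \<eta> / (2 * M * c)"
    have \<kappa>: "\<kappa> > 0" using \<eta> M c by (simp add: \<kappa>_def)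
    obtain s1 where s1: "s1 > 0" "\<And>p q. norm p \<le> s1 \<Longrightarrow> norm q \<le> s1 \<Longrightarrow> norm (f p - f q - A (p - q)) \<le> \<kappa> * norm (p - q)"
      using strict_derivD[OF f \<kappa>] by metis
    obtain s2 where s2: "s2 > 0" "\<And>p q. norm p \<le> s2 \<Longrightarrow> norm q \<le> s2 \<Longrightarrow> norm (g p - g q - B (p - q)) \<le> \<kappa> * norm (p - q)"
      using strict_derivD[OF g \<kappa>] by metis
    define s3 where "s3 = \<eta> / (4 * M * K * N)"
    have s3: "s3 > 0" using \<eta> M r1 r2 by (simp add: s3_def)
    define s where "s = Min {r1, r2, s1, s2, s3}"
    have s: "s > 0" "s \<le> r1" "s \<le> r2" "s \<le> s1" "s \<le> s2" "s \<le> s3"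
      using r1 r2 s1 s2 s3 by (auto simp: s_def)
    show "\<exists>r>0. \<forall>p q. norm p \<le> r \<and> norm q \<le> r \<longrightarrow>
        norm (prod (f p) (g p) - prod (f q) (g q) - (prod (f 0) (B (p - q)) + prod (A (p - q)) (g 0))) \<le> \<eta> * norm (p - q)"
    proof (intro exI[of _ s] conjI allI impI)
      fix p q :: 'd assume "norm p \<le> s \<and> norm q \<le> s"
      then have p: "norm p \<le> s" and q: "norm q \<le> s" by auto
      define d where "d = norm (p - q)"
      have d: "d \<ge> 0" by (simp add: d_def)
      have id: "prod (f p) (g p) - prod (f q) (g q) - (prod (f 0) (B (p - q)) + prod (A (p - q)) (g 0))
        = prod (f 0) (g p - g q - B (p - q)) + prod (f p - f q - A (p - q)) (g 0)
          + prod (f p - f 0) (g p - g q) + prod (f p - f q) (g q - g 0)"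
        by (simp add: add_left add_right diff_left diff_right algebra_simps)
      have 1: "norm (prod (f 0) (g p - g q - B (p - q))) \<le> norm (f 0) * (\<kappa> * d) * M"
        using s2(2)[of p q] p q s d_def by (intro le) auto
      have 2: "norm (prod (f p - f q - A (p - q)) (g 0)) \<le> (\<kappa> * d) * norm (g 0) * M"
        using s1(2)[of p q] p q s d_def by (intro le) auto
      have "norm (f p - f 0) \<le> K * norm p" using r1(3)[of p 0] p s r1 by simp
      also have "\<dots> \<le> K * s3" using p s r1 by (intro mult_left_mono) auto
      finally have 3: "norm (prod (f p - f 0) (g p - g q)) \<le> (K * s3) * (N * d) * M"
        using r2(3)[of p q] p q s d_def by (intro le) auto
      have "norm (g q - g 0) \<le> N * norm q" using r2(3)[of q 0] q s r2 by simp
      also have "\<dots> \<le> N * s3" using q s r2 by (intro mult_left_mono) auto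
      finally have 4: "norm (prod (f p - f q) (g q - g 0)) \<le> (K * d) * (N * s3) * M"
        using r1(3)[of p q] p q s d_def by (intro le) auto
      have "norm (f 0) * (\<kappa> * d) * M + (\<kappa> * d) * norm (g 0) * M = (\<kappa> * M * d) * (norm (f 0) + norm (g 0))"
        by (simp add: algebra_simps)
      also have "\<dots> \<le> (\<kappa> * M * d) * c"
        using \<kappa> M d by (intro mult_left_mono) (auto simp: c_def)
      also have "\<dots> = \<eta> / 2 * d" using M c by (simp add: \<kappa>_def)
      finally have 5: "norm (f 0) * (\<kappa> * d) * M + (\<kappa> * d) * norm (g 0) * M \<le> \<eta> / 2 * d" .
      have 6: "(K * s3) * (N * d) * M + (K * d) * (N * s3) * M = \<eta> / 2 * d"
        using M r1 r2 by (simp add: s3_def field_simps)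
      show "norm (prod (f p) (g p) - prod (f q) (g q) - (prod (f 0) (B (p - q)) + prod (A (p - q)) (g 0))) \<le> \<eta> * norm (p - q)"
        unfolding id d_def[symmetric]
        using 1 2 3 4 5 6
          norm_triangle_ineq[of "prod (f 0) (g p - g q - B (p - q)) + prod (f p - f q - A (p - q)) (g 0)
          + prod (f p - f 0) (g p - g q)" "prod (f p - f q) (g q - g 0)"]
          norm_triangle_ineq[of "prod (f 0) (g p - g q - B (p - q)) + prod (f p - f q - A (p - q)) (g 0)"
           "prod (f p - f 0) (g p - g q)"]
          norm_triangle_ineq[of "prod (f 0) (g p - g q - B (p - q))" "prod (f p - f q - A (p - q)) (g 0)"]
        by linarith
    qed (use s in auto)
  qed
qed

text \<open>The mean value inequality applied to \<open>f - D 0\<close>, whose derivative is small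
  near the origin by continuity of \<open>D\<close>.\<close>

lemma strict_deriv_C1:
  fixes f :: "'a::real_normed_vector \<Rightarrow> 'b::real_normed_vector"
  assumes f: "\<And>p. (f has_derivative blinfun_apply (D p)) (at p)" and D: "isCont D 0"
  shows "strict_deriv f (blinfun_apply (D 0))"
  unfolding strict_deriv_def
proof (intro conjI allI impI)
  show "bounded_linear (blinfun_apply (D 0))" by (rule blinfun.bounded_linear_right)
  fix \<eta> :: real assume \<eta>: "\<eta> > 0"
  obtain s where s: "s > 0" "\<And>p. norm p < s \<Longrightarrow> norm (D p - D 0) < \<eta>"
    using D \<eta> unfolding continuous_at_eps_delta by (auto simp: dist_norm)
  show "\<exists>r>0. \<forall>p q. norm p \<le> r \<and> norm q \<le> r \<longrightarrow> norm (f p - f q - blinfun_apply (D 0) (p - q)) \<le> \<eta> * norm (p - q)"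
  proof (intro exI[of _ "s / 2"] conjI allI impI)
    fix p q :: 'a assume pq: "norm p \<le> s / 2 \<and> norm q \<le> s / 2"
    have "norm ((\<lambda>x. f x - blinfun_apply (D 0) x) p - (\<lambda>x. f x - blinfun_apply (D 0) x) q) \<le> \<eta> * norm (p - q)"
    proof (rule differentiable_bound[where S = "cball 0 (s/2)" and f' = "\<lambda>x v. blinfun_apply (D x) v - blinfun_apply (D 0) v"])
      fix x :: 'a assume x: "x \<in> cball 0 (s / 2)"
      show "((\<lambda>x. f x - blinfun_apply (D 0) x) has_derivative (\<lambda>v. blinfun_apply (D x) v - blinfun_apply (D 0) v)) (at x within cball 0 (s/2))"
        by (intro has_derivative_diff has_derivative_at_withinI[OF f] bounded_linear_imp_has_derivative blinfun.bounded_linear_right)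
      have "onorm (blinfun_apply (D x - D 0)) \<le> \<eta>"
        using s(2)[of x] s(1) x by (simp add: norm_blinfun.rep_eq[symmetric] less_imp_le)
      then show "onorm (\<lambda>v. blinfun_apply (D x) v - blinfun_apply (D 0) v) \<le> \<eta>"
        unfolding blinfun.diff_left .
    qed (use pq in auto)
    then show "norm (f p - f q - blinfun_apply (D 0) (p - q)) \<le> \<eta> * norm (p - q)"
      by (simp add: blinfun.diff_right algebra_simps)
  qed (use s in auto)
qed

lemma strict_deriv_inverse:
  fixes f :: "'a::real_normed_vector \<Rightarrow> real"
  assumes f: "strict_deriv f A" and f0: "f 0 \<noteq> 0"
  shows "strict_deriv (\<lambda>p. inverse (f p)) (\<lambda>v. - (A v) / (f 0)\<^sup>2)"
proof -
  have A: "bounded_linear A" using f by (auto simp: strict_deriv_def)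
  obtain B where B: "B > 0" "\<And>v. norm (A v) \<le> norm v * B" using bounded_linear.pos_bounded[OF A] by blast
  obtain r1 K where r1: "r1 > 0" "K > 0"
    "\<And>p q. norm p \<le> r1 \<Longrightarrow> norm q \<le> r1 \<Longrightarrow> norm (f p - f q) \<le> K * norm (p - q)"
    using strict_deriv_lipschitz[OF f] by metis
  define a where "a = \<bar>f 0\<bar>"
  have a: "a > 0" using f0 by (simp add: a_def)
  show ?thesis unfolding strict_deriv_def
  proof (intro conjI allI impI)
    show "bounded_linear (\<lambda>v. - (A v) / (f 0)\<^sup>2)"
      by (intro bounded_linear_minus bounded_linear_compose[OF bounded_linear_divide] A)
    fix \<eta> :: real assume \<eta>: "\<eta> > 0"
    define \<kappa> where "\<kappa> = \<eta> * a\<^sup>2 / 8"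
    have \<kappa>: "\<kappa> > 0" using \<eta> a by (simp add: \<kappa>_def)
    obtain s1 where s1: "s1 > 0" "\<And>p q. norm p \<le> s1 \<Longrightarrow> norm q \<le> s1 \<Longrightarrow> norm (f p - f q - A (p - q)) \<le> \<kappa> * norm (p - q)"
      using strict_derivD[OF f \<kappa>] by metis
    \<comment> \<open>The first bound keeps \<open>f\<close> between \<open>a / 2\<close> and
      \<open>2 * a\<close> in modulus. The second one makes the term with
      \<open>x * y - z\<^sup>2\<close> in the expansion below cost at most
      \<open>\<eta> / 2\<close>; the linear remainder costs the other half.\<close>
    define e where "e = min (a / 2) (\<eta> * a ^ 3 / (24 * B))"
    have e: "e > 0" "e \<le> a / 2" "e \<le> \<eta> * a ^ 3 / (24 * B)" using \<eta> a B by (auto simp: e_def)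
    define s where "s = Min {r1, s1, e / K}"
    have s: "s > 0" "s \<le> r1" "s \<le> s1" "s \<le> e / K" using r1 s1 e by (auto simp: s_def)
    have near: "\<bar>f p - f 0\<bar> \<le> e" if "norm p \<le> s" for p
    proof -
      have "\<bar>f p - f 0\<bar> \<le> K * norm p" using r1(3)[of p 0] that s r1 by simp
      also have "\<dots> \<le> K * (e / K)" using that s r1 by (intro mult_left_mono) auto
      finally show ?thesis using r1 by simp
    qed
    show "\<exists>r>0. \<forall>p q. norm p \<le> r \<and> norm q \<le> r \<longrightarrow>
        norm (inverse (f p) - inverse (f q) - - A (p - q) / (f 0)\<^sup>2) \<le> \<eta> * norm (p - q)"
    proof (intro exI[of _ s] conjI allI impI)
      fix p q :: 'a assume "norm p \<le> s \<and> norm q \<le> s"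
      then have p: "norm p \<le> s" and q: "norm q \<le> s" by auto
      define d where "d = norm (p - q)"
      have d: "d \<ge> 0" by (simp add: d_def)
      define x y z where "x = f p" "y = f q" "z = f 0"
      have x: "\<bar>x - z\<bar> \<le> e" "\<bar>y - z\<bar> \<le> e" and z: "\<bar>z\<bar> = a" using near[OF p] near[OF q] by (auto simp: x_y_z_def a_def)
      have xa: "\<bar>x\<bar> \<ge> a / 2" "\<bar>y\<bar> \<ge> a / 2" "\<bar>x\<bar> \<le> 2 * a" using x z e by auto
      then have nz: "x \<noteq> 0" "y \<noteq> 0" "z \<noteq> 0" using a z by auto
      have "(a / 2) * (a / 2) \<le> \<bar>x\<bar> * \<bar>y\<bar>" using xa a by (intro mult_mono) auto
      then have xy: "a\<^sup>2 / 4 \<le> \<bar>x * y\<bar>" by (simp add: abs_mult power2_eq_square)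
      have "inverse x - inverse y - - A (p - q) / z\<^sup>2 =
          - (x - y - A (p - q)) / (x * y) + A (p - q) * (x * y - z\<^sup>2) / (x * y * z\<^sup>2)"
        using nz by (simp add: field_simps power2_eq_square)
      moreover have "\<bar>- (x - y - A (p - q)) / (x * y)\<bar> \<le> \<eta> / 2 * d"
      proof -
        have "\<bar>- (x - y - A (p - q)) / (x * y)\<bar> \<le> (\<kappa> * d) / (a\<^sup>2 / 4)"
          unfolding abs_divide abs_minus_cancel using s1(2)[of p q] p q s a xy
          by (intro frac_le) (auto simp: x_y_z_def d_def)
        then show ?thesis using a by (simp add: \<kappa>_def)
      qed
      moreover have "\<bar>A (p - q) * (x * y - z\<^sup>2) / (x * y * z\<^sup>2)\<bar> \<le> \<eta> / 2 * d"
      proof -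
        have "x * y - z\<^sup>2 = x * (y - z) + z * (x - z)" by (simp add: algebra_simps power2_eq_square)
        then have "\<bar>x * y - z\<^sup>2\<bar> \<le> \<bar>x\<bar> * \<bar>y - z\<bar> + \<bar>z\<bar> * \<bar>x - z\<bar>" by (metis abs_mult abs_triangle_ineq)
        also have "\<dots> \<le> (2 * a) * e + a * e" using x xa z a e by (intro add_mono mult_mono) auto
        finally have 1: "\<bar>x * y - z\<^sup>2\<bar> \<le> 3 * a * e" by simp
        have "\<bar>A (p - q) * (x * y - z\<^sup>2) / (x * y * z\<^sup>2)\<bar> \<le> ((d * B) * (3 * a * e)) / (a\<^sup>2 / 4 * a\<^sup>2)"
          unfolding abs_divide abs_mult
        proof (intro frac_le mult_mono 1)
          show "\<bar>A (p - q)\<bar> \<le> d * B" using B(2)[of "p - q"] by (simp add: d_def)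
          show "a\<^sup>2 / 4 \<le> \<bar>x\<bar> * \<bar>y\<bar>" using xy by (simp add: abs_mult)
          show "a\<^sup>2 \<le> \<bar>z\<^sup>2\<bar>" using z by (metis abs_power2 order_refl power2_abs)
        qed (use d B a e in auto)
        also have "\<dots> = e * (12 * B / a ^ 3) * d" using a by (simp add: field_simps power2_eq_square power3_eq_cube)
        also have "\<dots> \<le> (\<eta> * a ^ 3 / (24 * B)) * (12 * B / a ^ 3) * d"
          using e a B d by (intro mult_right_mono) auto
        also have "\<dots> = \<eta> / 2 * d" using a B by simp
        finally show ?thesis .
      qed
      ultimately have "\<bar>inverse x - inverse y - - A (p - q) / z\<^sup>2\<bar> \<le> \<eta> * d" by linarith
      then show "norm (inverse (f p) - inverse (f q) - - A (p - q) / (f 0)\<^sup>2) \<le> \<eta> * norm (p - q)"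
        by (simp add: x_y_z_def d_def)
    qed (use s in auto)
  qed
qed

section \<open>Linearisation of a Filippov system\<close>

text \<open>The hypotheses are reduced to data at the origin: \<open>b\<close> and \<open>c\<close>
  are the derivatives of \<open>H\<close> in \<open>y\<close> and in the parameter,
  \<open>aij\<close> is the Jacobian matrix of the lower field. That \<open>DH0\<close> contains no
  term in \<open>x\<close> is the condition that the \<open>x\<close>-derivative of \<open>H\<close>
  vanishes.\<close>

locale filippov_fold =
  fixes fp gp fm gm :: "real \<times> real \<Rightarrow> real"
    and H :: "real \<times> real \<Rightarrow> real \<Rightarrow> real"
    and DH :: "(real \<times> real) \<times> real \<Rightarrow> ((real \<times> real) \<times> real) \<Rightarrow>\<^sub>L real"
    and D2H :: "(real \<times> real) \<times> real \<Rightarrow> ((real \<times> real) \<times> real) \<Rightarrow>\<^sub>L real"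
    and DFp :: "real \<times> real \<Rightarrow> real \<times> real"
    and b c a11 a12 a21 a22 :: real
  assumes H_deriv: "\<And>p. ((\<lambda>(z, e). H z e) has_derivative blinfun_apply (DH p)) (at p)"
    and DH_cont: "isCont DH 0"
    and DH_strict: "strict_deriv DH D2H"
    and Fm_strict': "strict_deriv (\<lambda>z. (fm z, gm z)) (\<lambda>z. (a11 * fst z + a12 * snd z, a21 * fst z + a22 * snd z))"
    and Fp_strict': "strict_deriv (\<lambda>z. (fp z, gp z)) DFp"
    and Fm_cont': "continuous_on UNIV (\<lambda>z. (fm z, gm z))"
    and Fp_cont': "continuous_on UNIV (\<lambda>z. (fp z, gp z))"
    and zero: "fm 0 = 0" "gm 0 = 0" "H 0 0 = 0"
    and DH0: "\<And>x y e. blinfun_apply (DH 0) ((x, y), e) = b * y + c * e"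
    and b: "b \<noteq> 0" and bgp: "b * gp 0 < 0" and a21: "a21 \<noteq> 0"
begin

text \<open>\<open>Lm\<close> is the derivative of \<^term>\<open>H\<close> along the lower field and \<open>Lm + W\<close> the one along the upper field.
  Off the switching curve, \<open>S\<close> extends the sliding field so that \<^term>\<open>H\<close> is a first integral of it;
  \<open>Sig\<close> is its linearisation.\<close>

definition Fm where "Fm z = (fm z, gm z)"
definition Fp where "Fp z = (fp z, gp z)"
definition V where "V z = Fp z - Fm z"
definition J where "J z = (a11 * fst z + a12 * snd z, a21 * fst z + a22 * snd z)"
definition ell where "ell z = b * (a21 * fst z + a22 * snd z)"
definition Lm where "Lm z e = blinfun_apply (DH (z, e)) (Fm z, 0)"
definition W where "W z e = blinfun_apply (DH (z, e)) (V z, 0)"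
definition S where "S z e = Fm z - (Lm z e / W z e) *\<^sub>R V z"
definition Sig where "Sig z = J z - (ell z / (b * gp 0)) *\<^sub>R Fp 0"

lemma Fm_strict: "strict_deriv Fm J" and Fp_strict: "strict_deriv Fp DFp"
  using Fm_strict' Fp_strict' unfolding Fm_def[abs_def] Fp_def[abs_def] J_def[abs_def] .

lemma Fm_cont: "continuous_on UNIV Fm" and Fp_cont: "continuous_on UNIV Fp"
  using Fm_cont' Fp_cont' unfolding Fm_def[abs_def] Fp_def[abs_def] .

lemma Fm0: "Fm 0 = 0" by (simp add: Fm_def zero zero_prod_def[symmetric])
lemma gp0: "gp 0 \<noteq> 0" using bgp by auto
lemma W0: "W 0 0 = b * gp 0"
  using DH0[of "fp 0" "gp 0" 0] by (simp add: W_def V_def Fm0 Fp_def zero_prod_def[symmetric])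
lemma L0: "Lm 0 0 = 0" by (simp add: Lm_def Fm0 zero_prod_def[symmetric] blinfun.zero_right)
lemma S0: "S 0 0 = 0" by (simp add: S_def L0 Fm0)
lemma V0: "V 0 = Fp 0" by (simp add: V_def Fm0)
lemma DH0': "blinfun_apply (DH 0) v = b * snd (fst v) + c * snd v"
  using DH0[of "fst (fst v)" "snd (fst v)" "snd v"] by simp

lemma H_strict: "strict_deriv (\<lambda>p. H (fst p) (snd p)) (\<lambda>v. b * snd (fst v) + c * snd v)"
proof -
  have "(\<lambda>(z, e). H z e) = (\<lambda>p. H (fst p) (snd p))" by (simp add: fun_eq_iff)
  moreover have "blinfun_apply (DH 0) = (\<lambda>v. b * snd (fst v) + c * snd v)" by (simp add: fun_eq_iff DH0)
  ultimately show ?thesis using strict_deriv_C1[OF H_deriv DH_cont] by simp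
qed

lemma Fm_fst_strict: "strict_deriv (\<lambda>p::(real\<times>real)\<times>real. Fm (fst p)) (\<lambda>v. J (fst v))"
  by (rule strict_deriv_compose_linear[OF Fm_strict bounded_linear_fst])

lemma V_strict: "strict_deriv V (\<lambda>v. DFp v - J v)"
  using strict_deriv_add[OF Fp_strict strict_deriv_linear_compose[OF Fm_strict bounded_linear_minus[OF bounded_linear_ident]]]
  by (simp add: V_def[abs_def])

lemma V_fst_strict: "strict_deriv (\<lambda>p::(real\<times>real)\<times>real. V (fst p)) (\<lambda>v. DFp (fst v) - J (fst v))"
  by (rule strict_deriv_compose_linear[OF V_strict bounded_linear_fst])

lemma bl_embed: "bounded_linear (\<lambda>z::real\<times>real. (z, 0::real))"
  by (intro bounded_linear_Pair bounded_linear_ident bounded_linear_zero)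

text \<open>In the product rule the second derivative of \<open>H\<close> is paired with
  \<open>Fm 0 = 0\<close> and drops out, so the linearisation depends on the Jacobian matrix of the
  lower field and on \<open>b\<close> alone.\<close>

lemma L_strict: "strict_deriv (\<lambda>p. Lm (fst p) (snd p)) (\<lambda>v. ell (fst v))"
proof -
  from bounded_bilinear.strict_deriv[OF bounded_bilinear_blinfun_apply DH_strict
        strict_deriv_linear_compose[OF Fm_fst_strict bl_embed]]
  show ?thesis
    by (simp add: Lm_def[abs_def] Fm0 zero_prod_def[symmetric] blinfun.zero_right DH0' J_def ell_def[abs_def])
qed

lemma W_strict: "\<exists>A. strict_deriv (\<lambda>p. W (fst p) (snd p)) A"
  using bounded_bilinear.strict_deriv[OF bounded_bilinear_blinfun_apply DH_strict
        strict_deriv_linear_compose[OF V_fst_strict bl_embed]]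
  unfolding W_def by auto

text \<open>Since \<open>Lm 0 0 = 0\<close>, the derivatives of \<open>W\<close> and of
  \<open>V\<close> are multiplied by zero. It is therefore enough to know that \<open>W\<close> has
  some strict derivative.\<close>

lemma S_strict: "strict_deriv (\<lambda>p. S (fst p) (snd p)) (\<lambda>v. Sig (fst v))"
proof -
  obtain A where A: "strict_deriv (\<lambda>p. W (fst p) (snd p)) A" using W_strict by blast
  have "W (fst 0) (snd 0) \<noteq> 0" using W0 b gp0 by simp
  from bounded_bilinear.strict_deriv[OF bounded_bilinear_mult L_strict strict_deriv_inverse[OF A this]]
  have "strict_deriv (\<lambda>p. Lm (fst p) (snd p) * inverse (W (fst p) (snd p))) (\<lambda>v. ell (fst v) / (b * gp 0))"
    by (simp add: L0 W0 field_simps)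
  from bounded_bilinear.strict_deriv[OF bounded_bilinear_scaleR this V_fst_strict]
  have "strict_deriv (\<lambda>p. (Lm (fst p) (snd p) / W (fst p) (snd p)) *\<^sub>R V (fst p))
      (\<lambda>v. (ell (fst v) / (b * gp 0)) *\<^sub>R Fp 0)"
    by (simp add: L0 V0 divide_inverse)
  from strict_deriv_add[OF Fm_fst_strict strict_deriv_linear_compose[OF this bounded_linear_minus[OF bounded_linear_ident]]]
  show ?thesis by (simp add: S_def[abs_def] Sig_def[abs_def])
qed

lemma J_lin: "bounded_linear J" using Fm_strict by (simp add: strict_deriv_def)

lemma ell_lin: "bounded_linear ell"
  unfolding ell_def[abs_def]
  by (intro bounded_linear_const_mult bounded_linear_add bounded_linear_compose[OF bounded_linear_mult_right]
      bounded_linear_fst bounded_linear_snd)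

lemma Sig_lin: "bounded_linear Sig"
  unfolding Sig_def[abs_def]
  by (intro bounded_linear_sub J_lin bounded_linear_scaleR_const bounded_linear_compose[OF bounded_linear_divide ell_lin])

lemma norm_pair_le: "norm (z::real\<times>real, e::real) \<le> norm z + \<bar>e\<bar>"
  using norm_Pair_le[of z e] by simp

text \<open>Strict differentiability in \<open>(z, e)\<close> is used in two ways: at two points
  with the same \<open>e\<close> it bounds the Lipschitz constant of the remainder, and with one
  point at the origin it bounds the remainder itself.\<close>

lemma estimates:
  assumes \<eta>: "\<eta> > 0"
  obtains r where "r > 0"
    "\<And>z z'. norm z \<le> r \<Longrightarrow> norm z' \<le> r \<Longrightarrow> norm (Fm z - Fm z' - J (z - z')) \<le> \<eta> * norm (z - z')"
    "\<And>z z' e. norm z \<le> r \<Longrightarrow> norm z' \<le> r \<Longrightarrow> \<bar>e\<bar> \<le> r \<Longrightarrow> \<bar>H z e - H z' e - b * snd (z - z')\<bar> \<le> \<eta> * norm (z - z')"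
    "\<And>z e. norm z \<le> r \<Longrightarrow> \<bar>e\<bar> \<le> r \<Longrightarrow> \<bar>H z e - (b * snd z + c * e)\<bar> \<le> \<eta> * (norm z + \<bar>e\<bar>)"
    "\<And>z z' e. norm z \<le> r \<Longrightarrow> norm z' \<le> r \<Longrightarrow> \<bar>e\<bar> \<le> r \<Longrightarrow> \<bar>Lm z e - Lm z' e - ell (z - z')\<bar> \<le> \<eta> * norm (z - z')"
    "\<And>z e. norm z \<le> r \<Longrightarrow> \<bar>e\<bar> \<le> r \<Longrightarrow> \<bar>Lm z e - ell z\<bar> \<le> \<eta> * (norm z + \<bar>e\<bar>)"
    "\<And>z z' e. norm z \<le> r \<Longrightarrow> norm z' \<le> r \<Longrightarrow> \<bar>e\<bar> \<le> r \<Longrightarrow> norm (S z e - S z' e - Sig (z - z')) \<le> \<eta> * norm (z - z')"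
    "\<And>z e. norm z \<le> r \<Longrightarrow> \<bar>e\<bar> \<le> r \<Longrightarrow> norm (S z e - Sig z) \<le> \<eta> * (norm z + \<bar>e\<bar>)"
proof -
  have pairs: "\<exists>r>0. (\<forall>z z' e. norm z \<le> r \<and> norm z' \<le> r \<and> \<bar>e\<bar> \<le> r \<longrightarrow> norm (f z e - f z' e - A (z - z', 0)) \<le> \<eta> * norm (z - z'))
      \<and> (\<forall>z e. norm z \<le> r \<and> \<bar>e\<bar> \<le> r \<longrightarrow> norm (f z e - f 0 0 - A (z, e)) \<le> \<eta> * (norm z + \<bar>e\<bar>))"
    if sf: "strict_deriv (\<lambda>p. f (fst p) (snd p)) A"
    for f :: "real \<times> real \<Rightarrow> real \<Rightarrow> 'a::real_normed_vector" and A
  proof -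
    obtain r where r: "r > 0" "\<And>p q. norm p \<le> r \<Longrightarrow> norm q \<le> r \<Longrightarrow>
       norm (f (fst p) (snd p) - f (fst q) (snd q) - A (p - q)) \<le> \<eta> * norm (p - q)"
      using strict_derivD[OF sf \<eta>] by metis
    have small: "norm (z, e) \<le> r" if "norm z \<le> r/2" "\<bar>e\<bar> \<le> r/2" for z :: "real\<times>real" and e :: real
      using norm_pair_le[of z e] that by linarith
    show ?thesis
    proof (intro exI[of _ "r/2"] conjI allI impI)
      fix z z' :: "real\<times>real" and e :: real assume a: "norm z \<le> r/2 \<and> norm z' \<le> r/2 \<and> \<bar>e\<bar> \<le> r/2"
      show "norm (f z e - f z' e - A (z - z', 0)) \<le> \<eta> * norm (z - z')"
        using r(2)[OF small[of z e] small[of z' e]] a by (simp add: norm_Pair)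
    next
      fix z :: "real\<times>real" and e :: real assume a: "norm z \<le> r/2 \<and> \<bar>e\<bar> \<le> r/2"
      have "norm (f z e - f 0 0 - A (z, e)) \<le> \<eta> * norm (z, e)"
        using r(2)[OF small[of z e], of 0] a r(1) by simp
      also have "\<dots> \<le> \<eta> * (norm z + \<bar>e\<bar>)" using norm_pair_le \<eta> by (intro mult_left_mono) auto
      finally show "norm (f z e - f 0 0 - A (z, e)) \<le> \<eta> * (norm z + \<bar>e\<bar>)" .
    qed (use r in auto)
  qed
  obtain r1 where r1: "r1 > 0" "\<And>z z'. norm z \<le> r1 \<Longrightarrow> norm z' \<le> r1 \<Longrightarrow> norm (Fm z - Fm z' - J (z - z')) \<le> \<eta> * norm (z - z')"
    using strict_derivD[OF Fm_strict \<eta>] by metis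
  obtain r2 where r2: "r2 > 0" "\<And>z z' e. norm z \<le> r2 \<and> norm z' \<le> r2 \<and> \<bar>e\<bar> \<le> r2 \<Longrightarrow> \<bar>H z e - H z' e - b * snd (z - z')\<bar> \<le> \<eta> * norm (z - z')"
    "\<And>z e. norm z \<le> r2 \<and> \<bar>e\<bar> \<le> r2 \<Longrightarrow> \<bar>H z e - (b * snd z + c * e)\<bar> \<le> \<eta> * (norm z + \<bar>e\<bar>)"
    using pairs[OF H_strict] by (auto simp: zero)
  obtain r3 where r3: "r3 > 0" "\<And>z z' e. norm z \<le> r3 \<and> norm z' \<le> r3 \<and> \<bar>e\<bar> \<le> r3 \<Longrightarrow> \<bar>Lm z e - Lm z' e - ell (z - z')\<bar> \<le> \<eta> * norm (z - z')"
    "\<And>z e. norm z \<le> r3 \<and> \<bar>e\<bar> \<le> r3 \<Longrightarrow> \<bar>Lm z e - ell z\<bar> \<le> \<eta> * (norm z + \<bar>e\<bar>)"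
    using pairs[OF L_strict] by (auto simp: L0)
  obtain r4 where r4: "r4 > 0" "\<And>z z' e. norm z \<le> r4 \<and> norm z' \<le> r4 \<and> \<bar>e\<bar> \<le> r4 \<Longrightarrow> norm (S z e - S z' e - Sig (z - z')) \<le> \<eta> * norm (z - z')"
    "\<And>z e. norm z \<le> r4 \<and> \<bar>e\<bar> \<le> r4 \<Longrightarrow> norm (S z e - Sig z) \<le> \<eta> * (norm z + \<bar>e\<bar>)"
    using pairs[OF S_strict] by (auto simp: S0)
  show ?thesis
    by (rule that[of "min (min r1 r2) (min r3 r4)"])
      (use r1 r2 r3 r4 in \<open>simp_all del: snd_diff fst_diff\<close>)
qed

text \<open>The determinant of two plane vectors. As a function of its second argument,
  \<open>cross (V z)\<close> annihilates the jump direction \<open>V z\<close> and thus does not see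
  the unknown weight of the upper field.\<close>

definition cross :: "real \<times> real \<Rightarrow> real \<times> real \<Rightarrow> real" where
  "cross v w = fst v * snd w - snd v * fst w"

lemma cross_le: "\<bar>cross v w\<bar> \<le> 2 * (norm v * norm w)"
proof -
  have n: "\<bar>fst v\<bar> \<le> norm v" "\<bar>snd v\<bar> \<le> norm v" "\<bar>fst w\<bar> \<le> norm w" "\<bar>snd w\<bar> \<le> norm w"
    using norm_fst_le[of "fst v" "snd v"] norm_snd_le[of "snd v" "fst v"] norm_fst_le[of "fst w" "snd w"] norm_snd_le[of "snd w" "fst w"]
    by auto
  have "\<bar>cross v w\<bar> \<le> \<bar>fst v * snd w\<bar> + \<bar>snd v * fst w\<bar>" unfolding cross_def by (rule abs_triangle_ineq4)
  also have "\<dots> \<le> norm v * norm w + norm v * norm w"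
    unfolding abs_mult by (intro add_mono mult_mono n) auto
  finally show ?thesis by simp
qed

lemma cross_bilinear: "bounded_bilinear cross"
proof
  show "\<exists>K. \<forall>a b. norm (cross a b) \<le> norm a * norm b * K"
    using cross_le by (intro exI[of _ 2]) (auto simp: mult_ac)
qed (auto simp: cross_def algebra_simps)

text \<open>One ball and one constant for all later uses. The last bound rests on transversality:
  \<open>V 0 = Fp 0\<close> is not tangent to the switching curve because \<open>b * gp 0\<close> is
  nonzero, so \<open>cross (V z)\<close> and \<open>H\<close> together control the distance of two
  points.\<close>

lemma region:
  obtains r K w where "r > 0" "K > 0" "w > 0"
    "\<And>z z'. norm z \<le> r \<Longrightarrow> norm z' \<le> r \<Longrightarrow> norm (Fm z - Fm z') \<le> K * norm (z - z')"
    "\<And>z z'. norm z \<le> r \<Longrightarrow> norm z' \<le> r \<Longrightarrow> norm (V z - V z') \<le> K * norm (z - z')"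
    "\<And>z. norm z \<le> r \<Longrightarrow> norm (Fm z) \<le> K"
    "\<And>z. norm z \<le> r \<Longrightarrow> norm (V z) \<le> K"
    "\<And>z z' e. norm z \<le> r \<Longrightarrow> norm z' \<le> r \<Longrightarrow> \<bar>e\<bar> \<le> r \<Longrightarrow> \<bar>H z e - H z' e\<bar> \<le> K * norm (z - z')"
    "\<And>z z' e. norm z \<le> r \<Longrightarrow> norm z' \<le> r \<Longrightarrow> \<bar>e\<bar> \<le> r \<Longrightarrow> \<bar>Lm z e - Lm z' e\<bar> \<le> K * norm (z - z')"
    "\<And>z z' e. norm z \<le> r \<Longrightarrow> norm z' \<le> r \<Longrightarrow> \<bar>e\<bar> \<le> r \<Longrightarrow> \<bar>W z e - W z' e\<bar> \<le> K * norm (z - z')"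
    "\<And>z e. norm z \<le> r \<Longrightarrow> \<bar>e\<bar> \<le> r \<Longrightarrow> W z e \<le> - w"
    "\<And>z e. norm z \<le> r \<Longrightarrow> \<bar>e\<bar> \<le> r \<Longrightarrow> Lm z e + W z e \<le> - w"
    "\<And>z z' e. norm z \<le> r \<Longrightarrow> norm z' \<le> r \<Longrightarrow> \<bar>e\<bar> \<le> r \<Longrightarrow>
        norm (z - z') \<le> K * (\<bar>cross (V z) (z - z')\<bar> + \<bar>H z e - H z' e\<bar>)"
proof -
  have lip: "\<exists>r>0. \<exists>K>0. \<forall>z z' e e'. norm z \<le> r \<and> norm z' \<le> r \<and> \<bar>e\<bar> \<le> r \<and> \<bar>e'\<bar> \<le> r \<longrightarrow>
      norm (f z e - f z' e') \<le> K * (norm (z - z') + \<bar>e - e'\<bar>)"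
    if sf: "strict_deriv (\<lambda>p. f (fst p) (snd p)) A"
    for f :: "real \<times> real \<Rightarrow> real \<Rightarrow> 'a::real_normed_vector" and A
  proof -
    obtain r K where r: "r > 0" "K > 0" "\<And>p q. norm p \<le> r \<Longrightarrow> norm q \<le> r \<Longrightarrow>
       norm (f (fst p) (snd p) - f (fst q) (snd q)) \<le> K * norm (p - q)"
      using strict_deriv_lipschitz[OF sf] by metis
    have small: "norm (z, e) \<le> r" if "norm z \<le> r/2" "\<bar>e\<bar> \<le> r/2" for z :: "real\<times>real" and e :: real
      using norm_pair_le[of z e] that by linarith
    show ?thesis
    proof (rule exI[of _ "r/2"], intro conjI exI[of _ K] allI impI)
      fix z z' :: "real\<times>real" and e e' :: real
      assume a: "norm z \<le> r/2 \<and> norm z' \<le> r/2 \<and> \<bar>e\<bar> \<le> r/2 \<and> \<bar>e'\<bar> \<le> r/2"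
      have "norm (f z e - f z' e') \<le> K * norm (z - z', e - e')"
        using r(3)[OF small[of z e] small[of z' e']] a by simp
      also have "\<dots> \<le> K * (norm (z - z') + \<bar>e - e'\<bar>)" using norm_pair_le r(2) by (intro mult_left_mono) auto
      finally show "norm (f z e - f z' e') \<le> K * (norm (z - z') + \<bar>e - e'\<bar>)" .
    qed (use r in auto)
  qed
  obtain A where A: "strict_deriv (\<lambda>p. W (fst p) (snd p)) A" using W_strict by blast
  obtain r1 K1 where 1: "r1 > 0" "K1 > 0" "\<And>z z' e e'. norm z \<le> r1 \<and> norm z' \<le> r1 \<and> \<bar>e\<bar> \<le> r1 \<and> \<bar>e'\<bar> \<le> r1 \<Longrightarrow>
      norm (Fm z - Fm z') \<le> K1 * (norm (z - z') + \<bar>e - e'\<bar>)" using lip[of "\<lambda>z e. Fm z", OF Fm_fst_strict] by metis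
  obtain r2 K2 where 2: "r2 > 0" "K2 > 0" "\<And>z z' e e'. norm z \<le> r2 \<and> norm z' \<le> r2 \<and> \<bar>e\<bar> \<le> r2 \<and> \<bar>e'\<bar> \<le> r2 \<Longrightarrow>
      norm (V z - V z') \<le> K2 * (norm (z - z') + \<bar>e - e'\<bar>)" using lip[of "\<lambda>z e. V z", OF V_fst_strict] by metis
  obtain r3 K3 where 3: "r3 > 0" "K3 > 0" "\<And>z z' e e'. norm z \<le> r3 \<and> norm z' \<le> r3 \<and> \<bar>e\<bar> \<le> r3 \<and> \<bar>e'\<bar> \<le> r3 \<Longrightarrow>
      norm (H z e - H z' e') \<le> K3 * (norm (z - z') + \<bar>e - e'\<bar>)" using lip[OF H_strict] by metis
  obtain r4 K4 where 4: "r4 > 0" "K4 > 0" "\<And>z z' e e'. norm z \<le> r4 \<and> norm z' \<le> r4 \<and> \<bar>e\<bar> \<le> r4 \<and> \<bar>e'\<bar> \<le> r4 \<Longrightarrow>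
      norm (Lm z e - Lm z' e') \<le> K4 * (norm (z - z') + \<bar>e - e'\<bar>)" using lip[OF L_strict] by metis
  obtain r5 K5 where 5: "r5 > 0" "K5 > 0" "\<And>z z' e e'. norm z \<le> r5 \<and> norm z' \<le> r5 \<and> \<bar>e\<bar> \<le> r5 \<and> \<bar>e'\<bar> \<le> r5 \<Longrightarrow>
      norm (W z e - W z' e') \<le> K5 * (norm (z - z') + \<bar>e - e'\<bar>)" using lip[OF A] by metis
  \<comment> \<open>Half of \<open>- W 0 0\<close>. Since \<open>Lm 0 0 = 0\<close>, the same margin
    serves \<open>W\<close> and \<open>Lm + W\<close>.\<close>
  define w where "w = - (b * gp 0) / 2"
  have w: "w > 0" using bgp by (simp add: w_def)
  define q where "q = \<bar>gp 0\<bar>"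
  define B where "B = \<bar>b\<bar>"
  define P where "P = norm (Fp 0)"
  have qB: "q > 0" "B > 0" "P \<ge> 0" using gp0 b by (auto simp: q_def B_def P_def)
  define \<kappa> where "\<kappa> = 2 * (P + q) / (B * q) + 2 / q"
  have \<kappa>: "\<kappa> > 0" using qB by (simp add: \<kappa>_def add_nonneg_pos)
  \<comment> \<open>\<^term>\<open>\<kappa>\<close> is chosen so that the linearised pair (cross, H) controls the norm; half of it absorbs the errors.\<close>
  define \<eta> where "\<eta> = 1 / (2 * \<kappa>)"
  have \<eta>: "\<eta> > 0" using \<kappa> by (simp add: \<eta>_def)
  obtain r6 where 6: "r6 > 0" "\<And>z z' e. norm z \<le> r6 \<Longrightarrow> norm z' \<le> r6 \<Longrightarrow> \<bar>e\<bar> \<le> r6 \<Longrightarrow> \<bar>H z e - H z' e - b * snd (z - z')\<bar> \<le> \<eta> * norm (z - z')"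
    using estimates[OF \<eta>] by metis
  define KS where "KS = {K1, K2, K3, K4, K5, K1 * r1, P + K2 * r2, 2 * \<kappa>}"
  define K where "K = Max KS"
  have KS: "x \<le> K" if "x \<in> KS" for x unfolding K_def using that by (intro Max_ge) (auto simp: KS_def)
  have K: "K1 \<le> K" "K2 \<le> K" "K3 \<le> K" "K4 \<le> K" "K5 \<le> K" "K1 * r1 \<le> K" "P + K2 * r2 \<le> K" "2 * \<kappa> \<le> K"
    by (rule KS, simp add: KS_def)+
  have K0: "K > 0" using K(1) 1(2) by linarith
  \<comment> \<open>The two entries with \<open>w\<close> limit the variation of \<open>W\<close>
    and \<open>Lm\<close> on the ball to the margin; the last entry keeps \<open>V z\<close> within
    \<open>\<eta> / 2\<close> of \<open>Fp 0\<close>.\<close>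
  define RS where "RS = {r1, r2, r3, r4, r5, r6, w / (4 * K5), w / (4 * (K4 + K5)), \<eta> / (2 * K2)}"
  define r where "r = Min RS"
  have RS: "r \<le> x" if "x \<in> RS" for x unfolding r_def using that by (intro Min_le) (auto simp: RS_def)
  have r: "r \<le> r1" "r \<le> r2" "r \<le> r3" "r \<le> r4" "r \<le> r5" "r \<le> r6" "r \<le> w / (4 * K5)" "r \<le> w / (4 * (K4 + K5))" "r \<le> \<eta> / (2 * K2)"
    by (rule RS, simp add: RS_def)+
  have "\<forall>x\<in>RS. 0 < x" using 1(1,2) 2(1,2) 3(1,2) 4(1,2) 5(1,2) 6(1) w \<eta> by (simp add: RS_def)
  then have r0: "r > 0" unfolding r_def by (subst Min_gr_iff) (auto simp: RS_def)
  have Kmono: "x \<le> K * n" if "x \<le> k * n" "k \<le> K" "n \<ge> 0" for x k n :: real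
    using that mult_right_mono by (meson order_trans)
  show ?thesis
  proof (rule that[of r K w])
    fix z z' :: "real\<times>real" assume z: "norm z \<le> r" and z': "norm z' \<le> r"
    show "norm (Fm z - Fm z') \<le> K * norm (z - z')"
      by (rule Kmono[of _ K1]) (use 1(3)[of z z' 0 0] z z' r K 1 in auto)
    show "norm (V z - V z') \<le> K * norm (z - z')"
      by (rule Kmono[of _ K2]) (use 2(3)[of z z' 0 0] z z' r K 2 in auto)
  next
    fix z z' :: "real\<times>real" and e :: real
    assume z: "norm z \<le> r"
    show "norm (Fm z) \<le> K"
    proof -
      have "norm (Fm z) \<le> K1 * norm z" using 1(3)[of z 0 0 0] z r 1(1) by (simp add: Fm0)
      also have "\<dots> \<le> K1 * r1" using z r 1 by (intro mult_left_mono) auto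
      finally show ?thesis using K by simp
    qed
    have Vz: "norm (V z - Fp 0) \<le> K2 * norm z" using 2(3)[of z 0 0 0] z r 2(1) by (simp add: V0)
    show "norm (V z) \<le> K"
    proof -
      have "K2 * norm z \<le> K2 * r2" using z r 2 by (intro mult_left_mono) auto
      then show ?thesis using Vz K norm_triangle_ineq[of "Fp 0" "V z - Fp 0"] by (simp add: P_def)
    qed
    assume e: "\<bar>e\<bar> \<le> r"
    have Wz: "\<bar>W z e - b * gp 0\<bar> \<le> K5 * (2 * r)"
    proof -
      have "\<bar>W z e - b * gp 0\<bar> \<le> K5 * (norm z + \<bar>e\<bar>)" using 5(3)[of z 0 e 0] z e r 5(1) by (simp add: W0)
      also have "\<dots> \<le> K5 * (2 * r)" using z e 5 by (intro mult_left_mono) auto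
      finally show ?thesis .
    qed
    moreover have "K5 * (2 * r) \<le> w" using r(7) 5(2) r0 w by (simp add: field_simps)
    ultimately show "W z e \<le> - w" by (simp add: w_def abs_le_iff)
    have "\<bar>Lm z e\<bar> \<le> K4 * (norm z + \<bar>e\<bar>)" using 4(3)[of z 0 e 0] z e r 4(1) by (simp add: L0)
    also have "\<dots> \<le> K4 * (2 * r)" using z e 4 by (intro mult_left_mono) auto
    finally have "\<bar>Lm z e\<bar> \<le> K4 * (2 * r)" .
    moreover have "K4 * (2 * r) + K5 * (2 * r) \<le> w" using r(8) 5(2) 4(2) r0 w by (simp add: field_simps)
    ultimately show "Lm z e + W z e \<le> - w" using Wz by (simp add: w_def abs_le_iff)
    assume z': "norm z' \<le> r"
    show "\<bar>H z e - H z' e\<bar> \<le> K * norm (z - z')"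
      by (rule Kmono[of _ K3]) (use 3(3)[of z z' e e] z z' e r K in auto)
    show "\<bar>Lm z e - Lm z' e\<bar> \<le> K * norm (z - z')"
      by (rule Kmono[of _ K4]) (use 4(3)[of z z' e e] z z' e r K in auto)
    show "\<bar>W z e - W z' e\<bar> \<le> K * norm (z - z')"
      by (rule Kmono[of _ K5]) (use 5(3)[of z z' e e] z z' e r K in auto)
    show "norm (z - z') \<le> K * (\<bar>cross (V z) (z - z')\<bar> + \<bar>H z e - H z' e\<bar>)"
    proof -
      define d where "d = z - z'"
      define n where "n = norm d"
      define X where "X = \<bar>cross (V z) d\<bar> + \<bar>H z e - H z' e\<bar>"
      have n: "n \<ge> 0" and X: "X \<ge> 0" by (auto simp: n_def X_def)
      have "B * \<bar>snd d\<bar> = \<bar>b * snd d\<bar>" by (simp add: B_def abs_mult)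
      then have s: "B * \<bar>snd d\<bar> \<le> \<bar>H z e - H z' e\<bar> + \<eta> * n"
        using 6(2)[of z z' e] z z' e r unfolding d_def n_def by (auto simp: abs_le_iff)
      \<comment> \<open>The jump direction is frozen at the origin. There \<open>fst d\<close> can
        be recovered from the determinant and \<open>snd d\<close>, because \<open>gp 0\<close> is
        nonzero.\<close>
      have "cross (Fp 0) d = cross (V z) d - cross (V z - Fp 0) d" by (simp add: cross_def algebra_simps)
      moreover have "\<bar>cross (V z - Fp 0) d\<bar> \<le> \<eta> * n"
      proof -
        have "K2 * norm z \<le> K2 * (\<eta> / (2 * K2))" using z r 2 by (intro mult_left_mono) auto
        then have "norm (V z - Fp 0) \<le> \<eta> / 2" using Vz 2 by simp
        then have "2 * (norm (V z - Fp 0) * norm d) \<le> 2 * (\<eta> / 2 * norm d)" by (intro mult_left_mono mult_right_mono) auto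
        then show ?thesis using cross_le[of "V z - Fp 0" d] by (simp add: n_def)
      qed
      ultimately have cr: "\<bar>cross (Fp 0) d\<bar> \<le> \<bar>cross (V z) d\<bar> + \<eta> * n" by linarith
      have "gp 0 * fst d = fp 0 * snd d - cross (Fp 0) d" by (simp add: cross_def Fp_def)
      then have "q * \<bar>fst d\<bar> \<le> \<bar>fp 0 * snd d\<bar> + \<bar>cross (Fp 0) d\<bar>"
        unfolding q_def abs_mult[symmetric] by linarith
      moreover have "\<bar>fp 0 * snd d\<bar> \<le> P * \<bar>snd d\<bar>"
        unfolding abs_mult P_def using norm_fst_le[of "fp 0" "gp 0"] by (intro mult_right_mono) (auto simp: Fp_def)
      ultimately have f: "q * \<bar>fst d\<bar> \<le> P * \<bar>snd d\<bar> + (\<bar>cross (V z) d\<bar> + \<eta> * n)" using cr by linarith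
      have "n \<le> \<bar>fst d\<bar> + \<bar>snd d\<bar>"
        unfolding n_def using norm_Pair_le[of "fst d" "snd d"] by simp
      then have "q * n \<le> q * \<bar>fst d\<bar> + q * \<bar>snd d\<bar>" using qB by (simp add: distrib_left[symmetric])
      then have "q * n \<le> (P + q) * \<bar>snd d\<bar> + (X + \<eta> * n)" using f by (simp add: X_def algebra_simps)
      moreover have "\<bar>snd d\<bar> \<le> (X + \<eta> * n) / B" using s qB by (simp add: X_def field_simps)
      then have "(P + q) * \<bar>snd d\<bar> \<le> (P + q) * ((X + \<eta> * n) / B)" using qB by (intro mult_left_mono) auto
      ultimately have "q * n \<le> ((P + q) / B + 1) * (X + \<eta> * n)" by (simp add: algebra_simps)
      then have "n \<le> (((P + q) / B + 1) * (X + \<eta> * n)) / q" using qB by (simp add: field_simps)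
      also have "\<dots> = \<kappa> / 2 * (X + \<eta> * n)" using qB by (simp add: \<kappa>_def field_simps)
      also have "\<dots> \<le> \<kappa> * (X + \<eta> * n)" using \<kappa> X n \<eta> by (intro mult_right_mono) auto
      also have "\<dots> = \<kappa> * X + n / 2" using \<kappa> by (simp add: \<eta>_def field_simps)
      finally have "n \<le> 2 * \<kappa> * X" by simp
      also have "\<dots> \<le> K * X" using K X by (intro mult_right_mono) auto
      finally show ?thesis by (simp add: n_def d_def X_def)
    qed
  qed (use r0 K0 w in auto)
qed

end

section \<open>Forward uniqueness and continuous dependence\<close>

text \<open>If the modulus grows at a rate proportional to the distance \<open>n\<close>, the square
  grows at a rate proportional to \<open>n\<^sup>2\<close>. One number \<open>\<delta>\<close>
  bounds both the step length and the relative error, so that every other term carries the factor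
  \<open>\<delta>\<close>.\<close>

lemma square_step:
  fixes x y :: real
  assumes y: "\<bar>y\<bar> \<le> \<bar>x\<bar> + h * (a * n + g * \<delta>)" and x: "\<bar>x\<bar> \<le> k * n"
    and nn: "0 \<le> h" "h \<le> \<delta>" "\<delta> \<le> 1" "0 \<le> n" "0 \<le> a" "0 \<le> g" "0 \<le> k"
  shows "y\<^sup>2 \<le> x\<^sup>2 + h * (2 * k * a * n\<^sup>2 + \<delta> * (2 * k * g * n + (a * n + g)\<^sup>2))"
proof -
  define m where "m = a * n + g * \<delta>"
  have \<delta>: "0 \<le> \<delta>" using nn by linarith
  have m: "0 \<le> m" "m \<le> a * n + g" unfolding m_def using nn \<delta> mult_left_mono[of \<delta> 1 g] by auto
  have "y\<^sup>2 = \<bar>y\<bar>\<^sup>2" by simp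
  also have "\<dots> \<le> (\<bar>x\<bar> + h * m)\<^sup>2" using y by (intro power_mono) (auto simp: m_def)
  also have "\<dots> = x\<^sup>2 + h * (2 * \<bar>x\<bar> * m) + h * (h * m\<^sup>2)" by (simp add: power2_eq_square algebra_simps)
  also have "\<dots> \<le> x\<^sup>2 + h * (2 * (k * n) * m) + h * (\<delta> * (a * n + g)\<^sup>2)"
  proof -
    have "2 * \<bar>x\<bar> * m \<le> 2 * (k * n) * m" using mult_right_mono[OF x m(1)] by simp
    moreover have "h * m\<^sup>2 \<le> \<delta> * (a * n + g)\<^sup>2"
      by (rule mult_mono[OF nn(2) power_mono[OF m(2,1)] \<delta>]) simp
    ultimately show ?thesis using nn(1) by (intro add_mono mult_left_mono) auto
  qed
  also have "\<dots> = x\<^sup>2 + h * (2 * k * a * n\<^sup>2 + \<delta> * (2 * k * g * n + (a * n + g)\<^sup>2))"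
    by (simp add: m_def power2_eq_square algebra_simps)
  finally show ?thesis .
qed

context filippov_fold
begin

text \<open>A Dini form of the differential inclusion: over a short time step the weight of the upper field
  averages to some \<^term>\<open>\<kappa>\<close>. Filippov solutions satisfy it at every time, so that no differentiation
  almost everywhere is needed.\<close>

definition filippov_step :: "real \<Rightarrow> (real \<Rightarrow> real \<times> real) \<Rightarrow> real \<Rightarrow> real \<Rightarrow> real \<Rightarrow> real \<Rightarrow> bool" where
  "filippov_step e z t \<eta> h \<kappa> \<longleftrightarrow> 0 \<le> \<kappa> \<and> \<kappa> \<le> 1 \<and> (H (z t) e < 0 \<longrightarrow> \<kappa> = 0) \<and> (H (z t) e > 0 \<longrightarrow> \<kappa> = 1) \<and>
     norm (z (t + h) - z t - h *\<^sub>R (Fm (z t) + \<kappa> *\<^sub>R V (z t))) \<le> \<eta> * h"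

definition dini_sol :: "real \<Rightarrow> real \<Rightarrow> (real \<Rightarrow> real \<times> real) \<Rightarrow> bool" where
  "dini_sol e T z \<longleftrightarrow> continuous_on {0..T} z \<and>
     (\<forall>t \<eta>. 0 \<le> t \<and> t < T \<and> \<eta> > 0 \<longrightarrow>
        (\<exists>h0>0. \<forall>h. 0 < h \<and> h < h0 \<longrightarrow> (\<exists>\<kappa>. filippov_step e z t \<eta> h \<kappa>)))"

lemma dini_solD:
  assumes "dini_sol e T z" "0 \<le> t" "t < T" "\<eta> > 0"
  obtains h0 where "h0 > 0" "\<And>h. 0 < h \<Longrightarrow> h < h0 \<Longrightarrow> \<exists>\<kappa>. filippov_step e z t \<eta> h \<kappa>"
  using assms unfolding dini_sol_def by blast

section \<open>Filippov solutions in Dini form\<close>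

lemma H_deriv_z: "((\<lambda>z. H z e) has_derivative (\<lambda>v. blinfun_apply (DH (z, e)) (v, 0))) (at z)"
proof -
  have "((\<lambda>z. (z, e)) has_derivative (\<lambda>v. (v, 0))) (at z)" by (auto intro!: derivative_eq_intros)
  from has_derivative_compose[OF this H_deriv] show ?thesis by (simp add: o_def)
qed

lemma H_cont: "continuous_on A (\<lambda>z. H z e)"
  using H_deriv_z by (intro continuous_at_imp_continuous_on ballI has_derivative_continuous) blast

lemma DH_Fm_V: "blinfun_apply (DH (z, e)) (Fm z + \<kappa> *\<^sub>R V z, 0) = Lm z e + \<kappa> * W z e"
proof -
  have "(Fm z + \<kappa> *\<^sub>R V z, 0::real) = (Fm z, 0) + \<kappa> *\<^sub>R (V z, 0)" by simp
  then show ?thesis unfolding Lm_def W_def by (simp only: blinfun.add_right blinfun.scaleR_right) simp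
qed

lemma DH_S: "W z e \<noteq> 0 \<Longrightarrow> blinfun_apply (DH (z, e)) (S z e, 0) = 0"
  using DH_Fm_V[of z e "- (Lm z e / W z e)"] by (simp add: S_def)

lemma dini_sol_smooth:
  assumes d: "\<And>t. t \<in> {0..T} \<Longrightarrow> (z has_vector_derivative (Fm (z t) + \<kappa> t *\<^sub>R V (z t))) (at t within {0..T})"
    and \<kappa>: "\<And>t. t \<in> {0..T} \<Longrightarrow> 0 \<le> \<kappa> t \<and> \<kappa> t \<le> 1 \<and> (H (z t) e < 0 \<longrightarrow> \<kappa> t = 0) \<and> (H (z t) e > 0 \<longrightarrow> \<kappa> t = 1)"
  shows "dini_sol e T z"
  unfolding dini_sol_def
proof (intro conjI allI impI)
  show "continuous_on {0..T} z" using d by (intro continuous_on_vector_derivative) auto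
  fix t \<eta> :: real assume t: "0 \<le> t \<and> t < T \<and> \<eta> > 0"
  have "(z has_derivative (\<lambda>h. h *\<^sub>R (Fm (z t) + \<kappa> t *\<^sub>R V (z t)))) (at t within {0..T})"
    using d[of t] t unfolding has_vector_derivative_def by simp
  then obtain d0 where d0: "d0 > 0" "\<And>s. s \<in> {0..T} \<Longrightarrow> norm (s - t) < d0 \<Longrightarrow>
      norm (z s - z t - (s - t) *\<^sub>R (Fm (z t) + \<kappa> t *\<^sub>R V (z t))) \<le> \<eta> * norm (s - t)"
    using t unfolding has_derivative_within_alt by meson
  show "\<exists>h0>0. \<forall>h. 0 < h \<and> h < h0 \<longrightarrow> (\<exists>\<kappa>. filippov_step e z t \<eta> h \<kappa>)"
  proof (rule exI[of _ "min d0 (T - t)"], intro conjI allI impI)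
    fix h assume h: "0 < h \<and> h < min d0 (T - t)"
    show "\<exists>\<kappa>. filippov_step e z t \<eta> h \<kappa>" unfolding filippov_step_def
      using \<kappa>[of t] d0(2)[of "t + h"] h t by (intro exI[of _ "\<kappa> t"]) auto
  qed (use d0 t in auto)
qed

lemma filippov_sol_continuous:
  assumes "filippov_sol fp gp fm gm H e z"
  shows "continuous_on {0..} z"
proof -
  obtain w where w: "\<And>t. t \<ge> 0 \<Longrightarrow> (w has_integral (z t - z 0)) {0..t}"
    using assms unfolding filippov_sol_def by blast
  have *: "continuous_on {0..T} z" if "T \<ge> 0" for T
  proof -
    have "continuous_on {0..T} (\<lambda>t. z 0 + integral {0..t} w)"
      using w[OF that] by (intro continuous_intros indefinite_integral_continuous_1) blast
    moreover have "z 0 + integral {0..t} w = z t" if "t \<in> {0..T}" for t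
      using integral_unique[OF w[of t]] that by simp
    ultimately show ?thesis by (rule continuous_on_eq)
  qed
  show ?thesis
  proof (rule continuous_on_eq_continuous_within[THEN iffD2], rule ballI)
    fix t :: real assume t: "t \<in> {0..}"
    have "continuous (at t within {0..t+1}) z" using *[of "t+1"] t unfolding continuous_on_eq_continuous_within by simp
    moreover have "at t within {0..t+1} = at t within {0..}"
      by (rule at_within_nhd[of t "{..<t+1}"]) (use t in auto)
    ultimately show "continuous (at t within {0..}) z" by simp
  qed
qed

lemma filippov_sol_increment:
  assumes "filippov_sol fp gp fm gm H e z"
  obtains w where "\<And>a b. 0 \<le> a \<Longrightarrow> a \<le> b \<Longrightarrow> (w has_integral (z b - z a)) {a..b}"
    "AE s in lebesgue. 0 \<le> s \<longrightarrow> w s \<in> filippov_map fp gp fm gm H e (z s)"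
proof -
  obtain w where w: "\<And>t. t \<ge> 0 \<Longrightarrow> (w has_integral (z t - z 0)) {0..t}"
    and ae: "AE s in lebesgue. 0 \<le> s \<longrightarrow> w s \<in> filippov_map fp gp fm gm H e (z s)"
    using assms unfolding filippov_sol_def by blast
  show ?thesis
  proof (rule that[OF _ ae])
    fix a b :: real assume ab: "0 \<le> a" "a \<le> b"
    have i: "w integrable_on {a..b}"
    proof (rule integrable_subinterval_real)
      show "w integrable_on {0..b}" using w[of b] ab by (simp add: has_integral_integrable)
    qed (use ab in simp)
    have "(w has_integral (z a - z 0 + integral {a..b} w)) {0..b}"
      using has_integral_combine[OF ab w[OF ab(1)] integrable_integral[OF i]] .
    then have "z a - z 0 + integral {a..b} w = z b - z 0"
      by (rule has_integral_unique) (use w[of b] ab in simp)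
    then have "integral {a..b} w = z b - z a" by (simp add: algebra_simps)
    then show "(w has_integral (z b - z a)) {a..b}" using integrable_integral[OF i] by simp
  qed
qed

text \<open>Upper semicontinuity of the Filippov map: at times near \<open>t\<close> its values lie
  in a closed convex neighbourhood of the velocities admissible at \<open>z t\<close>, hence so does
  the mean velocity of a short step.\<close>

lemma dini_sol_filippov:
  assumes sol: "filippov_sol fp gp fm gm H e z" and s0: "s0 \<ge> 0"
  shows "dini_sol e T (\<lambda>t. z (s0 + t))"
  unfolding dini_sol_def
proof (intro conjI allI impI)
  note cz = filippov_sol_continuous[OF sol]
  show "continuous_on {0..T} (\<lambda>t. z (s0 + t))"
    by (rule continuous_on_compose2[OF cz]) (use s0 in \<open>auto intro!: continuous_intros\<close>)
  obtain w where w: "\<And>a b. 0 \<le> a \<Longrightarrow> a \<le> b \<Longrightarrow> (w has_integral (z b - z a)) {a..b}"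
    and ae: "AE s in lebesgue. 0 \<le> s \<longrightarrow> w s \<in> filippov_map fp gp fm gm H e (z s)"
    using filippov_sol_increment[OF sol] by metis
  fix t' \<eta> :: real assume t': "0 \<le> t' \<and> t' < T \<and> \<eta> > 0"
  define t where "t = s0 + t'"
  have t: "t \<ge> 0" using s0 t' by (simp add: t_def)
  define p where "p = z t"
  define S where "S = (if H p e > 0 then {Fp p} else if H p e < 0 then {Fm p} else closed_segment (Fp p) (Fm p))"
  have S: "S \<noteq> {}" "convex S" "compact S" by (auto simp: S_def)
  \<comment> \<open>The sum of the compact convex set of admissible velocities and a closed ball is
    again closed and convex, as required for averaging.\<close>
  define C where "C = (\<Union>x\<in>S. \<Union>y\<in>cball 0 \<eta>. {x + y})"
  have "convex C" unfolding C_def by (rule convex_sums[OF S(2) convex_cball])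
  moreover have "closed C" unfolding C_def by (rule compact_imp_closed[OF compact_sums'[OF S(3) compact_cball]])
  moreover have "C \<noteq> {}" using S(1) t' unfolding C_def by (auto simp: ex_in_conv[symmetric] intro!: exI[of _ 0])
  ultimately have C: "convex C" "closed C" "C \<noteq> {}" by auto
  have CI: "x \<in> C" if "y \<in> S" "norm (x - y) \<le> \<eta>" for x y
    unfolding C_def using that by (intro UN_I[of y] UN_I[of "x - y"]) auto
  have cont: "continuous (at t within {0..}) z" using cz t continuous_on_eq_continuous_within by auto
  have ev: "\<forall>\<^sub>F s in at t within {0..}. norm (g (z s) - g p) < \<eta>'"
    if "continuous_on UNIV g" "\<eta>' > 0" for g :: "real \<times> real \<Rightarrow> 'b::real_normed_vector" and \<eta>'
  proof -
    have "isCont g (z t)" using that continuous_on_eq_continuous_at by blast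
    then have "continuous (at t within {0..}) (\<lambda>s. g (z s))" using continuous_within_compose3[OF _ cont] by blast
    then show ?thesis using that(2) unfolding continuous_within tendsto_iff p_def dist_norm by blast
  qed
  have "\<forall>\<^sub>F s in at t within {0..}. filippov_map fp gp fm gm H e (z s) \<subseteq> C"
  proof -
    \<comment> \<open>On the switching curve nothing has to be shown about the sign nearby, since
      \<open>S\<close> is then the full segment between the two fields.\<close>
    have sign: "\<forall>\<^sub>F s in at t within {0..}. (H p e > 0 \<longrightarrow> H (z s) e > 0) \<and> (H p e < 0 \<longrightarrow> H (z s) e < 0)"
    proof (cases "H p e = 0")
      case False
      have "\<forall>\<^sub>F s in at t within {0..}. norm (H (z s) e - H p e) < \<bar>H p e\<bar>"
        using ev[OF H_cont, of "\<bar>H p e\<bar>" e] False by simp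
      then show ?thesis by eventually_elim auto
    qed auto
    have "\<forall>\<^sub>F s in at t within {0..}. norm (Fm (z s) - Fm p) < \<eta>" using ev[OF Fm_cont] t' by blast
    moreover have "\<forall>\<^sub>F s in at t within {0..}. norm (Fp (z s) - Fp p) < \<eta>" using ev[OF Fp_cont] t' by blast
    ultimately show ?thesis using sign
    proof eventually_elim
      case (elim s)
      show ?case
      proof
        fix x assume x: "x \<in> filippov_map fp gp fm gm H e (z s)"
        then have seg: "x \<in> closed_segment (Fp (z s)) (Fm (z s))"
          by (auto simp: filippov_map_def Fp_def Fm_def split: if_splits)
        consider "H p e > 0" | "H p e < 0" | "H p e = 0" by linarith
        then show "x \<in> C"
        proof cases
          case 1
          then have "x = Fp (z s)" using x elim by (simp add: filippov_map_def Fp_def)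
          then show ?thesis using 1 elim by (intro CI[of "Fp p"]) (auto simp: S_def)
        next
          case 2
          then have "x = Fm (z s)" using x elim by (simp add: filippov_map_def Fm_def)
          then show ?thesis using 2 elim by (intro CI[of "Fm p"]) (auto simp: S_def)
        next
          case 3
          obtain u where u: "0 \<le> u" "u \<le> 1" "x = (1 - u) *\<^sub>R Fp (z s) + u *\<^sub>R Fm (z s)"
            using seg unfolding closed_segment_def by blast
          have "x - ((1 - u) *\<^sub>R Fp p + u *\<^sub>R Fm p) = (1 - u) *\<^sub>R (Fp (z s) - Fp p) + u *\<^sub>R (Fm (z s) - Fm p)"
            unfolding u(3) by (simp add: algebra_simps)
          also have "norm \<dots> \<le> (1 - u) * norm (Fp (z s) - Fp p) + u * norm (Fm (z s) - Fm p)"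
            using u norm_triangle_ineq[of "(1 - u) *\<^sub>R (Fp (z s) - Fp p)" "u *\<^sub>R (Fm (z s) - Fm p)"] by simp
          also have "\<dots> \<le> (1 - u) * \<eta> + u * \<eta>"
            using u elim by (intro add_mono mult_left_mono) auto
          finally have "norm (x - ((1 - u) *\<^sub>R Fp p + u *\<^sub>R Fm p)) \<le> \<eta>" by (simp add: algebra_simps)
          then show ?thesis using 3 u by (intro CI[of "(1 - u) *\<^sub>R Fp p + u *\<^sub>R Fm p"]) (auto simp: S_def in_segment)
        qed
      qed
    qed
  qed
  then obtain h0 where h0: "h0 > 0" "\<And>s. s \<in> {0..} \<Longrightarrow> s \<noteq> t \<Longrightarrow> dist s t < h0 \<Longrightarrow> filippov_map fp gp fm gm H e (z s) \<subseteq> C"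
    unfolding eventually_at by blast
  show "\<exists>h0>0. \<forall>h. 0 < h \<and> h < h0 \<longrightarrow> (\<exists>\<kappa>. filippov_step e (\<lambda>t. z (s0 + t)) t' \<eta> h \<kappa>)"
  proof (rule exI[of _ h0], intro conjI allI impI h0(1))
    fix h assume h: "0 < h \<and> h < h0"
    \<comment> \<open>\<open>h0\<close> comes from a punctured neighbourhood of \<open>t\<close>, so
      this single time is discarded as a null set.\<close>
    have ae': "AE s in lebesgue. s \<noteq> t"
      using negligible_sing[of t] by (auto simp: eventually_ae_filter_negligible)
    have "AE s in lebesgue. s \<in> {t..t+h} \<longrightarrow> w s \<in> C"
      using ae ae'
    proof eventually_elim
      case (elim s)
      show ?case
      proof
        assume s: "s \<in> {t..t+h}"
        then have "filippov_map fp gp fm gm H e (z s) \<subseteq> C"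
          using h t elim by (intro h0) (auto simp: dist_real_def)
        then show "w s \<in> C" using elim s t by auto
      qed
    qed
    then have "(1 / (t + h - t)) *\<^sub>R (z (t + h) - z t) \<in> C"
      by (intro average_in_closed_convex[OF C _ w]) (use h t in auto)
    then obtain x y where xy: "x \<in> S" "norm y \<le> \<eta>" "(1 / h) *\<^sub>R (z (t + h) - z t) = x + y"
      unfolding C_def by auto
    obtain \<kappa> where \<kappa>: "0 \<le> \<kappa>" "\<kappa> \<le> 1" "x = Fm p + \<kappa> *\<^sub>R V p" "H p e < 0 \<longrightarrow> \<kappa> = 0" "H p e > 0 \<longrightarrow> \<kappa> = 1"
    proof -
      consider "H p e > 0" | "H p e < 0" | "H p e = 0" by linarith
      then show ?thesis
      proof cases
        case 1 then show ?thesis using xy(1) by (intro that[of 1]) (auto simp: S_def V_def)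
      next
        case 2 then show ?thesis using xy(1) by (intro that[of 0]) (auto simp: S_def V_def)
      next
        case 3
        then obtain u where "0 \<le> u" "u \<le> 1" "x = (1 - u) *\<^sub>R Fp p + u *\<^sub>R Fm p"
          using xy(1) by (auto simp: S_def closed_segment_def)
        then show ?thesis using 3 by (intro that[of "1 - u"]) (auto simp: V_def algebra_simps)
      qed
    qed
    have "z (t + h) - z t = h *\<^sub>R ((1 / h) *\<^sub>R (z (t + h) - z t))" using h by simp
    then have "z (t + h) - z t - h *\<^sub>R (Fm p + \<kappa> *\<^sub>R V p) = h *\<^sub>R y"
      unfolding xy(3) \<kappa>(3) by (simp add: algebra_simps)
    then have "norm (z (t + h) - z t - h *\<^sub>R (Fm p + \<kappa> *\<^sub>R V p)) \<le> \<eta> * h"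
      using xy(2) h by (simp add: mult.commute)
    then show "\<exists>\<kappa>. filippov_step e (\<lambda>t. z (s0 + t)) t' \<eta> h \<kappa>"
      using \<kappa> unfolding p_def t_def filippov_step_def by (intro exI[of _ \<kappa>]) (simp add: add.assoc)
  qed
qed

text \<open>A chain rule for increments: the weight \<open>\<kappa>\<close> that describes the step
  of \<open>z\<close> also describes the increment of \<open>H\<close>. This common weight permits
  comparing two solutions by the signs of \<open>H\<close>. With \<open>\<eta> \<le> 1\<close> the
  displacement is at most \<open>h * M\<close>, so the error stays linear in
  \<open>\<eta>\<close>.\<close>

lemma dini_sol_H_step:
  assumes z: "dini_sol e T z" "0 \<le> t" "t < T" and \<eta>: "\<eta> > 0" "\<eta> \<le> 1"
  obtains h0 where "h0 > 0" "\<And>h. 0 < h \<Longrightarrow> h < h0 \<Longrightarrow> \<exists>\<kappa>. filippov_step e z t \<eta> h \<kappa> \<and>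
     \<bar>H (z (t + h)) e - H (z t) e - h * (Lm (z t) e + \<kappa> * W (z t) e)\<bar>
       \<le> \<eta> * h * (norm (Fm (z t)) + norm (V (z t)) + 1 + norm (DH (z t, e)))"
proof -
  define p where "p = z t"
  define M where "M = norm (Fm p) + norm (V p) + 1"
  have M: "M \<ge> 1" by (simp add: M_def)
  obtain h1 where h1: "h1 > 0" "\<And>h. 0 < h \<Longrightarrow> h < h1 \<Longrightarrow> \<exists>\<kappa>. filippov_step e z t \<eta> h \<kappa>"
    using dini_solD[OF z \<eta>(1)] by blast
  obtain d where d: "d > 0" "\<And>y. norm (y - p) < d \<Longrightarrow> norm (H y e - H p e - blinfun_apply (DH (p, e)) (y - p, 0)) \<le> \<eta> * norm (y - p)"
    using H_deriv_z[of e p] \<eta>(1) unfolding has_derivative_at_alt by meson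
  show ?thesis
  proof (rule that[of "min h1 (d / M)"])
    fix h assume h: "0 < h" "h < min h1 (d / M)"
    obtain \<kappa> where step: "filippov_step e z t \<eta> h \<kappa>" using h1(2)[of h] h by auto
    then have \<kappa>: "0 \<le> \<kappa>" "\<kappa> \<le> 1" "norm (z (t + h) - p - h *\<^sub>R (Fm p + \<kappa> *\<^sub>R V p)) \<le> \<eta> * h"
      by (auto simp: filippov_step_def p_def)
    define \<rho> where "\<rho> = z (t + h) - p - h *\<^sub>R (Fm p + \<kappa> *\<^sub>R V p)"
    have \<rho>n: "norm \<rho> \<le> \<eta> * h" using \<kappa>(3) by (simp add: \<rho>_def)
    have eq: "z (t + h) - p = h *\<^sub>R (Fm p + \<kappa> *\<^sub>R V p) + \<rho>" by (simp add: \<rho>_def)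
    have "norm (Fm p + \<kappa> *\<^sub>R V p) \<le> norm (Fm p) + \<kappa> * norm (V p)"
      using norm_triangle_ineq[of "Fm p" "\<kappa> *\<^sub>R V p"] \<kappa>(1) by simp
    also have "\<dots> \<le> norm (Fm p) + norm (V p)" using \<kappa> by (simp add: mult_left_le_one_le)
    finally have *: "h * norm (Fm p + \<kappa> *\<^sub>R V p) \<le> h * (norm (Fm p) + norm (V p))"
      using h(1) by simp
    have "norm (z (t + h) - p) \<le> h * (norm (Fm p) + norm (V p)) + \<eta> * h"
    proof -
      have "norm (h *\<^sub>R (Fm p + \<kappa> *\<^sub>R V p)) = h * norm (Fm p + \<kappa> *\<^sub>R V p)" using h(1) by simp
      then show ?thesis
        using norm_triangle_ineq[of "h *\<^sub>R (Fm p + \<kappa> *\<^sub>R V p)" \<rho>] \<rho>n *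
        unfolding eq by linarith
    qed
    also have "\<dots> \<le> h * M" using h mult_right_mono[OF \<eta>(2), of h] by (simp add: M_def distrib_left)
    finally have n: "norm (z (t + h) - p) \<le> h * M" .
    also have "\<dots> < d" using h M by (simp add: pos_less_divide_eq)
    finally have "norm (H (z (t + h)) e - H p e - blinfun_apply (DH (p, e)) (z (t + h) - p, 0)) \<le> \<eta> * norm (z (t + h) - p)"
      by (rule d(2))
    also have "\<dots> \<le> \<eta> * (h * M)" using n \<eta> by (intro mult_left_mono) auto
    finally have 1: "\<bar>H (z (t + h)) e - H p e - blinfun_apply (DH (p, e)) (z (t + h) - p, 0)\<bar> \<le> \<eta> * (h * M)" by simp
    have "(z (t + h) - p, 0::real) = h *\<^sub>R (Fm p + \<kappa> *\<^sub>R V p, 0) + (\<rho>, 0)" unfolding eq by simp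
    then have 2: "blinfun_apply (DH (p, e)) (z (t + h) - p, 0) = h * (Lm p e + \<kappa> * W p e) + blinfun_apply (DH (p, e)) (\<rho>, 0)"
      by (simp only: blinfun.add_right blinfun.scaleR_right DH_Fm_V) simp
    have "norm (blinfun_apply (DH (p, e)) (\<rho>, 0)) \<le> norm (DH (p, e)) * norm (\<rho>, 0::real)" by (rule norm_blinfun)
    also have "\<dots> \<le> norm (DH (p, e)) * (\<eta> * h)" using \<kappa>(3) by (intro mult_left_mono) (auto simp: norm_Pair \<rho>_def)
    finally have "\<bar>H (z (t + h)) e - H p e - h * (Lm p e + \<kappa> * W p e)\<bar> \<le> \<eta> * (h * M) + norm (DH (p, e)) * (\<eta> * h)"
      using 1 unfolding 2 by (simp add: abs_le_iff)
    then have "\<bar>H (z (t + h)) e - H p e - h * (Lm p e + \<kappa> * W p e)\<bar> \<le> \<eta> * h * (M + norm (DH (p, e)))"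
      by (simp add: algebra_simps)
    then show "\<exists>\<kappa>. filippov_step e z t \<eta> h \<kappa> \<and>
     \<bar>H (z (t + h)) e - H (z t) e - h * (Lm (z t) e + \<kappa> * W (z t) e)\<bar>
       \<le> \<eta> * h * (norm (Fm (z t)) + norm (V (z t)) + 1 + norm (DH (z t, e)))"
      using step unfolding M_def p_def by blast
  qed (use h1 d M in auto)
qed

text \<open>The difference of two solutions is measured by the increment of \<^term>\<open>H\<close>, for which the
  jump of the field is monotone, and by its component transversal to the jump direction \<^term>\<open>V\<close>,
  on which the jump has no effect to first order.\<close>

lemma continuous_dependence:
  obtains r C K where "r > 0" "C \<ge> 0" "K > 0"
    "\<And>e T z1 z2 t. \<bar>e\<bar> \<le> r \<Longrightarrow> dini_sol e T z1 \<Longrightarrow> dini_sol e T z2 \<Longrightarrow>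
        (\<And>s. s \<in> {0..T} \<Longrightarrow> norm (z1 s) \<le> r \<and> norm (z2 s) \<le> r) \<Longrightarrow> t \<in> {0..T} \<Longrightarrow>
        norm (z1 t - z2 t) \<le> K * exp (C * t) * norm (z1 0 - z2 0)"
proof -
  obtain r K w where rK: "r > 0" "K > 0" "w > 0"
    and Fm_lip: "\<And>z z'. norm z \<le> r \<Longrightarrow> norm z' \<le> r \<Longrightarrow> norm (Fm z - Fm z') \<le> K * norm (z - z')"
    and V_lip: "\<And>z z'. norm z \<le> r \<Longrightarrow> norm z' \<le> r \<Longrightarrow> norm (V z - V z') \<le> K * norm (z - z')"
    and Fm_bd: "\<And>z. norm z \<le> r \<Longrightarrow> norm (Fm z) \<le> K"
    and V_bd: "\<And>z. norm z \<le> r \<Longrightarrow> norm (V z) \<le> K"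
    and H_lip: "\<And>z z' e. norm z \<le> r \<Longrightarrow> norm z' \<le> r \<Longrightarrow> \<bar>e\<bar> \<le> r \<Longrightarrow> \<bar>H z e - H z' e\<bar> \<le> K * norm (z - z')"
    and L_lip: "\<And>z z' e. norm z \<le> r \<Longrightarrow> norm z' \<le> r \<Longrightarrow> \<bar>e\<bar> \<le> r \<Longrightarrow> \<bar>Lm z e - Lm z' e\<bar> \<le> K * norm (z - z')"
    and W_lip: "\<And>z z' e. norm z \<le> r \<Longrightarrow> norm z' \<le> r \<Longrightarrow> \<bar>e\<bar> \<le> r \<Longrightarrow> \<bar>W z e - W z' e\<bar> \<le> K * norm (z - z')"
    and W_neg: "\<And>z e. norm z \<le> r \<Longrightarrow> \<bar>e\<bar> \<le> r \<Longrightarrow> W z e \<le> - w"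
    and _: "\<And>z e. norm z \<le> r \<Longrightarrow> \<bar>e\<bar> \<le> r \<Longrightarrow> Lm z e + W z e \<le> - w"
    and coer: "\<And>z z' e. norm z \<le> r \<Longrightarrow> norm z' \<le> r \<Longrightarrow> \<bar>e\<bar> \<le> r \<Longrightarrow>
        norm (z - z') \<le> K * (\<bar>cross (V z) (z - z')\<bar> + \<bar>H z e - H z' e\<bar>)"
    by (rule region) (rule that; assumption)
  \<comment> \<open>The growth rate of \<open>D\<close> relative to the distance:
    \<open>4 * K\<^sup>2\<close> stems from the difference of the fields, the other summand from the
    change of \<open>V\<close> along the first solution.\<close>
  define a where "a = 4 * K\<^sup>2 + 2 * K * (2 * K + 1)"
  have a: "a \<ge> 0" using rK by (simp add: a_def)
  \<comment> \<open>The coefficients of the squared distance in the growth of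
    \<open>D\<^sup>2\<close> and \<open>d\<^sup>2\<close>, multiplied by the factor
    \<open>2 * K\<^sup>2\<close> that bounds the squared distance by \<open>E\<close>. The distance
    itself, a square root, grows with exponent \<open>C / 2\<close>.\<close>
  define C where "C = 2 * K\<^sup>2 * (2 * (2 * K) * a + 2 * K * (2 * K))"
  have C: "C \<ge> 0" using rK a by (simp add: C_def)
  define K' where "K' = sqrt (2 * K\<^sup>2 * (5 * K\<^sup>2))"
  have K': "K' > 0" using rK by (simp add: K'_def)
  show ?thesis
  proof (rule that[of r "C / 2" K'])
    fix e T :: real and z1 z2 :: "real \<Rightarrow> real \<times> real" and t :: real
    assume e: "\<bar>e\<bar> \<le> r" and z1: "dini_sol e T z1" and z2: "dini_sol e T z2"
      and inr: "\<And>s. s \<in> {0..T} \<Longrightarrow> norm (z1 s) \<le> r \<and> norm (z2 s) \<le> r" and t: "t \<in> {0..T}"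
    define D where "D s = cross (V (z1 s)) (z1 s - z2 s)" for s
    define d where "d s = H (z1 s) e - H (z2 s) e" for s
    define E where "E s = (D s)\<^sup>2 + (d s)\<^sup>2" for s
    define n where "n s = norm (z1 s - z2 s)" for s
    have E0: "E s \<ge> 0" for s by (simp add: E_def)
    have D_le: "\<bar>D s\<bar> \<le> 2 * K * n s" and d_le: "\<bar>d s\<bar> \<le> K * n s" and n_le: "(n s)\<^sup>2 \<le> 2 * K\<^sup>2 * E s" and nr: "n s \<le> 2 * r"
      if s: "s \<in> {0..T}" for s
    proof -
      note i = inr[OF s, THEN conjunct1] inr[OF s, THEN conjunct2]
      have "\<bar>D s\<bar> \<le> 2 * (norm (V (z1 s)) * n s)" unfolding D_def n_def by (rule cross_le)
      also have "\<dots> \<le> 2 * (K * n s)" using V_bd[OF i(1)] by (intro mult_left_mono mult_right_mono) (auto simp: n_def)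
      finally show "\<bar>D s\<bar> \<le> 2 * K * n s" by simp
      show "\<bar>d s\<bar> \<le> K * n s" unfolding d_def n_def by (rule H_lip[OF i e])
      have "n s \<le> K * (\<bar>D s\<bar> + \<bar>d s\<bar>)" unfolding D_def d_def n_def by (rule coer[OF i e])
      then have "(n s)\<^sup>2 \<le> (K * (\<bar>D s\<bar> + \<bar>d s\<bar>))\<^sup>2" by (intro power_mono) (auto simp: n_def)
      also have "\<dots> = K\<^sup>2 * (\<bar>D s\<bar> + \<bar>d s\<bar>)\<^sup>2" by (simp add: power_mult_distrib)
      also have "\<dots> \<le> K\<^sup>2 * (2 * E s)"
        using sum_squares_bound[of "\<bar>D s\<bar>" "\<bar>d s\<bar>"]
        by (intro mult_left_mono) (auto simp: E_def power2_sum)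
      finally show "(n s)\<^sup>2 \<le> 2 * K\<^sup>2 * E s" by simp
      show "n s \<le> 2 * r" unfolding n_def using norm_triangle_ineq4[of "z1 s" "z2 s"] i by linarith
    qed
    have cz: "continuous_on {0..T} z1" "continuous_on {0..T} z2" using z1 z2 by (auto simp: dini_sol_def)
    have "continuous_on UNIV V" unfolding V_def[abs_def] by (intro continuous_intros Fp_cont Fm_cont)
    then have contV: "continuous_on {0..T} (\<lambda>s. V (z1 s))" by (rule continuous_on_compose2) (use cz in auto)
    have contE: "continuous_on {0..T} E"
      unfolding E_def D_def d_def
      by (intro continuous_intros bounded_bilinear.continuous_on[OF cross_bilinear] contV cz
          continuous_on_compose2[OF H_cont[of UNIV e]]) auto
    have "E t \<le> (E 0 + 0 * t) * exp (C * t)"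
    proof (rule dini_gronwall[OF contE C order_refl E0])
      fix t \<eta> :: real assume t: "0 \<le> t" "t < T" and \<eta>: "\<eta> > 0"
      have tT: "t \<in> {0..T}" using t by auto
      note i = inr[OF tT, THEN conjunct1] inr[OF tT, THEN conjunct2]
      define N where "N = n t"
      have N: "0 \<le> N" by (simp add: N_def n_def)
      define g where "g = 4 * K + 4 * K * (2 * K + 1) ^ 2"
      define Q where "Q = (norm (Fm (z1 t)) + norm (V (z1 t)) + 1 + norm (DH (z1 t, e))) + (norm (Fm (z2 t)) + norm (V (z2 t)) + 1 + norm (DH (z2 t, e)))"
      define G where "G = \<bar>Lm (z1 t) e\<bar> + \<bar>Lm (z2 t) e\<bar> + \<bar>W (z1 t) e\<bar> + \<bar>W (z2 t) e\<bar> + Q"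
      have g: "g \<ge> 0" and Q: "Q \<ge> 0" and G: "G \<ge> 0" using rK by (auto simp: g_def Q_def G_def)
      define B where "B = (2 * (2 * K) * g * N + (a * N + g)\<^sup>2) + (2 * K * Q * N + (2 * K * N + Q)\<^sup>2) + G\<^sup>2 + 1"
      have B1: "2 * (2 * K) * g * N + (a * N + g)\<^sup>2 \<ge> 0" and B2: "2 * K * Q * N + (2 * K * N + Q)\<^sup>2 \<ge> 0"
        using rK g Q N by auto
      then have B: "B > 0" unfolding B_def using zero_le_power2[of G] by linarith
      define \<delta> where "\<delta> = min (1/2) (\<eta> / B)"
      have \<delta>: "\<delta> > 0" "\<delta> \<le> 1" "\<delta> * B \<le> \<eta>" using \<eta> B by (auto simp: \<delta>_def min_def field_simps)
      obtain h1 where h1: "h1 > 0" "\<And>h. 0 < h \<Longrightarrow> h < h1 \<Longrightarrow> \<exists>\<kappa>. filippov_step e z1 t \<delta> h \<kappa> \<and>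
         \<bar>H (z1 (t + h)) e - H (z1 t) e - h * (Lm (z1 t) e + \<kappa> * W (z1 t) e)\<bar>
            \<le> \<delta> * h * (norm (Fm (z1 t)) + norm (V (z1 t)) + 1 + norm (DH (z1 t, e)))"
        using dini_sol_H_step[OF z1 t \<delta>(1,2)] by blast
      obtain h2 where h2: "h2 > 0" "\<And>h. 0 < h \<Longrightarrow> h < h2 \<Longrightarrow> \<exists>\<kappa>. filippov_step e z2 t \<delta> h \<kappa> \<and>
         \<bar>H (z2 (t + h)) e - H (z2 t) e - h * (Lm (z2 t) e + \<kappa> * W (z2 t) e)\<bar>
            \<le> \<delta> * h * (norm (Fm (z2 t)) + norm (V (z2 t)) + 1 + norm (DH (z2 t, e)))"
        using dini_sol_H_step[OF z2 t \<delta>(1,2)] by blast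
      \<comment> \<open>During a step \<open>d\<close> changes by at most \<open>h * G\<close>, so
        below \<open>h3\<close> a nonzero \<open>d\<close> keeps its sign. The value 1 for
        \<open>d t = 0\<close> is arbitrary.\<close>
      define h3 where "h3 = (if d t = 0 then 1 else \<bar>d t\<bar> / (G + 1))"
      have h3: "h3 > 0" using G by (simp add: h3_def)
      show "\<exists>h0>0. \<forall>h. 0 < h \<and> h < h0 \<longrightarrow> E (t + h) \<le> E t + h * (C * E t + 0 + \<eta>)"
      proof (intro exI[of _ "Min {h1, h2, h3, T - t, \<delta>}"] conjI allI impI)
        fix h assume "0 < h \<and> h < Min {h1, h2, h3, T - t, \<delta>}"
        then have h: "0 < h" "h < h1" "h < h2" "h < h3" "h < T - t" "h < \<delta>" by auto
        obtain \<kappa> where \<kappa>: "0 \<le> \<kappa>" "\<kappa> \<le> 1" "H (z1 t) e < 0 \<longrightarrow> \<kappa> = 0" "H (z1 t) e > 0 \<longrightarrow> \<kappa> = 1"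
         "norm (z1 (t + h) - z1 t - h *\<^sub>R (Fm (z1 t) + \<kappa> *\<^sub>R V (z1 t))) \<le> \<delta> * h"
         "\<bar>H (z1 (t + h)) e - H (z1 t) e - h * (Lm (z1 t) e + \<kappa> * W (z1 t) e)\<bar>
            \<le> \<delta> * h * (norm (Fm (z1 t)) + norm (V (z1 t)) + 1 + norm (DH (z1 t, e)))"
          using h1(2)[OF h(1,2)] unfolding filippov_step_def by blast
        obtain \<mu> where \<mu>: "0 \<le> \<mu>" "\<mu> \<le> 1" "H (z2 t) e < 0 \<longrightarrow> \<mu> = 0" "H (z2 t) e > 0 \<longrightarrow> \<mu> = 1"
         "norm (z2 (t + h) - z2 t - h *\<^sub>R (Fm (z2 t) + \<mu> *\<^sub>R V (z2 t))) \<le> \<delta> * h"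
         "\<bar>H (z2 (t + h)) e - H (z2 t) e - h * (Lm (z2 t) e + \<mu> * W (z2 t) e)\<bar>
            \<le> \<delta> * h * (norm (Fm (z2 t)) + norm (V (z2 t)) + 1 + norm (DH (z2 t, e)))"
          using h2(2)[OF h(1,3)] unfolding filippov_step_def by blast
        define F1 F2 V1 V2 where "F1 = Fm (z1 t)" "F2 = Fm (z2 t)" "V1 = V (z1 t)" "V2 = V (z2 t)"
        note FV = F1_F2_V1_V2_def
        define \<rho>1 where "\<rho>1 = z1 (t + h) - z1 t - h *\<^sub>R (F1 + \<kappa> *\<^sub>R V1)"
        define \<rho>2 where "\<rho>2 = z2 (t + h) - z2 t - h *\<^sub>R (F2 + \<mu> *\<^sub>R V2)"
        have \<rho>: "norm \<rho>1 \<le> \<delta> * h" "norm \<rho>2 \<le> \<delta> * h" using \<kappa>(5) \<mu>(5) by (auto simp: \<rho>1_def \<rho>2_def FV)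
        have FVb: "norm F1 \<le> K" "norm F2 \<le> K" "norm V1 \<le> K" "norm V2 \<le> K" "norm (F1 - F2) \<le> K * N" "norm (V1 - V2) \<le> K * N"
          using Fm_bd[OF i(1)] Fm_bd[OF i(2)] V_bd[OF i(1)] V_bd[OF i(2)] Fm_lip[OF i] V_lip[OF i] by (auto simp: FV N_def n_def)
        have scal: "norm (c *\<^sub>R x) \<le> y" if "0 \<le> c" "c \<le> 1" "norm x \<le> y" for c y and x :: "real\<times>real"
          using that mult_left_le_one_le[of "norm x" c] by simp
        have \<delta>h: "\<delta> * h \<le> h" using mult_right_mono[OF \<delta>(2), of h] h(1) by simp
        have mv1: "norm (z1 (t + h) - z1 t) \<le> h * (2 * K + 1)"
        proof -
          have "z1 (t + h) - z1 t = h *\<^sub>R (F1 + \<kappa> *\<^sub>R V1) + \<rho>1" by (simp add: \<rho>1_def)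
          moreover have "norm (F1 + \<kappa> *\<^sub>R V1) \<le> 2 * K"
            using norm_triangle_ineq[of F1 "\<kappa> *\<^sub>R V1"] FVb scal[OF \<kappa>(1,2) FVb(3)] by linarith
          then have "norm (h *\<^sub>R (F1 + \<kappa> *\<^sub>R V1)) \<le> h * (2 * K)" using h by simp
          moreover have "norm \<rho>1 \<le> h * 1" using \<rho>(1) \<delta>h by simp
          ultimately show ?thesis
            using norm_triangle_ineq[of "h *\<^sub>R (F1 + \<kappa> *\<^sub>R V1)" \<rho>1] by (simp add: algebra_simps)
        qed
        have mv2: "norm (z2 (t + h) - z2 t) \<le> h * (2 * K + 1)"
        proof -
          have "z2 (t + h) - z2 t = h *\<^sub>R (F2 + \<mu> *\<^sub>R V2) + \<rho>2" by (simp add: \<rho>2_def)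
          moreover have "norm (F2 + \<mu> *\<^sub>R V2) \<le> 2 * K"
            using norm_triangle_ineq[of F2 "\<mu> *\<^sub>R V2"] FVb scal[OF \<mu>(1,2) FVb(4)] by linarith
          then have "norm (h *\<^sub>R (F2 + \<mu> *\<^sub>R V2)) \<le> h * (2 * K)" using h by simp
          moreover have "norm \<rho>2 \<le> h * 1" using \<rho>(2) \<delta>h by simp
          ultimately show ?thesis
            using norm_triangle_ineq[of "h *\<^sub>R (F2 + \<mu> *\<^sub>R V2)" \<rho>2] by (simp add: algebra_simps)
        qed
        have th: "t + h \<in> {0..T}" using t h by auto
        define \<Delta> \<Delta>' where "\<Delta> = z1 t - z2 t" and "\<Delta>' = z1 (t + h) - z2 (t + h)"
        define U where "U = (F1 - F2) + \<mu> *\<^sub>R (V1 - V2)"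
        have U: "norm U \<le> 2 * K * N"
          unfolding U_def using norm_triangle_ineq[of "F1 - F2" "\<mu> *\<^sub>R (V1 - V2)"] FVb scal[OF \<mu>(1,2) FVb(6)] by linarith
        define \<nu> where "\<nu> = V (z1 (t + h)) - V1"
        have \<nu>: "norm \<nu> \<le> K * (h * (2 * K + 1))"
        proof -
          have "norm \<nu> \<le> K * norm (z1 (t + h) - z1 t)"
            unfolding \<nu>_def FV using V_lip[of "z1 (t + h)" "z1 t"] inr[OF th] i by blast
          also have "\<dots> \<le> K * (h * (2 * K + 1))" using mv1 rK by (intro mult_left_mono) auto
          finally show ?thesis .
        qed
        \<comment> \<open>The difference of the weights multiplies exactly \<open>V1\<close>; the
          product with \<open>cross V1\<close> removes this term, the only one of first order that
          is not small with the distance.\<close>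
        have \<Delta>eq: "\<Delta>' = \<Delta> + h *\<^sub>R U + (h * (\<kappa> - \<mu>)) *\<^sub>R V1 + (\<rho>1 - \<rho>2)"
          by (simp add: \<Delta>'_def \<Delta>_def U_def \<rho>1_def \<rho>2_def algebra_simps)
        have \<Delta>'n: "norm \<Delta>' \<le> N + h * (2 * (2 * K + 1))"
        proof -
          have "\<Delta>' = \<Delta> + ((z1 (t + h) - z1 t) - (z2 (t + h) - z2 t))" by (simp add: \<Delta>'_def \<Delta>_def)
          then have "norm \<Delta>' \<le> norm \<Delta> + (norm (z1 (t + h) - z1 t) + norm (z2 (t + h) - z2 t))"
            using norm_triangle_ineq norm_triangle_ineq4 by (metis (no_types, lifting) add_left_mono order_trans)
          then show ?thesis using mv1 mv2 by (simp add: N_def n_def \<Delta>_def algebra_simps)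
        qed
        have claimD: "\<bar>D (t + h)\<bar> \<le> \<bar>D t\<bar> + h * (a * N + g * \<delta>)"
        proof -
          have Deq: "D (t + h) = D t + h * cross V1 U + cross V1 (\<rho>1 - \<rho>2) + cross \<nu> \<Delta>'"
          proof -
            have "D (t + h) = cross V1 \<Delta>' + cross \<nu> \<Delta>'"
              unfolding D_def \<nu>_def \<Delta>'_def by (simp add: cross_def algebra_simps)
            also have "cross V1 \<Delta>' = cross V1 \<Delta> + h * cross V1 U + cross V1 (\<rho>1 - \<rho>2)"
              unfolding \<Delta>eq by (simp add: cross_def algebra_simps)
            also have "cross V1 \<Delta> = D t" by (simp add: D_def FV \<Delta>_def)
            finally show ?thesis by simp
          qed
          have "\<bar>cross V1 U\<bar> \<le> 2 * (norm V1 * norm U)" by (rule cross_le)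
          also have "\<dots> \<le> 2 * (K * (2 * K * N))" using FVb U rK by (intro mult_left_mono mult_mono) auto
          finally have c1: "\<bar>h * cross V1 U\<bar> \<le> h * (4 * K\<^sup>2 * N)"
            using h by (simp add: abs_mult power2_eq_square mult_left_mono algebra_simps)
          have "norm (\<rho>1 - \<rho>2) \<le> 2 * (\<delta> * h)" using norm_triangle_ineq4[of \<rho>1 \<rho>2] \<rho> by linarith
          then have "2 * (norm V1 * norm (\<rho>1 - \<rho>2)) \<le> 2 * (K * (2 * (\<delta> * h)))"
            using FVb rK by (intro mult_left_mono mult_mono) auto
          then have c2: "\<bar>cross V1 (\<rho>1 - \<rho>2)\<bar> \<le> h * (4 * K * \<delta>)"
            using cross_le[of V1 "\<rho>1 - \<rho>2"] by (simp add: algebra_simps)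
          have "2 * (norm \<nu> * norm \<Delta>') \<le> 2 * ((K * (h * (2 * K + 1))) * (N + h * (2 * (2 * K + 1))))"
            using \<nu> \<Delta>'n rK h by (intro mult_left_mono mult_mono) auto
          also have "\<dots> = h * (2 * K * (2 * K + 1) * N) + h * (4 * K * (2 * K + 1) ^ 2 * h)"
            by (simp add: power2_eq_square algebra_simps)
          also have "\<dots> \<le> h * (2 * K * (2 * K + 1) * N) + h * (4 * K * (2 * K + 1) ^ 2 * \<delta>)"
            using h rK by (intro add_left_mono mult_left_mono) auto
          finally have c3: "\<bar>cross \<nu> \<Delta>'\<bar> \<le> h * (2 * K * (2 * K + 1) * N) + h * (4 * K * (2 * K + 1) ^ 2 * \<delta>)"
            using cross_le[of \<nu> \<Delta>'] by linarith
          have "h * (a * N + g * \<delta>) = h * (4 * K\<^sup>2 * N) + h * (4 * K * \<delta>)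
             + (h * (2 * K * (2 * K + 1) * N) + h * (4 * K * (2 * K + 1) ^ 2 * \<delta>))"
            unfolding a_def g_def by (simp only: distrib_left distrib_right ac_simps)
          then show ?thesis unfolding Deq using c1 c2 c3 by linarith
        qed
        have D2: "(D (t + h))\<^sup>2 \<le> (D t)\<^sup>2 + h * (2 * (2 * K) * a * N\<^sup>2 + \<delta> * (2 * (2 * K) * g * N + (a * N + g)\<^sup>2))"
          by (rule square_step[OF claimD]) (use D_le[OF tT] h \<delta> N a g rK in \<open>auto simp: N_def\<close>)
        define L1 L2 W1 W2 where "L1 = Lm (z1 t) e" "L2 = Lm (z2 t) e" "W1 = W (z1 t) e" "W2 = W (z2 t) e"
        note LW = L1_L2_W1_W2_def
        have LWb: "\<bar>L1 - L2\<bar> \<le> K * N" "\<bar>W1 - W2\<bar> \<le> K * N" "W1 \<le> 0" "W2 \<le> 0"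
          using L_lip[OF i e] W_lip[OF i e] W_neg[OF i(1) e] W_neg[OF i(2) e] rK by (auto simp: LW N_def n_def)
        define err where "err = d (t + h) - d t - h * ((L1 + \<kappa> * W1) - (L2 + \<mu> * W2))"
        have err: "\<bar>err\<bar> \<le> \<delta> * h * Q"
          unfolding err_def d_def LW Q_def distrib_left[of "\<delta> * h"] using \<kappa>(6) \<mu>(6)
          by (simp only: abs_le_iff) (simp add: algebra_simps)
        have deq: "d (t + h) = d t + h * ((L1 - L2) + \<kappa> * W1 - \<mu> * W2) + err" by (simp add: err_def algebra_simps)
        have crude: "\<bar>h * ((L1 - L2) + \<kappa> * W1 - \<mu> * W2) + err\<bar> \<le> h * G"
        proof -
          have "\<bar>\<kappa> * W1\<bar> \<le> \<bar>W1\<bar>" "\<bar>\<mu> * W2\<bar> \<le> \<bar>W2\<bar>" using \<kappa>(1,2) \<mu>(1,2) by (auto simp: abs_mult mult_left_le_one_le)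
          then have "\<bar>(L1 - L2) + \<kappa> * W1 - \<mu> * W2\<bar> \<le> \<bar>L1\<bar> + \<bar>L2\<bar> + \<bar>W1\<bar> + \<bar>W2\<bar>" by linarith
          then have "\<bar>h * ((L1 - L2) + \<kappa> * W1 - \<mu> * W2)\<bar> \<le> h * (\<bar>L1\<bar> + \<bar>L2\<bar> + \<bar>W1\<bar> + \<bar>W2\<bar>)"
            using h by (simp add: abs_mult)
          moreover have "\<delta> * h * Q \<le> h * Q" by (rule mult_right_mono[OF \<delta>h Q])
          ultimately show ?thesis using err unfolding G_def LW by (simp add: distrib_left) linarith
        qed
        \<comment> \<open>At \<open>d t = 0\<close> the crude bound suffices because its square is
          quadratic in \<open>h\<close>. Otherwise the jump of the field acts with a favourable
          sign.\<close>
        have d2: "(d (t + h))\<^sup>2 \<le> (d t)\<^sup>2 + h * (2 * K * (2 * K) * N\<^sup>2 + \<delta> * ((2 * K * Q * N + (2 * K * N + Q)\<^sup>2) + G\<^sup>2))"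
        proof (cases "d t = 0")
          case True
          then have "\<bar>d (t + h)\<bar> \<le> h * G" using deq crude by simp
          then have "\<bar>d (t + h)\<bar>\<^sup>2 \<le> (h * G)\<^sup>2" by (intro power_mono) auto
          also have "\<dots> = h * (h * G\<^sup>2)" by (simp add: power2_eq_square algebra_simps)
          also have "\<dots> \<le> h * (\<delta> * G\<^sup>2)" using h by (intro mult_left_mono mult_right_mono) auto
          also have "\<dots> \<le> h * (2 * K * (2 * K) * N\<^sup>2 + \<delta> * ((2 * K * Q * N + (2 * K * N + Q)\<^sup>2) + G\<^sup>2))"
          proof -
            have "0 \<le> 2 * K * (2 * K) * N\<^sup>2" using rK by simp
            moreover have "0 \<le> \<delta> * (2 * K * Q * N + (2 * K * N + Q)\<^sup>2)" using B2 \<delta> by simp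
            ultimately show ?thesis using h(1) unfolding distrib_left[of \<delta>] by (intro mult_left_mono) auto
          qed
          finally show ?thesis using True by simp
        next
          case False
          have hG: "h * G < \<bar>d t\<bar>"
          proof -
            have "h * (G + 1) < \<bar>d t\<bar>" using h(4) False G by (simp add: h3_def pos_less_divide_eq)
            then show ?thesis using h(1) by (simp add: distrib_left)
          qed
          have \<mu>W: "\<bar>\<mu> * (W1 - W2)\<bar> \<le> K * N" "\<bar>\<kappa> * (W1 - W2)\<bar> \<le> K * N"
          proof -
            show "\<bar>\<mu> * (W1 - W2)\<bar> \<le> K * N" using \<mu>(1,2) LWb(2) mult_left_le_one_le[of "\<bar>W1 - W2\<bar>" \<mu>] by (simp add: abs_mult)
            show "\<bar>\<kappa> * (W1 - W2)\<bar> \<le> K * N" using \<kappa>(1,2) LWb(2) mult_left_le_one_le[of "\<bar>W1 - W2\<bar>" \<kappa>] by (simp add: abs_mult)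
          qed
          have "\<bar>d (t + h)\<bar> \<le> \<bar>d t\<bar> + h * (2 * K * N + Q * \<delta>)"
          proof (cases "d t > 0")
            case True
            \<comment> \<open>The larger value of \<open>H\<close> belongs to the larger weight of
              the upper field. As \<open>W1 \<le> 0\<close>, the difference of the weights can only
              push \<open>d\<close> back towards zero; what remains is Lipschitz in the
              distance.\<close>
            have "\<mu> \<le> \<kappa>"
            proof (cases "H (z2 t) e < 0")
              case True then show ?thesis using \<mu>(3) \<kappa>(1) by simp
            next
              case F: False
              then have "H (z1 t) e > 0" using True by (simp add: d_def)
              then show ?thesis using \<kappa>(4) \<mu>(2) by simp
            qed
            then have "(\<kappa> - \<mu>) * W1 \<le> 0" using LWb(3) by (simp add: mult_nonneg_nonpos)
            moreover have "(L1 - L2) + \<kappa> * W1 - \<mu> * W2 = (L1 - L2) + (\<kappa> - \<mu>) * W1 + \<mu> * (W1 - W2)" by (simp add: algebra_simps)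
            ultimately have "(L1 - L2) + \<kappa> * W1 - \<mu> * W2 \<le> 2 * K * N" using LWb(1) \<mu>W(1) by linarith
            then have "h * ((L1 - L2) + \<kappa> * W1 - \<mu> * W2) \<le> h * (2 * K * N)" using h by simp
            moreover have "d (t + h) > 0" using deq crude hG True by linarith
            ultimately show ?thesis using deq err True by (simp add: algebra_simps)
          next
            case neg: False
            then have dn: "d t < 0" using False by simp
            have "\<kappa> \<le> \<mu>"
            proof (cases "H (z1 t) e < 0")
              case True then show ?thesis using \<mu>(1) \<kappa>(3) by simp
            next
              case F: False
              then have "H (z2 t) e > 0" using dn by (simp add: d_def)
              then show ?thesis using \<kappa>(2) \<mu>(4) by simp
            qed
            then have "(\<kappa> - \<mu>) * W1 \<ge> 0" using LWb(3) by (simp add: mult_nonpos_nonpos)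
            moreover have "(L1 - L2) + \<kappa> * W1 - \<mu> * W2 = (L1 - L2) + (\<kappa> - \<mu>) * W1 + \<mu> * (W1 - W2)" by (simp add: algebra_simps)
            ultimately have "(L1 - L2) + \<kappa> * W1 - \<mu> * W2 \<ge> - (2 * K * N)" using LWb(1) \<mu>W(1) by linarith
            then have "h * ((L1 - L2) + \<kappa> * W1 - \<mu> * W2) \<ge> h * (- (2 * K * N))" using h by (intro mult_left_mono) auto
            moreover have "d (t + h) < 0" using deq crude hG dn by linarith
            ultimately show ?thesis using deq err dn by (simp add: algebra_simps)
          qed
          then have "(d (t + h))\<^sup>2 \<le> (d t)\<^sup>2 + h * (2 * K * (2 * K) * N\<^sup>2 + \<delta> * (2 * K * Q * N + (2 * K * N + Q)\<^sup>2))"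
            by (rule square_step) (use d_le[OF tT] h \<delta> N Q rK in \<open>auto simp: N_def\<close>)
          also have "\<dots> \<le> (d t)\<^sup>2 + h * (2 * K * (2 * K) * N\<^sup>2 + \<delta> * ((2 * K * Q * N + (2 * K * N + Q)\<^sup>2) + G\<^sup>2))"
            using h \<delta> by (intro add_left_mono mult_left_mono) auto
          finally show ?thesis .
        qed
        \<comment> \<open>The term \<open>- h * \<delta>\<close> comes from the summand 1 in
          \<open>B\<close>, which was there to make \<open>B\<close> positive.\<close>
        have "E (t + h) \<le> E t + h * ((2 * (2 * K) * a + 2 * K * (2 * K)) * N\<^sup>2 + \<delta> * B) - h * \<delta>"
          using D2 d2 unfolding E_def B_def by (simp add: algebra_simps)
        also have "\<dots> \<le> E t + h * ((2 * (2 * K) * a + 2 * K * (2 * K)) * (2 * K\<^sup>2 * E t) + \<eta>)"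
        proof -
          have "(2 * (2 * K) * a + 2 * K * (2 * K)) * N\<^sup>2 \<le> (2 * (2 * K) * a + 2 * K * (2 * K)) * (2 * K\<^sup>2 * E t)"
            using n_le[OF tT] rK a by (intro mult_left_mono) (auto simp: N_def)
          then have "h * ((2 * (2 * K) * a + 2 * K * (2 * K)) * N\<^sup>2 + \<delta> * B) \<le> h * ((2 * (2 * K) * a + 2 * K * (2 * K)) * (2 * K\<^sup>2 * E t) + \<eta>)"
            by (rule mult_left_mono[OF add_mono[OF _ \<delta>(3)]]) (use h(1) in simp)
          then show ?thesis using mult_pos_pos[OF h(1) \<delta>(1)] by linarith
        qed
        also have "\<dots> = E t + h * (C * E t + 0 + \<eta>)" by (simp add: C_def algebra_simps)
        finally show "E (t + h) \<le> E t + h * (C * E t + 0 + \<eta>)" .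
      qed (use h1 h2 h3 t \<delta> in auto)
    qed (use t in auto)
    then have Et: "E t \<le> E 0 * exp (C * t)" by simp
    have T0: "0 \<in> {0..T}" using t by auto
    have "E 0 \<le> 5 * K\<^sup>2 * (n 0)\<^sup>2"
    proof -
      have "(D 0)\<^sup>2 \<le> (2 * K * n 0)\<^sup>2" using D_le[OF T0] by (metis abs_ge_zero power2_abs power_mono)
      moreover have "(d 0)\<^sup>2 \<le> (K * n 0)\<^sup>2" using d_le[OF T0] by (metis abs_ge_zero power2_abs power_mono)
      ultimately show ?thesis by (simp add: E_def power_mult_distrib)
    qed
    then have "E 0 * exp (C * t) \<le> 5 * K\<^sup>2 * (n 0)\<^sup>2 * exp (C * t)" by (intro mult_right_mono) auto
    then have "(n t)\<^sup>2 \<le> 2 * K\<^sup>2 * (5 * K\<^sup>2 * (n 0)\<^sup>2 * exp (C * t))"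
      using n_le[OF t] Et by (meson mult_left_mono order_trans zero_le_mult_iff zero_le_numeral zero_le_power2)
    also have "\<dots> = (K' * exp (C / 2 * t) * n 0)\<^sup>2"
      by (simp add: K'_def power_mult_distrib power2_eq_square[of "exp _"] exp_add[symmetric])
    finally have "n t \<le> K' * exp (C / 2 * t) * n 0"
      by (rule power2_le_imp_le) (use K' in \<open>simp add: n_def\<close>)
    then show "norm (z1 t - z2 t) \<le> K' * exp (C / 2 * t) * norm (z1 0 - z2 0)" by (simp add: n_def)
  qed (use rK C K' in auto)
qed

end

section \<open>Slip and slide arcs\<close>

lemma first_zero:
  fixes f :: "real \<Rightarrow> real"
  assumes cont: "continuous_on {a..b} f" and ab: "a \<le> b" and f: "f a < 0" "f b > 0"
  obtains t where "a < t" "t < b" "f t = 0" "\<And>s. a \<le> s \<Longrightarrow> s < t \<Longrightarrow> f s < 0"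
proof -
  define Z where "Z = {t \<in> {a..b}. f t = 0}"
  have "closed Z"
    unfolding Z_def using continuous_closed_preimage[OF cont closed_real_atLeastAtMost, of "{0}"]
    by (simp add: vimage_def Int_def conj_commute)
  moreover have "Z \<noteq> {}" using IVT'[of f a 0 b] f ab cont unfolding Z_def by force
  moreover have bd: "bdd_below Z" unfolding Z_def by (rule bdd_belowI[of _ a]) auto
  ultimately have I: "Inf Z \<in> Z" using closed_contains_Inf by blast
  show ?thesis
  proof (rule that[of "Inf Z"])
    show "f (Inf Z) = 0" "a < Inf Z" "Inf Z < b" using I f unfolding Z_def by (auto simp: less_le)
    fix s assume s: "a \<le> s" "s < Inf Z"
    show "f s < 0"
    proof (rule ccontr)
      assume "\<not> f s < 0"
      moreover have "continuous_on {a..s} f" using cont I s by (auto intro: continuous_on_subset simp: Z_def)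
      ultimately obtain r where "a \<le> r" "r \<le> s" "f r = 0" using IVT'[of f a 0 s] f s by force
      then have "r \<in> Z" using I s unfolding Z_def by auto
      then show False using cInf_lower[OF _ bd] \<open>r \<le> s\<close> s by force
    qed
  qed
qed

text \<open>The equation is solved for \<open>f\<close> composed with the projection onto the ball.
  The projection does not expand distances and fixes \<open>y\<close>, so Gronwall's inequality
  keeps the solution within \<open>\<theta>\<close> of \<open>y\<close>, hence in the ball, where
  the projection is the identity.\<close>

lemma perturbed_flow:
  fixes f :: "'a::euclidean_space \<Rightarrow> 'a"
  assumes lip: "\<And>z z'. norm z \<le> \<rho> \<Longrightarrow> norm z' \<le> \<rho> \<Longrightarrow> norm (f z - f z') \<le> K * norm (z - z')"
    and lin: "bounded_linear \<Lambda>" and M: "\<And>v. norm (\<Lambda> v) \<le> M * norm v" "M \<ge> 0"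
    and near: "\<And>z. norm z \<le> \<rho> \<Longrightarrow> norm (f z - \<Lambda> z) \<le> \<eta>" and \<eta>: "\<eta> \<ge> 0"
    and y: "\<And>t. t \<in> {0..T} \<Longrightarrow> (y has_vector_derivative \<Lambda> (y t)) (at t within {0..T})"
    and bd: "\<And>t. t \<in> {0..T} \<Longrightarrow> norm (y t) + \<theta> \<le> \<rho>"
    and x0: "norm (x0 - y 0) \<le> \<tau>" and T: "T \<ge> 0" and \<tau>: "(\<tau> + \<eta> * T) * exp (M * T) \<le> \<theta>"
  obtains x where "x 0 = x0"
    "\<And>t. t \<in> {0..T} \<Longrightarrow> (x has_vector_derivative f (x t)) (at t within {0..T})"
    "\<And>t. t \<in> {0..T} \<Longrightarrow> norm (x t - y t) \<le> \<theta>"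
    "\<And>t. t \<in> {0..T} \<Longrightarrow> norm (x t) \<le> \<rho>"
proof -
  have \<tau>0: "0 \<le> \<tau>" using order_trans[OF norm_ge_zero x0] .
  have \<theta>: "\<theta> \<ge> 0" using \<tau> \<tau>0 \<eta> T by (meson add_nonneg_nonneg exp_ge_zero mult_nonneg_nonneg order_trans)
  have \<rho>: "\<rho> \<ge> 0"
  proof -
    have "norm (y 0) + \<theta> \<le> \<rho>" using bd[of 0] T by simp
    then show ?thesis using \<theta> norm_ge_zero[of "y 0"] by linarith
  qed
  define P where "P = closest_point (cball (0::'a) \<rho>)"
  have P: "norm (P z) \<le> \<rho>" for z
    unfolding P_def using closest_point_in_set[of "cball 0 \<rho>" z] \<rho> by simp
  have Pid: "P z = z" if "norm z \<le> \<rho>" for z unfolding P_def using that by (intro closest_point_self) auto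
  have Plip: "norm (P z - P z') \<le> norm (z - z')" for z z'
    unfolding P_def using closest_point_lipschitz[of "cball 0 \<rho>" z z'] \<rho> by (simp add: dist_norm)
  have "norm (f (P x) - f (P y)) \<le> \<bar>K\<bar> * norm (x - y)" for x y
  proof -
    have "norm (f (P x) - f (P y)) \<le> K * norm (P x - P y)" by (rule lip[OF P P])
    also have "\<dots> \<le> \<bar>K\<bar> * norm (P x - P y)" by (intro mult_right_mono) auto
    also have "\<dots> \<le> \<bar>K\<bar> * norm (x - y)" by (intro mult_left_mono Plip) auto
    finally show ?thesis .
  qed
  then obtain x where x: "x 0 = x0"
    "\<And>t. t \<in> {0..T} \<Longrightarrow> (x has_vector_derivative f (P (x t))) (at t within {0..T})"
    using ode_exists[of "\<lambda>z. f (P z)" "\<bar>K\<bar>" T x0] T by auto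
  have dist: "norm (x t - y t) \<le> \<theta>" if t: "t \<in> {0..T}" for t
  proof -
    have "norm (x t - y t) \<le> (norm (x 0 - y 0) + \<eta> * t) * exp (M * t)"
    proof (rule norm_diff_gronwall[OF x(2) y _ M(2) \<eta> t])
      fix s assume s: "s \<in> {0..T}"
      have "norm (y s) \<le> \<rho>" using bd[OF s] \<theta> by simp
      then have "f (P (x s)) - \<Lambda> (y s) = (f (P (x s)) - \<Lambda> (P (x s))) + \<Lambda> (P (x s) - P (y s))"
        using Pid by (simp add: linear_diff[OF bounded_linear.linear[OF lin]])
      also have "norm \<dots> \<le> \<eta> + M * norm (P (x s) - P (y s))"
        by (rule norm_triangle_mono[OF near[OF P] M(1)])
      also have "\<dots> \<le> \<eta> + M * norm (x s - y s)" using M(2) Plip by (intro add_left_mono mult_left_mono) auto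
      finally show "norm (f (P (x s)) - \<Lambda> (y s)) \<le> M * norm (x s - y s) + \<eta>" by simp
    qed
    also have "\<dots> \<le> (\<tau> + \<eta> * T) * exp (M * T)"
      using t x0 x(1) \<eta> M(2) \<tau>0 T by (intro mult_mono add_mono mult_left_mono) (auto intro: add_nonneg_nonneg mult_left_mono)
    finally show ?thesis using \<tau> by simp
  qed
  have bnd: "norm (x t) \<le> \<rho>" if t: "t \<in> {0..T}" for t
    using dist[OF t] bd[OF t] norm_triangle_ineq[of "x t - y t" "y t"] by simp
  show ?thesis
    by (rule that[OF x(1) _ dist bnd]) (use x(2) Pid bnd in \<open>metis (no_types, lifting)\<close>)
qed

section \<open>The neighbourhood of the origin at scale \<open>e\<close>\<close>

context filippov_fold
begin

lemma H_along:
  assumes "(z has_vector_derivative v) (at t within X)"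
  shows "((\<lambda>t. H (z t) e) has_real_derivative blinfun_apply (DH (z t, e)) (v, 0)) (at t within X)"
proof -
  have "(z has_derivative (\<lambda>h. h *\<^sub>R v)) (at t within X)" using assms by (simp add: has_vector_derivative_def)
  from has_derivative_compose[OF this has_derivative_at_withinI[OF H_deriv_z]]
  have "((\<lambda>t. H (z t) e) has_derivative (\<lambda>h. blinfun_apply (DH (z t, e)) (h *\<^sub>R v, 0))) (at t within X)" .
  moreover have "blinfun_apply (DH (z t, e)) (h *\<^sub>R v, 0) = blinfun_apply (DH (z t, e)) (v, 0) * h" for h
    using blinfun.scaleR_right[of "DH (z t, e)" h "(v, 0)"] by (simp add: mult.commute)
  ultimately show ?thesis by (simp add: has_field_derivative_def)
qed

text \<open>The two functionals are linearly independent because \<open>b\<close> and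
  \<open>a21\<close> are nonzero. Their common zero, shifted by the constant \<open>c * e\<close>,
  is the fold, so this is its nondegeneracy.\<close>

lemma linear_coercive:
  obtains \<kappa> where "\<kappa> > 0" "\<And>d. norm d \<le> \<kappa> * (\<bar>b * snd d\<bar> + \<bar>ell d\<bar>)"
proof (rule that[of "1 / \<bar>b\<bar> + (1 + \<bar>a22\<bar>) / \<bar>a21 * b\<bar>"])
  show "1 / \<bar>b\<bar> + (1 + \<bar>a22\<bar>) / \<bar>a21 * b\<bar> > 0" using b a21 by (intro add_pos_pos) auto
  fix d :: "real \<times> real"
  define X where "X = \<bar>b * snd d\<bar> + \<bar>ell d\<bar>"
  have "\<bar>snd d\<bar> = \<bar>b * snd d\<bar> / \<bar>b\<bar>" using b by (simp add: abs_mult)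
  also have "\<dots> \<le> X / \<bar>b\<bar>" unfolding X_def by (intro divide_right_mono) auto
  finally have s: "\<bar>snd d\<bar> \<le> X / \<bar>b\<bar>" .
  have "(a21 * b) * fst d = ell d - a22 * (b * snd d)" by (simp add: ell_def algebra_simps)
  then have "\<bar>a21 * b\<bar> * \<bar>fst d\<bar> = \<bar>ell d - a22 * (b * snd d)\<bar>" by (simp add: abs_mult[symmetric])
  also have "\<dots> \<le> \<bar>ell d\<bar> + \<bar>a22\<bar> * \<bar>b * snd d\<bar>" unfolding abs_mult[of a22, symmetric] by (rule abs_triangle_ineq4)
  also have "\<dots> \<le> (1 + \<bar>a22\<bar>) * X" by (simp add: X_def algebra_simps)
  finally have f: "\<bar>fst d\<bar> \<le> (1 + \<bar>a22\<bar>) * X / \<bar>a21 * b\<bar>" using b a21 by (simp add: pos_le_divide_eq mult.commute)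
  have "norm d \<le> \<bar>fst d\<bar> + \<bar>snd d\<bar>" using norm_Pair_le[of "fst d" "snd d"] by simp
  also have "\<dots> \<le> (1 / \<bar>b\<bar> + (1 + \<bar>a22\<bar>) / \<bar>a21 * b\<bar>) * X" using s f by (simp add: algebra_simps)
  finally show "norm d \<le> (1 / \<bar>b\<bar> + (1 + \<bar>a22\<bar>) / \<bar>a21 * b\<bar>) * (\<bar>b * snd d\<bar> + \<bar>ell d\<bar>)" by (simp add: X_def)
qed

text \<open>The system at scale \<^term>\<open>e\<close> is \<^term>\<open>\<eta>\<close>-close in the C1 sense to its linear limit on the rescaled ball
  of radius \<^term>\<open>R\<close>.\<close>

definition close :: "real \<Rightarrow> real \<Rightarrow> real \<Rightarrow> bool" where
  "close R \<eta> e \<longleftrightarrow> 0 < e \<and> (\<forall>z z'. norm z \<le> R * e \<and> norm z' \<le> R * e \<longrightarrow>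
     norm (Fm z - Fm z' - J (z - z')) \<le> \<eta> * norm (z - z') \<and> norm (Fm z - J z) \<le> \<eta> * e \<and>
     \<bar>H z e - H z' e - b * snd (z - z')\<bar> \<le> \<eta> * norm (z - z') \<and> \<bar>H z e - (b * snd z + c * e)\<bar> \<le> \<eta> * e \<and>
     \<bar>Lm z e - Lm z' e - ell (z - z')\<bar> \<le> \<eta> * norm (z - z') \<and> \<bar>Lm z e - ell z\<bar> \<le> \<eta> * e \<and>
     norm (S z e - S z' e - Sig (z - z')) \<le> \<eta> * norm (z - z') \<and> norm (S z e - Sig z) \<le> \<eta> * e \<and>
     W z e < 0 \<and> Lm z e + W z e < 0)"

lemma closeD:
  assumes "close R \<eta> e"
  shows "0 < e"
    "\<And>z z'. norm z \<le> R * e \<Longrightarrow> norm z' \<le> R * e \<Longrightarrow> norm (Fm z - Fm z' - J (z - z')) \<le> \<eta> * norm (z - z')"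
    "\<And>z. norm z \<le> R * e \<Longrightarrow> norm (Fm z - J z) \<le> \<eta> * e"
    "\<And>z z'. norm z \<le> R * e \<Longrightarrow> norm z' \<le> R * e \<Longrightarrow> \<bar>H z e - H z' e - b * snd (z - z')\<bar> \<le> \<eta> * norm (z - z')"
    "\<And>z. norm z \<le> R * e \<Longrightarrow> \<bar>H z e - (b * snd z + c * e)\<bar> \<le> \<eta> * e"
    "\<And>z z'. norm z \<le> R * e \<Longrightarrow> norm z' \<le> R * e \<Longrightarrow> \<bar>Lm z e - Lm z' e - ell (z - z')\<bar> \<le> \<eta> * norm (z - z')"
    "\<And>z. norm z \<le> R * e \<Longrightarrow> \<bar>Lm z e - ell z\<bar> \<le> \<eta> * e"
    "\<And>z z'. norm z \<le> R * e \<Longrightarrow> norm z' \<le> R * e \<Longrightarrow> norm (S z e - S z' e - Sig (z - z')) \<le> \<eta> * norm (z - z')"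
    "\<And>z. norm z \<le> R * e \<Longrightarrow> norm (S z e - Sig z) \<le> \<eta> * e"
    "\<And>z. norm z \<le> R * e \<Longrightarrow> W z e < 0"
    "\<And>z. norm z \<le> R * e \<Longrightarrow> Lm z e + W z e < 0"
  using assms unfolding close_def by blast+

lemma close_small:
  assumes \<eta>: "\<eta> > 0" and R: "R \<ge> 0"
  obtains e0 where "e0 > 0" "\<And>e. 0 < e \<Longrightarrow> e < e0 \<Longrightarrow> close R \<eta> e"
proof -
  \<comment> \<open>On the ball of radius \<open>R * e\<close> the sum
    \<open>norm z + \<bar>e\<bar>\<close> is at most \<open>(R + 1) * e\<close>; the quotient
    compensates for this factor.\<close>
  define \<eta>' where "\<eta>' = \<eta> / (R + 1)"
  have \<eta>': "\<eta>' > 0" "\<eta>' \<le> \<eta>" "\<eta>' * (R + 1) = \<eta>"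
    using \<eta> R by (auto simp: \<eta>'_def field_simps)
  obtain r1 where r1: "r1 > 0"
    and e1: "\<And>z z'. norm z \<le> r1 \<Longrightarrow> norm z' \<le> r1 \<Longrightarrow> norm (Fm z - Fm z' - J (z - z')) \<le> \<eta>' * norm (z - z')"
    and e2: "\<And>z z' e. norm z \<le> r1 \<Longrightarrow> norm z' \<le> r1 \<Longrightarrow> \<bar>e\<bar> \<le> r1 \<Longrightarrow> \<bar>H z e - H z' e - b * snd (z - z')\<bar> \<le> \<eta>' * norm (z - z')"
    and e3: "\<And>z e. norm z \<le> r1 \<Longrightarrow> \<bar>e\<bar> \<le> r1 \<Longrightarrow> \<bar>H z e - (b * snd z + c * e)\<bar> \<le> \<eta>' * (norm z + \<bar>e\<bar>)"
    and e4: "\<And>z z' e. norm z \<le> r1 \<Longrightarrow> norm z' \<le> r1 \<Longrightarrow> \<bar>e\<bar> \<le> r1 \<Longrightarrow> \<bar>Lm z e - Lm z' e - ell (z - z')\<bar> \<le> \<eta>' * norm (z - z')"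
    and e5: "\<And>z e. norm z \<le> r1 \<Longrightarrow> \<bar>e\<bar> \<le> r1 \<Longrightarrow> \<bar>Lm z e - ell z\<bar> \<le> \<eta>' * (norm z + \<bar>e\<bar>)"
    and e6: "\<And>z z' e. norm z \<le> r1 \<Longrightarrow> norm z' \<le> r1 \<Longrightarrow> \<bar>e\<bar> \<le> r1 \<Longrightarrow> norm (S z e - S z' e - Sig (z - z')) \<le> \<eta>' * norm (z - z')"
    and e7: "\<And>z e. norm z \<le> r1 \<Longrightarrow> \<bar>e\<bar> \<le> r1 \<Longrightarrow> norm (S z e - Sig z) \<le> \<eta>' * (norm z + \<bar>e\<bar>)"
    by (rule estimates[OF \<eta>'(1)]) (rule that; assumption)
  obtain r2 w where r2: "r2 > 0" "w > 0"
    and W: "\<And>z e. norm z \<le> r2 \<Longrightarrow> \<bar>e\<bar> \<le> r2 \<Longrightarrow> W z e \<le> - w"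
    and LW: "\<And>z e. norm z \<le> r2 \<Longrightarrow> \<bar>e\<bar> \<le> r2 \<Longrightarrow> Lm z e + W z e \<le> - w"
    by (rule region) (rule that; assumption)
  show ?thesis
  proof (rule that[of "min r1 r2 / (R + 1)"])
    show "min r1 r2 / (R + 1) > 0" using r1 r2 R by simp
    fix e assume e: "0 < e" "e < min r1 r2 / (R + 1)"
    then have "e * (R + 1) < min r1 r2" using R by (simp add: pos_less_divide_eq)
    moreover have "0 \<le> R * e" using R e by simp
    ultimately have er: "\<bar>e\<bar> \<le> r1" "\<bar>e\<bar> \<le> r2" "R * e \<le> r1" "R * e \<le> r2" using e by (auto simp: algebra_simps)
    have up: "\<eta>' * (norm z + \<bar>e\<bar>) \<le> \<eta> * e" if "norm z \<le> R * e" for z :: "real \<times> real"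
    proof -
      have "\<eta>' * (norm z + \<bar>e\<bar>) \<le> \<eta>' * ((R + 1) * e)" using that e \<eta>' by (intro mult_left_mono) (auto simp: algebra_simps)
      also have "\<dots> = \<eta> * e" using \<eta>'(3) by (simp add: mult.assoc[symmetric])
      finally show ?thesis .
    qed
    have up': "\<eta>' * n \<le> \<eta> * n" if "n \<ge> 0" for n using that \<eta>' by (intro mult_right_mono) auto
    show "close R \<eta> e"
      unfolding close_def
    proof (intro conjI allI impI e(1))
      fix z z' :: "real \<times> real" assume "norm z \<le> R * e \<and> norm z' \<le> R * e"
      then have z: "norm z \<le> R * e" "norm z \<le> r1" "norm z' \<le> r1" "norm z \<le> r2" using er by auto
      note u = up[OF z(1)] and u' = up'[OF norm_ge_zero[of "z - z'"]]
      show "norm (Fm z - Fm z' - J (z - z')) \<le> \<eta> * norm (z - z')" using e1[OF z(2,3)] u' by linarith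
      have "norm (Fm z - J z) \<le> \<eta>' * norm z" using e1[OF z(2), of 0] r1 by (simp add: Fm0)
      also have "\<dots> \<le> \<eta>' * (norm z + \<bar>e\<bar>)" using \<eta>' by (intro mult_left_mono) auto
      finally show "norm (Fm z - J z) \<le> \<eta> * e" using u by linarith
      show "\<bar>H z e - H z' e - b * snd (z - z')\<bar> \<le> \<eta> * norm (z - z')" using e2[OF z(2,3) er(1)] u' by linarith
      show "\<bar>H z e - (b * snd z + c * e)\<bar> \<le> \<eta> * e" using e3[OF z(2) er(1)] u by linarith
      show "\<bar>Lm z e - Lm z' e - ell (z - z')\<bar> \<le> \<eta> * norm (z - z')" using e4[OF z(2,3) er(1)] u' by linarith
      show "\<bar>Lm z e - ell z\<bar> \<le> \<eta> * e" using e5[OF z(2) er(1)] u by linarith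
      show "norm (S z e - S z' e - Sig (z - z')) \<le> \<eta> * norm (z - z')" using e6[OF z(2,3) er(1)] u' by linarith
      show "norm (S z e - Sig z) \<le> \<eta> * e" using e7[OF z(2) er(1)] u by linarith
      show "W z e < 0" "Lm z e + W z e < 0" using W[OF z(4) er(2)] LW[OF z(4) er(2)] r2 by auto
    qed
  qed
qed

end

lemma bounded_linear_pos_bound:
  assumes "bounded_linear A"
  obtains M where "M > 0" "\<And>v. norm (A v) \<le> M * norm v"
  using bounded_linear.pos_bounded[OF assms] by (metis mult.commute)

text \<open>By linearity \<open>e *\<^sub>R y\<close> solves the same limit equation, so no
  rescaling of the field is needed. All errors are measured in units of \<open>e\<close>; the margin
  1 in the bound on \<open>y\<close>, together with \<open>\<theta> \<le> 1\<close>, keeps the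
  solution in the ball.\<close>

lemma scaled_flow:
  fixes f :: "real \<times> real \<Rightarrow> real \<times> real"
  assumes lin: "bounded_linear \<Lambda>" and M: "M > 0" "\<And>v. norm (\<Lambda> v) \<le> M * norm v"
    and e: "e > 0" and \<eta>: "\<eta> \<ge> 0" and T: "T \<ge> 0"
    and lip: "\<And>z z'. norm z \<le> R * e \<Longrightarrow> norm z' \<le> R * e \<Longrightarrow> norm (f z - f z' - \<Lambda> (z - z')) \<le> \<eta> * norm (z - z')"
    and near: "\<And>z. norm z \<le> R * e \<Longrightarrow> norm (f z - \<Lambda> z) \<le> \<eta> * e"
    and y: "\<And>t. (y has_vector_derivative \<Lambda> (y t)) (at t)" and bd: "\<And>t. t \<in> {0..T} \<Longrightarrow> norm (y t) \<le> R - 1"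
    and x0: "norm (x0 - e *\<^sub>R y 0) \<le> \<tau> * e" and tot: "(\<tau> + \<eta> * T) * exp (M * T) \<le> \<theta>" and \<theta>: "\<theta> \<le> 1"
  obtains x where "x 0 = x0" "\<And>t. t \<in> {0..T} \<Longrightarrow> (x has_vector_derivative f (x t)) (at t within {0..T})"
    "\<And>t. t \<in> {0..T} \<Longrightarrow> norm (x t - e *\<^sub>R y t) \<le> \<theta> * e" "\<And>t. t \<in> {0..T} \<Longrightarrow> norm (x t) \<le> R * e"
proof (rule perturbed_flow[where f = f and \<Lambda> = \<Lambda> and y = "\<lambda>t. e *\<^sub>R y t" and T = T and \<rho> = "R * e" and \<theta> = "\<theta> * e"
      and M = M and \<eta> = "\<eta> * e" and \<tau> = "\<tau> * e" and K = "M + \<eta>"])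
  fix z z' :: "real \<times> real" assume z: "norm z \<le> R * e" "norm z' \<le> R * e"
  show "norm (f z - f z') \<le> (M + \<eta>) * norm (z - z')"
    using lip[OF z] M(2)[of "z - z'"] norm_triangle_ineq[of "f z - f z' - \<Lambda> (z - z')" "\<Lambda> (z - z')"]
    by (simp add: distrib_right)
next
  fix t assume t: "t \<in> {0..T}"
  have "((\<lambda>t. e *\<^sub>R y t) has_vector_derivative e *\<^sub>R \<Lambda> (y t)) (at t within {0..T})"
    by (intro has_vector_derivative_scaleR[where g = y and f = "\<lambda>t. e" and f' = 0, simplified] has_vector_derivative_at_within[OF y])
  then show "((\<lambda>t. e *\<^sub>R y t) has_vector_derivative \<Lambda> (e *\<^sub>R y t)) (at t within {0..T})"
    by (simp add: linear_cmul[OF bounded_linear.linear[OF lin]])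
  have "e * norm (y t) \<le> e * (R - 1)" using bd[OF t] e by (intro mult_left_mono) auto
  moreover have "\<theta> * e \<le> 1 * e" using \<theta> e by (intro mult_right_mono) auto
  moreover have "norm (e *\<^sub>R y t) = e * norm (y t)" using e by simp
  moreover have "e * (R - 1) = R * e - e" by (simp add: algebra_simps)
  ultimately show "norm (e *\<^sub>R y t) + \<theta> * e \<le> R * e" by linarith
next
  have "(\<tau> * e + \<eta> * e * T) * exp (M * T) = ((\<tau> + \<eta> * T) * exp (M * T)) * e" by (simp add: algebra_simps)
  also have "\<dots> \<le> \<theta> * e" using tot e by (intro mult_right_mono) auto
  finally show "(\<tau> * e + \<eta> * e * T) * exp (M * T) \<le> \<theta> * e" .
qed (use lin M \<eta> e T near x0 that in auto)

section \<open>Persistence of the slip arc and the slide arc\<close>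

context filippov_fold
begin

definition slip_arc where
  "slip_arc R e A T x \<longleftrightarrow> T > 0 \<and> x 0 = A \<and>
     (\<forall>t\<in>{0..T}. (x has_vector_derivative Fm (x t)) (at t within {0..T}) \<and> norm (x t) \<le> R * e) \<and>
     (\<forall>t. 0 < t \<and> t < T \<longrightarrow> H (x t) e < 0) \<and> H (x 0) e = 0 \<and> H (x T) e = 0"

text \<open>\<open>Lm > 0\<close> before the final time means that the lower field points into the
  curve; the upper field does so everywhere in the region considered. The arc stops at the fold,
  where \<open>Lm\<close> vanishes for the first time.\<close>

definition slide_arc where
  "slide_arc R e B T s \<longleftrightarrow> T > 0 \<and> s 0 = B \<and>
     (\<forall>t\<in>{0..T}. (s has_vector_derivative S (s t) e) (at t within {0..T}) \<and> norm (s t) \<le> R * e \<and> H (s t) e = 0) \<and>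
     (\<forall>t. 0 \<le> t \<and> t < T \<longrightarrow> Lm (s t) e > 0) \<and> Lm (s T) e = 0"

lemma close_Lm_continuous:
  assumes cl: "close R \<eta> e" and z: "continuous_on X z" "\<And>t. t \<in> X \<Longrightarrow> norm (z t) \<le> R * e"
  shows "continuous_on X (\<lambda>t. Lm (z t) e)"
proof -
  obtain N where N: "N > 0" "\<And>v. norm (ell v) \<le> N * norm v" using bounded_linear_pos_bound[OF ell_lin] by blast
  have "continuous_on (cball 0 (R * e)) (\<lambda>z. Lm z e)"
  proof (rule lipschitz_on_continuous_on[of "N + \<bar>\<eta>\<bar>"], rule lipschitz_onI)
    fix x y :: "real \<times> real" assume xy: "x \<in> cball 0 (R * e)" "y \<in> cball 0 (R * e)"
    have "\<bar>Lm x e - Lm y e - ell (x - y)\<bar> \<le> \<eta> * norm (x - y)" using closeD(6)[OF cl, of x y] xy by simp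
    also have "\<dots> \<le> \<bar>\<eta>\<bar> * norm (x - y)" by (intro mult_right_mono) auto
    finally show "dist (Lm x e) (Lm y e) \<le> (N + \<bar>\<eta>\<bar>) * dist x y"
      using N(2)[of "x - y"] by (simp add: dist_norm distrib_right)
  qed (use N in auto)
  then show ?thesis by (rule continuous_on_compose2[OF _ z(1)]) (use z(2) in auto)
qed

lemma slide_H:
  assumes cl: "close R \<eta> e"
    and s: "\<And>t. t \<in> {0..T} \<Longrightarrow> (s has_vector_derivative S (s t) e) (at t within {0..T})"
      "\<And>t. t \<in> {0..T} \<Longrightarrow> norm (s t) \<le> R * e"
    and s0: "H (s 0) e = 0" and t: "t \<in> {0..T}"
  shows "H (s t) e = 0"
proof -
  have "((\<lambda>t. H (s t) e) has_real_derivative 0) (at t within {0..T})" if "t \<in> {0..T}" for t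
    using H_along[OF s(1)[OF that], of e] DH_S[of "s t" e] closeD(10)[OF cl s(2)[OF that]] by simp
  then obtain k where "\<forall>t\<in>{0..T}. H (s t) e = k"
    using has_field_derivative_zero_constant[of "{0..T}" "\<lambda>t. H (s t) e"] by (auto simp: convex_real_interval)
  then show ?thesis using t s0 by auto
qed

end

text \<open>\<open>\<psi>\<close> and \<open>\<sigma>\<close> are the slip arc (starting at the fold) and the slide arc (starting at the landing point and
  continued beyond the fold) of the rescaled limit system.\<close>

locale fold_cycle = filippov_fold +
  fixes \<psi> \<sigma> :: "real \<Rightarrow> real \<times> real" and T0 T2 R :: real
  assumes \<psi>: "\<And>t. (\<psi> has_vector_derivative J (\<psi> t)) (at t)"
    and \<psi>0: "b * snd (\<psi> 0) + c = 0" "ell (\<psi> 0) = 0" and visible: "ell (J (\<psi> 0)) < 0"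
    and T0: "T0 > 0" and below: "\<And>t. 0 < t \<Longrightarrow> t < T0 \<Longrightarrow> b * snd (\<psi> t) + c < 0"
    and land: "b * snd (\<psi> T0) + c = 0" "ell (\<psi> T0) > 0"
    and T2: "T2 > 0" and \<sigma>: "\<And>t. (\<sigma> has_vector_derivative Sig (\<sigma> t)) (at t)"
    and \<sigma>0: "\<sigma> 0 = \<psi> T0" and \<sigma>T: "ell (\<sigma> T2) < 0"
    and R: "\<And>t. t \<in> {0..T0 + 1} \<Longrightarrow> norm (\<psi> t) \<le> R - 1" "\<And>t. t \<in> {0..T2} \<Longrightarrow> norm (\<sigma> t) \<le> R - 1"
begin

lemma R1: "R \<ge> 1"
proof -
  have "norm (\<psi> 0) \<le> R - 1" using R(1)[of 0] T0 by simp
  then show ?thesis using norm_ge_zero[of "\<psi> 0"] by linarith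
qed

text \<open>The limit slide is followed past the fold to a point where \<open>ell\<close> is
  negative. This gives \<open>Lm\<close> a strict change of sign that survives the perturbation, and
  its first zero ends the arc.\<close>

lemma slide:
  obtains \<tau> \<eta> where "\<tau> > 0" "\<eta> > 0"
    "\<And>e z1. close R \<eta> e \<Longrightarrow> H z1 e = 0 \<Longrightarrow> norm (z1 - e *\<^sub>R \<psi> T0) \<le> \<tau> * e \<Longrightarrow>
       \<exists>T s. slide_arc R e z1 T s"
proof -
  obtain M where M: "M > 0" "\<And>v. norm (Sig v) \<le> M * norm v" using bounded_linear_pos_bound[OF Sig_lin] by blast
  obtain N where N: "N > 0" "\<And>v. norm (ell v) \<le> N * norm v" using bounded_linear_pos_bound[OF ell_lin] by blast
  \<comment> \<open>At both ends of \<open>\<sigma>\<close> the modulus of \<open>ell\<close> is at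
    least \<open>l\<close>. Half of it may be lost: \<open>l / 4\<close> by the displacement of the
    orbit, controlled by \<open>\<theta>\<close>, and \<open>l / 4\<close> by the linearisation of
    \<open>Lm\<close>, controlled by \<open>\<eta>\<close>.\<close>
  define l where "l = min (ell (\<psi> T0)) (- ell (\<sigma> T2))"
  have l: "l > 0" "l \<le> ell (\<psi> T0)" "l \<le> - ell (\<sigma> T2)" using land \<sigma>T by (auto simp: l_def)
  define \<theta> where "\<theta> = min 1 (l / (4 * N))"
  have "N * \<theta> \<le> N * (l / (4 * N))" using N by (intro mult_left_mono) (auto simp: \<theta>_def)
  then have \<theta>: "\<theta> > 0" "\<theta> \<le> 1" "N * \<theta> \<le> l / 4" using l N by (auto simp: \<theta>_def)
  define E where "E = exp (M * T2)"
  have E: "E > 0" by (simp add: E_def)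
  define \<tau> where "\<tau> = \<theta> / (2 * E)"
  define \<eta> where "\<eta> = min (l / 4) (\<theta> / (2 * E * T2))"
  have \<tau>: "\<tau> > 0" and \<eta>: "\<eta> > 0" "\<eta> \<le> l / 4" using \<theta> E l T2 by (auto simp: \<tau>_def \<eta>_def)
  have "\<eta> * T2 \<le> \<theta> / (2 * E * T2) * T2" using T2 by (intro mult_right_mono) (auto simp: \<eta>_def)
  then have "\<eta> * T2 \<le> \<theta> / (2 * E)" using T2 by simp
  then have "(\<tau> + \<eta> * T2) * E \<le> (\<theta> / (2 * E) + \<theta> / (2 * E)) * E" using E by (intro mult_right_mono) (auto simp: \<tau>_def)
  then have tot: "(\<tau> + \<eta> * T2) * E \<le> \<theta>" using E by simp
  show ?thesis
  proof (rule that[OF \<tau> \<eta>(1)])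
    fix e z1 assume cl: "close R \<eta> e" and H1: "H z1 e = 0" and z1: "norm (z1 - e *\<^sub>R \<psi> T0) \<le> \<tau> * e"
    note e = closeD(1)[OF cl]
    obtain x where x: "x 0 = z1" "\<And>t. t \<in> {0..T2} \<Longrightarrow> (x has_vector_derivative S (x t) e) (at t within {0..T2})"
      "\<And>t. t \<in> {0..T2} \<Longrightarrow> norm (x t - e *\<^sub>R \<sigma> t) \<le> \<theta> * e" "\<And>t. t \<in> {0..T2} \<Longrightarrow> norm (x t) \<le> R * e"
      by (rule scaled_flow[OF Sig_lin M e less_imp_le[OF \<eta>(1)] less_imp_le[OF T2] closeD(8)[OF cl] closeD(9)[OF cl] \<sigma> R(2)
            _ tot[unfolded E_def] \<theta>(2)]) (use z1 \<sigma>0 that in auto)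
    have Lx: "\<bar>Lm (x t) e - e * ell (\<sigma> t)\<bar> \<le> l / 2 * e" if t: "t \<in> {0..T2}" for t
    proof -
      have "\<bar>Lm (x t) e - ell (x t)\<bar> \<le> \<eta> * e" by (rule closeD(7)[OF cl x(4)[OF t]])
      moreover have "\<eta> * e \<le> l / 4 * e" using \<eta> e by (intro mult_right_mono) auto
      moreover have "ell (x t) - e * ell (\<sigma> t) = ell (x t - e *\<^sub>R \<sigma> t)"
        using linear_diff[OF bounded_linear.linear[OF ell_lin]] linear_cmul[OF bounded_linear.linear[OF ell_lin]] by simp
      moreover have "\<bar>ell (x t - e *\<^sub>R \<sigma> t)\<bar> \<le> l / 4 * e"
      proof -
        have "\<bar>ell (x t - e *\<^sub>R \<sigma> t)\<bar> \<le> N * norm (x t - e *\<^sub>R \<sigma> t)" using N(2)[of "x t - e *\<^sub>R \<sigma> t"] by simp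
        also have "\<dots> \<le> N * (\<theta> * e)" using x(3)[OF t] N by (intro mult_left_mono) auto
        also have "\<dots> \<le> l / 4 * e" using mult_right_mono[OF \<theta>(3), of e] e by (simp add: mult.assoc)
        finally show ?thesis .
      qed
      ultimately show ?thesis by linarith
    qed
    have "continuous_on {0..T2} x" using x(2) by (intro continuous_on_vector_derivative) auto
    then have contL: "continuous_on {0..T2} (\<lambda>t. - Lm (x t) e)"
      by (intro continuous_on_minus close_Lm_continuous[OF cl]) (use x(4) in auto)
    have "l / 2 * e > 0" using l e by simp
    moreover have "e * l \<le> e * ell (\<psi> T0)" by (rule mult_left_mono[OF l(2)]) (use e in simp)
    moreover have "e * l \<le> - (e * ell (\<sigma> T2))" using mult_left_mono[OF l(3), of e] e by simp
    moreover have "e * l = 2 * (l / 2 * e)" by simp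
    moreover have "\<bar>Lm (x 0) e - e * ell (\<psi> T0)\<bar> \<le> l / 2 * e" "\<bar>Lm (x T2) e - e * ell (\<sigma> T2)\<bar> \<le> l / 2 * e"
      using Lx[of 0] Lx[of T2] T2 by (simp_all add: \<sigma>0)
    ultimately have "- Lm (x 0) e < 0" "- Lm (x T2) e > 0" by linarith+
    then obtain T where T: "0 < T" "T < T2" "- Lm (x T) e = 0" "\<And>s. 0 \<le> s \<Longrightarrow> s < T \<Longrightarrow> - Lm (x s) e < 0"
      using first_zero[OF contL] T2 by (metis less_imp_le)
    have H0: "H (x t) e = 0" if "t \<in> {0..T2}" for t
      by (rule slide_H[OF cl x(2) x(4) _ that]) (use x(1) H1 in auto)
    show "\<exists>T s. slide_arc R e z1 T s" unfolding slide_arc_def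
    proof (intro exI[of _ T] exI[of _ x] conjI ballI allI impI)
      fix t assume t: "t \<in> {0..T}"
      then have t2: "t \<in> {0..T2}" using T by auto
      show "(x has_vector_derivative S (x t) e) (at t within {0..T})"
        by (rule has_vector_derivative_within_subset[OF x(2)[OF t2]]) (use T in auto)
      show "norm (x t) \<le> R * e" "H (x t) e = 0" using x(4)[OF t2] H0[OF t2] by auto
    next
      fix t assume "0 \<le> t \<and> t < T" then show "Lm (x t) e > 0" using T(4)[of t] by simp
    qed (use T x in auto)
  qed
qed

text \<open>The pair \<open>(H, Lm)\<close> is a perturbation of an injective linear map. With the
  Lipschitz constant \<open>1 / (4 * \<kappa>)\<close> in each component the remainder accounts for
  at most half of the distance, so the pair is injective on the ball.\<close>

lemma fold_unique:
  obtains \<eta> where "\<eta> > 0"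
    "\<And>e z z'. close R \<eta> e \<Longrightarrow> norm z \<le> R * e \<Longrightarrow> norm z' \<le> R * e \<Longrightarrow>
       H z e = 0 \<Longrightarrow> Lm z e = 0 \<Longrightarrow> H z' e = 0 \<Longrightarrow> Lm z' e = 0 \<Longrightarrow> z = z'"
proof -
  obtain \<kappa> where \<kappa>: "\<kappa> > 0" "\<And>d. norm d \<le> \<kappa> * (\<bar>b * snd d\<bar> + \<bar>ell d\<bar>)" using linear_coercive by blast
  show ?thesis
  proof (rule that[of "1 / (4 * \<kappa>)"])
    show "1 / (4 * \<kappa>) > 0" using \<kappa> by simp
    fix e z z' assume cl: "close R (1 / (4 * \<kappa>)) e" and z: "norm z \<le> R * e" "norm z' \<le> R * e"
      and f: "H z e = 0" "Lm z e = 0" "H z' e = 0" "Lm z' e = 0"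
    have "norm (z - z') \<le> \<kappa> * (1 / (4 * \<kappa>) * norm (z - z') + 1 / (4 * \<kappa>) * norm (z - z'))"
      using closeD(4)[OF cl z] closeD(6)[OF cl z] f \<kappa>(1)
      by (intro order_trans[OF \<kappa>(2)] mult_left_mono add_mono) (auto simp del: snd_diff)
    also have "\<dots> = norm (z - z') / 2" using \<kappa>(1) by (simp add: field_simps)
    finally show "z = z'" by simp
  qed
qed

lemma fold_near:
  obtains \<kappa> where "\<kappa> > 0"
    "\<And>e z \<eta>. close R \<eta> e \<Longrightarrow> norm z \<le> R * e \<Longrightarrow> H z e = 0 \<Longrightarrow> Lm z e = 0 \<Longrightarrow> norm (z - e *\<^sub>R \<psi> 0) \<le> \<kappa> * (\<eta> * e)"
proof -
  obtain \<kappa> where \<kappa>: "\<kappa> > 0" "\<And>d. norm d \<le> \<kappa> * (\<bar>b * snd d\<bar> + \<bar>ell d\<bar>)" using linear_coercive by blast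
  show ?thesis
  proof (rule that[of "2 * \<kappa>"])
    fix e z \<eta> assume cl: "close R \<eta> e" and z: "norm z \<le> R * e" and f: "H z e = 0" "Lm z e = 0"
    have "b * snd (z - e *\<^sub>R \<psi> 0) = (b * snd z + c * e) - e * (b * snd (\<psi> 0) + c)" by (simp add: algebra_simps)
    then have 1: "\<bar>b * snd (z - e *\<^sub>R \<psi> 0)\<bar> \<le> \<eta> * e" using closeD(5)[OF cl z] f \<psi>0 by (simp add: abs_minus_commute)
    have "ell (z - e *\<^sub>R \<psi> 0) = ell z"
      using linear_diff[OF bounded_linear.linear[OF ell_lin]] linear_cmul[OF bounded_linear.linear[OF ell_lin]] \<psi>0 by simp
    then have 2: "\<bar>ell (z - e *\<^sub>R \<psi> 0)\<bar> \<le> \<eta> * e" using closeD(7)[OF cl z] f by simp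
    have "norm (z - e *\<^sub>R \<psi> 0) \<le> \<kappa> * (\<eta> * e + \<eta> * e)"
      using 1 2 \<kappa>(1) by (intro order_trans[OF \<kappa>(2)] mult_left_mono add_mono) auto
    then show "norm (z - e *\<^sub>R \<psi> 0) \<le> 2 * \<kappa> * (\<eta> * e)" by simp
  qed (use \<kappa> in simp)
qed

text \<open>On the vertical segment through \<open>e *\<^sub>R \<psi> T0\<close> the function
  \<open>H\<close> is \<open>b * s\<close> up to half of the value at the ends, so the intermediate
  value theorem applies. The point serves to start a first slide, by which the perturbed fold is
  found.\<close>

lemma switching_point:
  assumes \<tau>: "\<tau> > 0" "\<tau> \<le> 1"
  obtains \<eta> where "\<eta> > 0"
    "\<And>e. close R \<eta> e \<Longrightarrow> \<exists>z. H z e = 0 \<and> norm (z - e *\<^sub>R \<psi> T0) \<le> \<tau> * e"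
proof (rule that[of "\<bar>b\<bar> * \<tau> / 2"])
  show "\<bar>b\<bar> * \<tau> / 2 > 0" using b \<tau> by simp
  fix e assume cl: "close R (\<bar>b\<bar> * \<tau> / 2) e"
  note e = closeD(1)[OF cl]
  define z where "z s = e *\<^sub>R \<psi> T0 + (0, s)" for s
  have nz: "norm (z s) \<le> R * e" if "\<bar>s\<bar> \<le> \<tau> * e" for s
  proof -
    have "norm (z s) \<le> e * norm (\<psi> T0) + \<bar>s\<bar>"
      unfolding z_def using norm_triangle_ineq[of "e *\<^sub>R \<psi> T0" "(0, s)"] e by (simp add: norm_Pair)
    also have "\<dots> \<le> e * (R - 1) + 1 * e"
      using R(1)[of T0] T0 e order_trans[OF that mult_right_mono[OF \<tau>(2), of e]] by (intro add_mono mult_left_mono) auto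
    finally show ?thesis by (simp add: algebra_simps)
  qed
  have Hz: "\<bar>H (z s) e - b * s\<bar> \<le> \<bar>b\<bar> * \<tau> / 2 * e" if "\<bar>s\<bar> \<le> \<tau> * e" for s
  proof -
    have "b * snd (z s) + c * e = b * s + e * (b * snd (\<psi> T0) + c)" by (simp add: z_def algebra_simps)
    then show ?thesis using closeD(5)[OF cl nz[OF that]] land by simp
  qed
  have cont: "continuous_on {- (\<tau> * e)..\<tau> * e} (\<lambda>s. H (z s) e)"
    unfolding z_def by (rule continuous_on_compose2[OF H_cont[of UNIV]]) (auto intro!: continuous_intros)
  have te: "\<tau> * e > 0" using \<tau> e by simp
  define q where "q = b * (\<tau> * e)"
  have q: "\<bar>H (z (\<tau> * e)) e - q\<bar> \<le> \<bar>q\<bar> / 2" "\<bar>H (z (- (\<tau> * e))) e + q\<bar> \<le> \<bar>q\<bar> / 2"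
    using Hz[of "- (\<tau> * e)"] Hz[of "\<tau> * e"] te \<tau> e by (simp_all add: q_def abs_mult)
  have "\<exists>s. \<bar>s\<bar> \<le> \<tau> * e \<and> H (z s) e = 0"
  proof (cases "b > 0")
    case True
    then have "q > 0" unfolding q_def using te by simp
    then have "H (z (- (\<tau> * e))) e \<le> 0" "0 \<le> H (z (\<tau> * e)) e"
      using q by linarith+
    then obtain s where "s \<ge> - (\<tau> * e)" "s \<le> \<tau> * e" "H (z s) e = 0"
      using IVT'[OF _ _ _ cont, of 0] te by auto
    then show ?thesis by (intro exI[of _ s]) auto
  next
    case False
    then have "q < 0" unfolding q_def using te b by (simp add: mult_neg_pos)
    then have "H (z (- (\<tau> * e))) e \<ge> 0" "0 \<ge> H (z (\<tau> * e)) e"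
      using q by linarith+
    then obtain s where "s \<ge> - (\<tau> * e)" "s \<le> \<tau> * e" "H (z s) e = 0"
      using IVT2'[OF _ _ _ cont, of 0] te by auto
    then show ?thesis by (intro exI[of _ s]) auto
  qed
  then obtain s where "\<bar>s\<bar> \<le> \<tau> * e" "H (z s) e = 0" by blast
  then show "\<exists>z. H z e = 0 \<and> norm (z - e *\<^sub>R \<psi> T0) \<le> \<tau> * e"
    by (intro exI[of _ "z s"]) (simp add: z_def norm_Pair)
qed

lemma \<psi>_within: "(\<psi> has_vector_derivative J (\<psi> t)) (at t within X)"
  by (rule has_vector_derivative_at_within[OF \<psi>])

lemma \<psi>_cont: "continuous_on X \<psi>"
  using \<psi>_within by (intro continuous_on_vector_derivative) blast

lemma H_lin_deriv: "((\<lambda>t. b * snd (\<psi> t) + c) has_real_derivative ell (\<psi> t)) (at t)"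
proof -
  have "((\<lambda>t. snd (\<psi> t)) has_vector_derivative snd (J (\<psi> t))) (at t)"
    by (rule bounded_linear.has_vector_derivative[OF bounded_linear_snd \<psi>])
  then have "((\<lambda>t. snd (\<psi> t)) has_real_derivative snd (J (\<psi> t))) (at t)"
    by (simp add: has_real_derivative_iff_has_vector_derivative)
  then show ?thesis by (auto intro!: derivative_eq_intros simp: J_def ell_def algebra_simps)
qed

text \<open>Three time intervals need different arguments. Just after the fold, two-point estimates
  show \<open>Lm < 0\<close>, hence \<open>H\<close> decreases; up to shortly before
  \<open>T0\<close>, \<open>H\<close> is negative by comparison with the limit; shortly after
  \<open>T0\<close> it is positive. The first zero after the initial interval is the landing
  time.\<close>

lemma slip:
  assumes \<tau>: "\<tau> > 0"
  obtains \<eta> where "\<eta> > 0"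
    "\<And>e z. close R \<eta> e \<Longrightarrow> norm z \<le> R * e \<Longrightarrow> H z e = 0 \<Longrightarrow> Lm z e = 0 \<Longrightarrow>
       \<exists>T x. slip_arc R e z T x \<and> norm (x T - e *\<^sub>R \<psi> T0) \<le> \<tau> * e"
proof -
  obtain M where M: "M > 0" "\<And>v. norm (J v) \<le> M * norm v" using bounded_linear_pos_bound[OF J_lin] by blast
  obtain N where N: "N > 0" "\<And>v. norm (ell v) \<le> N * norm v" using bounded_linear_pos_bound[OF ell_lin] by blast
  obtain \<kappa> where \<kappa>: "\<kappa> > 0"
    "\<And>e z \<eta>. close R \<eta> e \<Longrightarrow> norm z \<le> R * e \<Longrightarrow> H z e = 0 \<Longrightarrow> Lm z e = 0 \<Longrightarrow> norm (z - e *\<^sub>R \<psi> 0) \<le> \<kappa> * (\<eta> * e)"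
    using fold_near by blast
  define c0 where "c0 = - ell (J (\<psi> 0))"
  have c0: "c0 > 0" using visible by (simp add: c0_def)
  \<comment> \<open>Chosen so that \<open>N * q = c0 / 2\<close>: of the rate \<open>c0\<close> at
    which \<open>ell\<close> decreases at the fold, one half may be lost to the drift error of the
    orbit and a further quarter to the linearisation of \<open>Lm\<close>.\<close>
  define q where "q = c0 / (2 * N)"
  have q: "q > 0" using c0 N by (simp add: q_def)
  define g where "g t = b * snd (\<psi> t) + c" for t
  have gcont: "continuous_on X g" for X unfolding g_def by (intro continuous_intros \<psi>_cont)
  have "isCont \<psi> 0" using \<psi>_cont[of UNIV] continuous_on_eq_continuous_at by blast
  then obtain d1 where d1: "d1 > 0" "\<And>t. \<bar>t\<bar> < d1 \<Longrightarrow> norm (\<psi> t - \<psi> 0) < q / (4 * M)"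
    using q M unfolding continuous_at_eps_delta by (metis diff_zero dist_norm divide_pos_pos mult_pos_pos zero_less_numeral real_norm_def)
  define t1 where "t1 = min (d1 / 2) (T0 / 4)"
  have t1: "t1 > 0" "t1 < d1" "t1 \<le> T0 / 4" using d1 T0 by (auto simp: t1_def)
  have "isCont \<psi> T0" using \<psi>_cont[of UNIV] continuous_on_eq_continuous_at by blast
  then obtain d2 where d2: "d2 > 0" "\<And>t. \<bar>t - T0\<bar> < d2 \<Longrightarrow> norm (\<psi> t - \<psi> T0) < \<tau> / 2"
    using \<tau> unfolding continuous_at_eps_delta by (metis dist_norm half_gt_zero real_norm_def)
  obtain d3 where d3: "d3 > 0" "\<And>h. h > 0 \<Longrightarrow> h < d3 \<Longrightarrow> g T0 < g (T0 + h)"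
    using DERIV_pos_inc_right[OF H_lin_deriv[of T0] land(2)] unfolding g_def by blast
  \<comment> \<open>Half-width of the window for the landing time: in it \<open>\<psi>\<close> stays
    within \<open>\<tau> / 2\<close> of \<open>\<psi> T0\<close>, and \<open>g\<close> is positive
    at its right end. The bound \<open>T0 / 4\<close> separates the window from \<open>t1\<close>;
    the bound 1 keeps it where \<open>R\<close> bounds \<open>\<psi>\<close>.\<close>
  define t2 where "t2 = Min {d2 / 2, d3 / 2, T0 / 4, 1}"
  have t2: "t2 > 0" "t2 < d2" "t2 < d3" "t2 \<le> T0 / 4" "t2 \<le> 1" using d2 d3 T0 by (auto simp: t2_def)
  define T where "T = T0 + t2"
  have T: "T > 0" "T \<le> T0 + 1" using T0 t2 by (auto simp: T_def)
  obtain m1 where m1: "m1 > 0" "\<And>t. t \<in> {t1..T0 - t2} \<Longrightarrow> g t \<le> - m1"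
  proof -
    have "t1 \<le> T0 - t2" using t1 t2 T0 by linarith
    then obtain s where s: "s \<in> {t1..T0 - t2}" "\<And>t. t \<in> {t1..T0 - t2} \<Longrightarrow> g t \<le> g s"
      using continuous_attains_sup[OF compact_Icc _ gcont, of t1 "T0 - t2"] by auto
    have "g s < 0" unfolding g_def using below[of s] s(1) t1 t2 by auto
    then show thesis using s by (intro that[of "- g s"]) auto
  qed
  define m where "m = min m1 (g T)"
  have gT: "g T > 0" using d3(2)[of t2] t2 land unfolding T_def g_def by simp
  have m: "m > 0" "m \<le> m1" "m \<le> g T" using m1 gT by (auto simp: m_def)
  define \<theta> where "\<theta> = Min {1, \<tau> / 2, m / (4 * \<bar>b\<bar>), q / (4 * M)}"
  have \<theta>: "\<theta> > 0" "\<theta> \<le> 1" "\<theta> \<le> \<tau> / 2" "\<theta> \<le> m / (4 * \<bar>b\<bar>)" "\<theta> \<le> q / (4 * M)"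
    using \<tau> m b q M by (auto simp: \<theta>_def)
  have \<theta>b: "\<bar>b\<bar> * \<theta> \<le> m / 4" and \<theta>M: "M * \<theta> \<le> q / 4" using \<theta>(4,5) b M by (auto simp: field_simps)
  define E where "E = exp (M * T)"
  have E: "E > 0" by (simp add: E_def)
  define j where "j = norm (J (\<psi> 0)) + q"
  have j: "j > 0" unfolding j_def using q by (simp add: add_nonneg_pos)
  define \<eta> where "\<eta> = Min {\<theta> / (E * (\<kappa> + T)), m / 4, q / 4, c0 / (4 * j)}"
  have \<eta>: "\<eta> > 0" using \<theta> E \<kappa>(1) T m q c0 j by (auto simp: \<eta>_def)
  have \<eta>': "\<eta> \<le> \<theta> / (E * (\<kappa> + T))" "\<eta> \<le> m / 4" "\<eta> \<le> q / 4" "\<eta> \<le> c0 / (4 * j)"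
    unfolding \<eta>_def by (rule Min_le, simp, simp)+
  note \<eta> = \<eta> \<eta>'
  have \<eta>j: "\<eta> * j \<le> c0 / 4" using \<eta>(5) j by (simp add: field_simps)
  have "\<eta> * (E * (\<kappa> + T)) \<le> \<theta>" using \<eta>(2) E \<kappa> T by (simp add: pos_le_divide_eq)
  then have tot: "(\<kappa> * \<eta> + \<eta> * T) * E \<le> \<theta>" by (simp add: algebra_simps)
  show ?thesis
  proof (rule that[OF \<eta>(1)])
    fix e z assume cl: "close R \<eta> e" and z: "norm z \<le> R * e" and Hz: "H z e = 0" and Lz: "Lm z e = 0"
    note e = closeD(1)[OF cl]
    obtain x where x: "x 0 = z" "\<And>t. t \<in> {0..T} \<Longrightarrow> (x has_vector_derivative Fm (x t)) (at t within {0..T})"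
      "\<And>t. t \<in> {0..T} \<Longrightarrow> norm (x t - e *\<^sub>R \<psi> t) \<le> \<theta> * e" "\<And>t. t \<in> {0..T} \<Longrightarrow> norm (x t) \<le> R * e"
    proof (rule scaled_flow[OF J_lin M e less_imp_le[OF \<eta>(1)] less_imp_le[OF T(1)] closeD(2)[OF cl] closeD(3)[OF cl] \<psi> R(1)
            _ tot[unfolded E_def] \<theta>(2)])
      show "norm (z - e *\<^sub>R \<psi> 0) \<le> \<kappa> * \<eta> * e" using \<kappa>(2)[OF cl z Hz Lz] by (simp add: mult.assoc)
    qed (use T that in auto)
    have Hx: "\<bar>H (x t) e - e * g t\<bar> \<le> m / 2 * e" if t: "t \<in> {0..T}" for t
    proof -
      have "\<bar>H (x t) e - (b * snd (x t) + c * e)\<bar> \<le> \<eta> * e" by (rule closeD(5)[OF cl x(4)[OF t]])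
      moreover have "\<eta> * e \<le> m / 4 * e" using \<eta> e by (intro mult_right_mono) auto
      moreover have "(b * snd (x t) + c * e) - e * g t = b * snd (x t - e *\<^sub>R \<psi> t)" by (simp add: g_def algebra_simps)
      moreover have "\<bar>b * snd (x t - e *\<^sub>R \<psi> t)\<bar> \<le> m / 4 * e"
      proof -
        have "\<bar>snd (x t - e *\<^sub>R \<psi> t)\<bar> \<le> norm (x t - e *\<^sub>R \<psi> t)"
          by (metis norm_snd_le prod.collapse real_norm_def)
        also have "\<dots> \<le> \<theta> * e" by (rule x(3)[OF t])
        finally have "\<bar>b\<bar> * \<bar>snd (x t - e *\<^sub>R \<psi> t)\<bar> \<le> \<bar>b\<bar> * (\<theta> * e)" by (rule mult_left_mono) simp
        also have "\<dots> \<le> m / 4 * e" using mult_right_mono[OF \<theta>b, of e] e by (simp add: mult.assoc)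
        finally show ?thesis by (simp add: abs_mult)
      qed
      ultimately show ?thesis by linarith
    qed
    have me: "m * e > 0" using m e by simp
    have HT: "H (x T) e > 0"
    proof -
      have "m * e \<le> e * g T" using mult_right_mono[OF m(3), of e] e by (simp add: mult.commute)
      moreover have "\<bar>H (x T) e - e * g T\<bar> \<le> m / 2 * e" by (rule Hx) (use T in simp)
      moreover have "m / 2 * e = m * e / 2" by simp
      ultimately show ?thesis using me by linarith
    qed
    have Hmid: "H (x t) e < 0" if t: "t \<in> {t1..T0 - t2}" for t
    proof -
      have "e * g t \<le> e * (- m)" using m1(2)[OF t] m e by (intro mult_left_mono) auto
      then have "e * g t \<le> - (m * e)" by (simp add: mult.commute)
      moreover have "t \<in> {0..T}" using t t1 t2 by (auto simp: T_def)
      then have "\<bar>H (x t) e - e * g t\<bar> \<le> m / 2 * e" by (rule Hx)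
      moreover have "m / 2 * e = m * e / 2" by simp
      ultimately show ?thesis using me by linarith
    qed
    have Ls: "Lm (x t) e < 0" if t: "0 < t" "t \<le> t1" for t
    proof -
      have t1T: "t1 \<le> T" using t1 t2 T0 by (simp add: T_def)
      have tT: "t \<in> {0..T}" using t t1T by auto
      \<comment> \<open>The straight line with the limit velocity at the fold. The drift of
        \<open>x\<close> from it has rate at most \<open>q * e\<close>, so \<open>x t - z\<close> is
        known up to an error proportional to \<open>t\<close>; comparison with \<open>\<psi>\<close>
        alone would leave an error that does not vanish as \<open>t\<close> tends to 0.\<close>
      define y where "y s = z + (s * e) *\<^sub>R J (\<psi> 0)" for s
      have "norm (x t - y t) \<le> (norm (x 0 - y 0) + (q * e) * t) * exp (0 * t)"
      proof (rule norm_diff_gronwall[where T = t1 and y' = "\<lambda>s. e *\<^sub>R J (\<psi> 0)" and x' = "\<lambda>s. Fm (x s)"])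
        fix s assume s: "s \<in> {0..t1}"
        then have sT: "s \<in> {0..T}" using t1T by auto
        show "(x has_vector_derivative Fm (x s)) (at s within {0..t1})"
          by (rule has_vector_derivative_within_subset[OF x(2)[OF sT]]) (use t1T in auto)
        show "(y has_vector_derivative e *\<^sub>R J (\<psi> 0)) (at s within {0..t1})"
          unfolding y_def by (auto intro!: derivative_eq_intros)
        have 1: "norm (Fm (x s) - J (x s)) \<le> q / 4 * e"
          by (rule order_trans[OF closeD(3)[OF cl x(4)[OF sT]] mult_right_mono[OF \<eta>(4)]]) (use e in simp)
        have 2: "norm (J (x s - e *\<^sub>R \<psi> s)) \<le> q / 4 * e"
        proof -
          have "norm (J (x s - e *\<^sub>R \<psi> s)) \<le> M * (\<theta> * e)"
            using M x(3)[OF sT] by (intro order_trans[OF M(2)] mult_left_mono) auto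
          also have "\<dots> \<le> q / 4 * e" unfolding mult.assoc[symmetric] by (rule mult_right_mono[OF \<theta>M]) (use e in simp)
          finally show ?thesis .
        qed
        have 3: "norm (J (e *\<^sub>R (\<psi> s - \<psi> 0))) \<le> q / 4 * e"
        proof -
          have "norm (\<psi> s - \<psi> 0) \<le> q / (4 * M)" using d1(2)[of s] s t1 by auto
          then have "e * norm (\<psi> s - \<psi> 0) \<le> e * (q / (4 * M))" by (rule mult_left_mono) (use e in simp)
          then have "norm (e *\<^sub>R (\<psi> s - \<psi> 0)) \<le> e * (q / (4 * M))" using e by simp
          then have "norm (J (e *\<^sub>R (\<psi> s - \<psi> 0))) \<le> M * (e * (q / (4 * M)))"
            by (intro order_trans[OF M(2)] mult_left_mono) (use M(1) in simp_all)
          then show ?thesis using M by (simp add: field_simps)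
        qed
        note lin = bounded_linear.linear[OF J_lin]
        have "Fm (x s) - e *\<^sub>R J (\<psi> 0) = (Fm (x s) - J (x s)) + J (x s - e *\<^sub>R \<psi> s) + J (e *\<^sub>R (\<psi> s - \<psi> 0))"
          by (simp add: linear_diff[OF lin] linear_cmul[OF lin] algebra_simps)
        also have "norm \<dots> \<le> q / 4 * e + q / 4 * e + q / 4 * e"
          by (intro norm_triangle_mono 1 2 3)
        also have "\<dots> \<le> q * e" using q e by simp
        finally show "norm (Fm (x s) - e *\<^sub>R J (\<psi> 0)) \<le> 0 * norm (x s - y s) + q * e" by simp
      qed (use q e t in auto)
      then have D: "norm (x t - y t) \<le> q * e * t" by (simp add: x(1) y_def)
      have te: "t * e > 0" using t e by simp
      have "ell (x t - z) = t * e * ell (J (\<psi> 0)) + ell (x t - y t)"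
      proof -
        have "x t - z = (t * e) *\<^sub>R J (\<psi> 0) + (x t - y t)" by (simp add: y_def)
        then show ?thesis using linear_add[OF bounded_linear.linear[OF ell_lin]] linear_cmul[OF bounded_linear.linear[OF ell_lin]]
          by (metis real_scaleR_def)
      qed
      moreover have "\<bar>ell (x t - y t)\<bar> \<le> c0 / 2 * (t * e)"
      proof -
        have "\<bar>ell (x t - y t)\<bar> \<le> N * (q * e * t)" using N D by (metis mult_left_mono order_trans less_imp_le real_norm_def)
        also have "\<dots> = c0 / 2 * (t * e)" using N by (simp add: q_def)
        finally show ?thesis .
      qed
      moreover have "\<bar>Lm (x t) e - Lm z e - ell (x t - z)\<bar> \<le> c0 / 4 * (t * e)"
      proof -
        have "x t - z = (t * e) *\<^sub>R J (\<psi> 0) + (x t - y t)" by (simp add: y_def)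
        then have "norm (x t - z) \<le> norm ((t * e) *\<^sub>R J (\<psi> 0)) + norm (x t - y t)" by (simp only: norm_triangle_ineq)
        also have "\<dots> \<le> j * (t * e)" using D te by (simp add: j_def algebra_simps)
        finally have "\<eta> * norm (x t - z) \<le> \<eta> * (j * (t * e))" using \<eta> by (intro mult_left_mono) auto
        also have "\<dots> \<le> c0 / 4 * (t * e)" using mult_right_mono[OF \<eta>j, of "t * e"] te by (simp add: mult.assoc)
        finally show ?thesis using closeD(6)[OF cl x(4)[OF tT] z] by linarith
      qed
      moreover have "t * e * ell (J (\<psi> 0)) = - (c0 * (t * e))" by (simp add: c0_def)
      moreover have "c0 * (t * e) > 0" using c0 te by simp
      ultimately show ?thesis using Lz by linarith
    qed
    have xc: "continuous_on {0..T} x" using x(2) by (intro continuous_on_vector_derivative) auto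
    have Hc: "continuous_on {0..T} (\<lambda>t. H (x t) e)" by (rule continuous_on_compose2[OF H_cont[of UNIV] xc]) auto
    have Hs: "H (x t) e < 0" if t: "0 < t" "t \<le> t1" for t
    proof -
      have t1T: "t1 < T" using t1 t2 T0 by (simp add: T_def)
      have "H (x t) e < H (x 0) e"
      proof (rule DERIV_neg_imp_decreasing_open[OF t(1)])
        fix s assume s: "0 < s" "s < t"
        have "(x has_vector_derivative Fm (x s)) (at s)"
          using x(2)[of s] s t t1T at_within_interior[of s "{0..T}"] by (auto simp: interior_atLeastAtMost_real)
        from H_along[OF this, of e] have "((\<lambda>t. H (x t) e) has_real_derivative Lm (x s) e) (at s)"
          by (simp add: Lm_def)
        then show "\<exists>y. ((\<lambda>t. H (x t) e) has_real_derivative y) (at s) \<and> y < 0" using Ls[of s] s t by auto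
      qed (use Hc t t1T in \<open>auto intro: continuous_on_subset\<close>)
      then show ?thesis using x(1) Hz by simp
    qed
    have "H (x t1) e < 0" using Hs[of t1] t1 by simp
    moreover have "continuous_on {t1..T} (\<lambda>t. H (x t) e)" using Hc t1 by (auto intro: continuous_on_subset)
    moreover have "t1 \<le> T" using t1 t2 T0 by (simp add: T_def)
    ultimately obtain T1 where T1: "t1 < T1" "T1 < T" "H (x T1) e = 0" "\<And>s. t1 \<le> s \<Longrightarrow> s < T1 \<Longrightarrow> H (x s) e < 0"
      using first_zero[of t1 T "\<lambda>t. H (x t) e"] HT by metis
    have T1T0: "\<bar>T1 - T0\<bar> < d2"
    proof -
      have "\<not> T1 \<le> T0 - t2" using Hmid[of T1] T1 by auto
      then show ?thesis using T1(2) t2 by (simp add: T_def)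
    qed
    have T1m: "T1 \<in> {0..T}" using T1 t1 by auto
    show "\<exists>T x. slip_arc R e z T x \<and> norm (x T - e *\<^sub>R \<psi> T0) \<le> \<tau> * e" unfolding slip_arc_def
    proof (intro exI[of _ T1] exI[of _ x] conjI ballI allI impI)
      fix t assume t: "t \<in> {0..T1}"
      then have tT: "t \<in> {0..T}" using T1 by auto
      show "(x has_vector_derivative Fm (x t)) (at t within {0..T1})"
        by (rule has_vector_derivative_within_subset[OF x(2)[OF tT]]) (use T1 in auto)
      show "norm (x t) \<le> R * e" by (rule x(4)[OF tT])
    next
      fix t assume "0 < t \<and> t < T1" then show "H (x t) e < 0" using Hs[of t] T1(4)[of t] by linarith
    next
      have "norm (e *\<^sub>R (\<psi> T1 - \<psi> T0)) \<le> \<tau> / 2 * e"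
        using d2(2)[OF T1T0] e by (simp add: mult.commute mult_left_mono less_imp_le)
      moreover have "\<theta> * e \<le> \<tau> / 2 * e" using \<theta> e by (intro mult_right_mono) auto
      moreover have eq: "x T1 - e *\<^sub>R \<psi> T0 = (x T1 - e *\<^sub>R \<psi> T1) + e *\<^sub>R (\<psi> T1 - \<psi> T0)" by (simp add: algebra_simps)
      have "norm (x T1 - e *\<^sub>R \<psi> T0) \<le> norm (x T1 - e *\<^sub>R \<psi> T1) + norm (e *\<^sub>R (\<psi> T1 - \<psi> T0))"
        unfolding eq by (rule norm_triangle_ineq)
      moreover have "\<tau> / 2 * e + \<tau> / 2 * e = \<tau> * e" by simp
      ultimately show "norm (x T1 - e *\<^sub>R \<psi> T0) \<le> \<tau> * e"
        using x(3)[OF T1m] by linarith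
    qed (use T1 t1 x Hz in auto)
  qed
qed

end

section \<open>The stick-slip cycle and its stability\<close>

lemma has_integral_shifted_derivative:
  fixes y :: "real \<Rightarrow> 'a::banach"
  assumes y: "\<And>t. t \<in> {0..T} \<Longrightarrow> (y has_vector_derivative v t) (at t within {0..T})"
    and t: "0 \<le> t" "t \<le> T"
  shows "((\<lambda>s. v (s - a)) has_integral (y t - y 0)) {a..a + t}"
proof -
  have "((\<lambda>s. v (s - a)) has_integral (y (a + t - a) - y (a - a))) {a..a + t}"
  proof (rule fundamental_theorem_of_calculus)
    fix s assume s: "s \<in> {a..a + t}"
    have im: "(\<lambda>s. s - a) ` {a..a + t} = {0..t}"
      using image_add_atLeastAtMost[of "- a" a "a + t"] by simp
    have "(y has_vector_derivative v (s - a)) (at (s - a) within (\<lambda>s. s - a) ` {a..a + t})"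
      unfolding im by (rule has_vector_derivative_within_subset[OF y]) (use s t in auto)
    moreover have "((\<lambda>s. s - a) has_vector_derivative 1) (at s within {a..a + t})"
      by (auto intro!: derivative_eq_intros)
    ultimately show "((\<lambda>s. y (s - a)) has_vector_derivative v (s - a)) (at s within {a..a + t})"
      using vector_diff_chain_within[of "\<lambda>s. s - a" 1 s "{a..a + t}" y "v (s - a)"] by (simp add: o_def)
  qed (use t in simp)
  then show ?thesis by simp
qed

lemma periodic_shift:
  fixes f :: "real \<Rightarrow> 'a"
  assumes "\<And>t. t \<ge> 0 \<Longrightarrow> f (t + p) = f t" "p > 0" "t \<ge> 0"
  shows "f (t + real n * p) = f t"
proof (induction n)
  case (Suc n)
  have "f (t + real (Suc n) * p) = f ((t + real n * p) + p)" by (simp add: algebra_simps)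
  also have "\<dots> = f (t + real n * p)" using assms by simp
  finally show ?case using Suc by simp
qed simp

definition frac_part :: "real \<Rightarrow> real \<Rightarrow> real" where
  "frac_part p t = t - p * of_int \<lfloor>t / p\<rfloor>"

lemma frac_part_range: "p > 0 \<Longrightarrow> 0 \<le> frac_part p t \<and> frac_part p t < p"
proof -
  assume p: "p > 0"
  have "of_int \<lfloor>t / p\<rfloor> \<le> t / p" "t / p < of_int \<lfloor>t / p\<rfloor> + 1" by linarith+
  from mult_right_mono[OF this(1), of p] mult_strict_right_mono[OF this(2) p]
  have "of_int \<lfloor>t / p\<rfloor> * p \<le> t" "t < (of_int \<lfloor>t / p\<rfloor> + 1) * p" using p by simp_all
  then show ?thesis by (simp add: frac_part_def algebra_simps)
qed

lemma frac_part_eq: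
  assumes "p > 0" "0 \<le> r" "r < p"
  shows "frac_part p (p * of_int n + r) = r"
proof -
  have "\<lfloor>(p * of_int n + r) / p\<rfloor> = n"
    using assms by (intro floor_unique) (auto simp: field_simps)
  then show ?thesis by (simp add: frac_part_def)
qed

lemma frac_part_periodic: "p > 0 \<Longrightarrow> frac_part p (t + p) = frac_part p t"
  by (simp add: frac_part_def add_divide_distrib algebra_simps)

section \<open>The arcs joined to a periodic solution\<close>

context filippov_fold
begin

definition cyc where
  "cyc T1 p x s t = (if frac_part p t \<le> T1 then x (frac_part p t) else s (frac_part p t - T1))"

text \<open>The weight of the upper field is \<open>- (Lm / W)\<close>. It is nonnegative because
  the lower field points upwards and at most 1 because \<open>Lm + W\<close> is negative; so
  \<open>S\<close> is the Filippov sliding field there.\<close>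

lemma S_in_segment:
  assumes "W z e < 0" "Lm z e + W z e < 0" "0 \<le> Lm z e"
  shows "S z e \<in> closed_segment (Fp z) (Fm z)"
    and "S z e = Fm z + (- (Lm z e / W z e)) *\<^sub>R V z" "0 \<le> - (Lm z e / W z e)" "- (Lm z e / W z e) \<le> 1"
proof -
  show eq: "S z e = Fm z + (- (Lm z e / W z e)) *\<^sub>R V z" by (simp add: S_def)
  show k: "0 \<le> - (Lm z e / W z e)" "- (Lm z e / W z e) \<le> 1"
    using assms by (auto simp: divide_nonneg_neg field_simps)
  show "S z e \<in> closed_segment (Fp z) (Fm z)"
    unfolding closed_segment_def
    using k by (auto simp: eq V_def algebra_simps intro!: exI[of _ "1 - (- (Lm z e / W z e))"])
qed

lemma slide_arc_dini:
  assumes cl: "close R \<eta> e" and s: "slide_arc R e B T s"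
  shows "dini_sol e T s"
proof (rule dini_sol_smooth[where \<kappa> = "\<lambda>t. - (Lm (s t) e / W (s t) e)"])
  fix t assume t: "t \<in> {0..T}"
  have n: "norm (s t) \<le> R * e" and H0: "H (s t) e = 0" using s t by (auto simp: slide_arc_def)
  have "0 \<le> Lm (s t) e" using s t by (cases "t = T") (auto simp: slide_arc_def less_imp_le)
  note seg = S_in_segment[OF closeD(10)[OF cl n] closeD(11)[OF cl n] this]
  show "(s has_vector_derivative Fm (s t) + - (Lm (s t) e / W (s t) e) *\<^sub>R V (s t)) (at t within {0..T})"
    using s t unfolding seg(2)[symmetric] by (auto simp: slide_arc_def)
  show "0 \<le> - (Lm (s t) e / W (s t) e) \<and> - (Lm (s t) e / W (s t) e) \<le> 1 \<and>
      (H (s t) e < 0 \<longrightarrow> - (Lm (s t) e / W (s t) e) = 0) \<and> (H (s t) e > 0 \<longrightarrow> - (Lm (s t) e / W (s t) e) = 1)"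
    using seg(3,4) H0 by simp
qed

text \<open>The velocity is periodic by construction, and its integral over one period is zero
  because the slide ends where the slip began. Hence its primitive is the periodic curve
  itself.\<close>

lemma cyc_filippov:
  assumes cl: "close R \<eta> e" and x: "slip_arc R e A T1 x" and s: "slide_arc R e (x T1) Ts s" and ret: "s Ts = A"
  defines "p \<equiv> T1 + Ts"
  shows "filippov_sol fp gp fm gm H e (cyc T1 p x s)"
    and "\<And>t. norm (cyc T1 p x s t) \<le> R * e" "\<And>t. H (cyc T1 p x s t) e \<le> 0"
    and "\<And>t. 0 \<le> t \<Longrightarrow> t \<le> T1 \<Longrightarrow> cyc T1 p x s t = x t"
    and "\<And>t. T1 \<le> t \<Longrightarrow> t < p \<Longrightarrow> cyc T1 p x s t = s (t - T1)"
    and "\<And>t. cyc T1 p x s (t + p) = cyc T1 p x s t"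
proof -
  have T: "T1 > 0" "Ts > 0" using x s by (auto simp: slip_arc_def slide_arc_def)
  then have p: "p > 0" "T1 < p" by (auto simp: p_def)
  let ?g = "cyc T1 p x s"
  note fr = frac_part_range[OF p(1)]
  define v where "v r = (if r \<le> T1 then Fm (x r) else S (s (r - T1)) e)" for r
  define w where "w t = v (frac_part p t)" for t
  define g0 where "g0 r = (if r \<le> T1 then x r else s (r - T1))" for r
  have g: "?g t = g0 (frac_part p t)" for t by (simp add: cyc_def g0_def)
  have junction: "s 0 = x T1" using s by (simp add: slide_arc_def)
  have xd: "\<And>t. t \<in> {0..T1} \<Longrightarrow> (x has_vector_derivative Fm (x t)) (at t within {0..T1})"
    and sd: "\<And>t. t \<in> {0..Ts} \<Longrightarrow> (s has_vector_derivative S (s t) e) (at t within {0..Ts})"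
    using x s by (auto simp: slip_arc_def slide_arc_def)
  \<comment> \<open>The starting time \<open>a\<close> is arbitrary so that one computation covers
    every period.\<close>
  have piece: "((\<lambda>t. v (t - a)) has_integral (g0 r - A)) {a..a + r}" if r: "0 \<le> r" "r \<le> p" for a r
  proof (cases "r \<le> T1")
    case True
    have "((\<lambda>t. Fm (x (t - a))) has_integral (x r - x 0)) {a..a + r}"
      by (rule has_integral_shifted_derivative[OF xd]) (use r True in auto)
    then have "((\<lambda>t. v (t - a)) has_integral (x r - x 0)) {a..a + r}"
      by (rule has_integral_eq[rotated]) (use True in \<open>auto simp: v_def\<close>)
    then show ?thesis using True x by (simp add: g0_def slip_arc_def)
  next
    case False
    have "((\<lambda>t. Fm (x (t - a))) has_integral (x T1 - x 0)) {a..a + T1}"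
      by (rule has_integral_shifted_derivative[OF xd]) (use T in auto)
    then have i1: "((\<lambda>t. v (t - a)) has_integral (x T1 - x 0)) {a..a + T1}"
      by (rule has_integral_eq[rotated]) (auto simp: v_def)
    have "(a + T1) + (r - T1) = a + r" by simp
    moreover have "((\<lambda>t. S (s (t - (a + T1))) e) has_integral (s (r - T1) - s 0)) {a + T1..(a + T1) + (r - T1)}"
      by (rule has_integral_shifted_derivative[OF sd]) (use r False in \<open>auto simp: p_def\<close>)
    ultimately have "((\<lambda>t. S (s (t - (a + T1))) e) has_integral (s (r - T1) - s 0)) {a + T1..a + r}" by metis
    then have i2: "((\<lambda>t. v (t - a)) has_integral (s (r - T1) - s 0)) {a + T1..a + r}"
      by (rule has_integral_spike_finite[rotated 2, where S = "{a + T1}"]) (auto simp: v_def algebra_simps)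
    show ?thesis
      using has_integral_combine[OF _ _ i1 i2] T False junction x by (simp add: g0_def slip_arc_def)
  qed
  have w_eq: "w (p * of_int n + r) = v r" if "0 \<le> r" "r < p" for n r
    unfolding w_def using frac_part_eq[OF p(1) that] by simp
  \<comment> \<open>For \<open>r = p\<close> the right end point already has phase 0, where
    \<open>w\<close> restarts while \<open>v\<close> is still sliding. This single point is
    removed.\<close>
  have pieceW: "(w has_integral (g0 r - A)) {p * of_int n..p * of_int n + r}" if r: "0 \<le> r" "r \<le> p" for n r
  proof (rule has_integral_spike_finite[OF _ _ piece[OF r]])
    fix t assume t: "t \<in> {p * of_int n..p * of_int n + r} - {p * of_int n + p}"
    then have "w (p * of_int n + (t - p * of_int n)) = v (t - p * of_int n)" by (intro w_eq) (use r in auto)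
    then show "w t = v (t - p * of_int n)" by simp
  qed simp
  have g0p: "g0 p = A" using p ret by (simp add: g0_def p_def)
  have periods: "(w has_integral 0) {0..p * of_int (int N)}" for N
  proof (induction N)
    case (Suc N)
    have "(w has_integral 0) {p * of_int (int N)..p * of_int (int N) + p}"
      using pieceW[of p "int N"] p g0p by simp
    from has_integral_combine[OF _ _ Suc this] show ?case using p by (simp add: algebra_simps)
  qed (use has_integral_refl(2)[of w 0] in simp)
  have int: "(w has_integral (?g t - ?g 0)) {0..t}" if t: "t \<ge> 0" for t
  proof -
    define N where "N = nat \<lfloor>t / p\<rfloor>"
    have "\<lfloor>t / p\<rfloor> \<ge> 0" using t p by simp
    then have N: "\<lfloor>t / p\<rfloor> = int N" by (simp add: N_def)
    define r where "r = frac_part p t"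
    have r: "0 \<le> r" "r < p" "t = p * of_int (int N) + r" using fr[of t] N by (auto simp: r_def frac_part_def)
    have "(w has_integral (g0 r - A)) {p * of_int (int N)..t}" using pieceW[of r "int N"] r by simp
    from has_integral_combine[OF _ _ periods this]
    have "(w has_integral (g0 r - A)) {0..t}" using r p by simp
    moreover have "?g 0 = A" using g[of 0] T x by (simp add: frac_part_def g0_def slip_arc_def)
    ultimately show ?thesis using g[of t] by (simp add: r_def)
  qed
  have nb: "norm (?g t) \<le> R * e" and Hb: "H (?g t) e \<le> 0" for t
  proof -
    define r where "r = frac_part p t"
    have "norm (g0 r) \<le> R * e \<and> H (g0 r) e \<le> 0"
    proof (cases "r \<le> T1")
      case True
      then have "H (x r) e \<le> 0" using x fr[of t] by (cases "r = 0"; cases "r = T1") (auto simp: slip_arc_def r_def less_imp_le)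
      then show ?thesis using True x fr[of t] by (auto simp: g0_def slip_arc_def r_def)
    next
      case False
      then have "r - T1 \<in> {0..Ts}" using fr[of t] by (auto simp: r_def p_def)
      then show ?thesis using False s by (auto simp: g0_def slide_arc_def)
    qed
    then show "norm (?g t) \<le> R * e" "H (?g t) e \<le> 0" by (auto simp: g r_def)
  qed
  then show "\<And>t. norm (?g t) \<le> R * e" "\<And>t. H (?g t) e \<le> 0" by auto
  \<comment> \<open>The last alternative does not concern membership: it gives the uniform bound on
    \<open>w\<close> from which absolute integrability follows.\<close>
  have mem: "w t \<in> filippov_map fp gp fm gm H e (?g t) \<and> w t \<in> closed_segment (Fp (?g t)) (Fm (?g t)) \<and> (w t = Fm (?g t) \<or> w t = S (?g t) e)" for t
  proof (cases "frac_part p t \<le> T1")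
    case True
    then have "w t = Fm (?g t)" by (simp add: w_def v_def g g0_def)
    then show ?thesis using Hb[of t] by (auto simp: filippov_map_def Fm_def Fp_def)
  next
    case False
    define q where "q = frac_part p t - T1"
    have q: "0 \<le> q" "q < Ts" using False fr[of t] by (auto simp: q_def p_def)
    have gq: "?g t = s q" using False by (simp add: g g0_def q_def)
    have "norm (s q) \<le> R * e" "H (s q) e = 0" "0 \<le> Lm (s q) e" using s q by (auto simp: slide_arc_def less_imp_le)
    then have "S (s q) e \<in> closed_segment (Fp (s q)) (Fm (s q))" "H (s q) e = 0"
      using S_in_segment(1) closeD(10,11)[OF cl] by auto
    moreover have "w t = S (s q) e" using False by (simp add: w_def v_def q_def)
    ultimately show ?thesis unfolding gq by (simp add: filippov_map_def Fm_def Fp_def)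
  qed
  show "filippov_sol fp gp fm gm H e ?g"
    unfolding filippov_sol_def
  proof (intro exI[of _ w] conjI allI impI)
    fix t :: real assume t: "t \<ge> 0"
    show i: "(w has_integral (?g t - ?g 0)) {0..t}" by (rule int[OF t])
    obtain MJ where MJ: "MJ > 0" "\<And>v. norm (J v) \<le> MJ * norm v" using bounded_linear_pos_bound[OF J_lin] by blast
    obtain MS where MS: "MS > 0" "\<And>v. norm (Sig v) \<le> MS * norm v" using bounded_linear_pos_bound[OF Sig_lin] by blast
    have wb: "norm (w t) \<le> \<eta> * e + (MJ + MS) * (R * e)" for t
    proof -
      have n: "norm (?g t) \<le> R * e" by (rule nb)
      have "norm (J (?g t)) \<le> MJ * (R * e)" "norm (Sig (?g t)) \<le> MS * (R * e)"
        using MJ MS n by (auto intro: order_trans[OF MJ(2)] order_trans[OF MS(2)] mult_left_mono)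
      moreover have "0 \<le> MJ * (R * e)" "0 \<le> MS * (R * e)" using order_trans[OF norm_ge_zero n] MJ MS by auto
      moreover have "norm (Fm (?g t)) \<le> \<eta> * e + norm (J (?g t))"
        using closeD(3)[OF cl n] norm_triangle_ineq[of "Fm (?g t) - J (?g t)" "J (?g t)"] by simp
      moreover have "norm (S (?g t) e) \<le> \<eta> * e + norm (Sig (?g t))"
        using closeD(9)[OF cl n] norm_triangle_ineq[of "S (?g t) e - Sig (?g t)" "Sig (?g t)"] by simp
      ultimately show ?thesis using mem[of t] by (auto simp: distrib_right)
    qed
    show "w absolutely_integrable_on {0..t}"
      by (rule absolutely_integrable_integrable_bound[OF wb]) (use i in auto)
  next
    show "AE t in lebesgue. 0 \<le> t \<longrightarrow> w t \<in> filippov_map fp gp fm gm H e (?g t)" using mem by simp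
  qed
  show "?g t = x t" if "0 \<le> t" "t \<le> T1" for t
    using g[of t] frac_part_eq[OF p(1), of t 0] that p by (simp add: g0_def)
  show "?g t = s (t - T1)" if "T1 \<le> t" "t < p" for t
    using g[of t] frac_part_eq[OF p(1), of t 0] that p T junction by (cases "t = T1") (auto simp: g0_def)
  show "?g (t + p) = ?g t" for t by (simp add: cyc_def frac_part_periodic[OF p(1)])
qed

section \<open>Attraction to the cycle in finite time\<close>

lemma dini_sol_mono: "dini_sol e T z \<Longrightarrow> T' \<le> T \<Longrightarrow> dini_sol e T' z"
  unfolding dini_sol_def by (auto intro: continuous_on_subset)

text \<open>Continuous dependence in the form suited to stability: only the reference solution is
  assumed to stay near the origin. The smallness of the initial distance must keep the other one
  there.\<close>

definition tracks :: "real \<Rightarrow> real \<Rightarrow> real \<Rightarrow> bool" where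
  "tracks r C K \<longleftrightarrow> r > 0 \<and> C \<ge> 0 \<and> K \<ge> 1 \<and>
     (\<forall>e T z1 z2 t. \<bar>e\<bar> \<le> r \<and> dini_sol e T z1 \<and> dini_sol e T z2 \<and> (\<forall>s\<in>{0..T}. norm (z1 s) \<le> r / 2) \<and>
        K * exp (C * T) * norm (z1 0 - z2 0) < r / 2 \<and> t \<in> {0..T} \<longrightarrow>
        norm (z1 t - z2 t) \<le> K * exp (C * T) * norm (z1 0 - z2 0)) \<and>
     (\<forall>z z' e. norm z \<le> r \<and> norm z' \<le> r \<and> \<bar>e\<bar> \<le> r \<longrightarrow>
        \<bar>H z e - H z' e\<bar> \<le> K * norm (z - z') \<and> \<bar>Lm z e - Lm z' e\<bar> \<le> K * norm (z - z') \<and>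
        \<bar>W z e - W z' e\<bar> \<le> K * norm (z - z'))"

lemma tracks_exist: obtains r C K where "tracks r C K"
proof -
  obtain r1 C K1 where r1: "r1 > 0" "C \<ge> 0" "K1 > 0"
    and dep: "\<And>e T z1 z2 t. \<bar>e\<bar> \<le> r1 \<Longrightarrow> dini_sol e T z1 \<Longrightarrow> dini_sol e T z2 \<Longrightarrow>
        (\<And>s. s \<in> {0..T} \<Longrightarrow> norm (z1 s) \<le> r1 \<and> norm (z2 s) \<le> r1) \<Longrightarrow> t \<in> {0..T} \<Longrightarrow>
        norm (z1 t - z2 t) \<le> K1 * exp (C * t) * norm (z1 0 - z2 0)"
    by (rule continuous_dependence) (rule that; blast)
  obtain r2 K2 where r2: "r2 > 0" "K2 > 0"
    and lip: "\<And>z z' e. norm z \<le> r2 \<Longrightarrow> norm z' \<le> r2 \<Longrightarrow> \<bar>e\<bar> \<le> r2 \<Longrightarrow> \<bar>H z e - H z' e\<bar> \<le> K2 * norm (z - z')"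
      "\<And>z z' e. norm z \<le> r2 \<Longrightarrow> norm z' \<le> r2 \<Longrightarrow> \<bar>e\<bar> \<le> r2 \<Longrightarrow> \<bar>Lm z e - Lm z' e\<bar> \<le> K2 * norm (z - z')"
      "\<And>z z' e. norm z \<le> r2 \<Longrightarrow> norm z' \<le> r2 \<Longrightarrow> \<bar>e\<bar> \<le> r2 \<Longrightarrow> \<bar>W z e - W z' e\<bar> \<le> K2 * norm (z - z')"
    by (rule region) (rule that; assumption)
  define r where "r = min r1 r2"
  define K where "K = max 1 (max K1 K2)"
  have r: "r > 0" "r \<le> r1" "r \<le> r2" and K: "K \<ge> 1" "K1 \<le> K" "K2 \<le> K" using r1 r2 by (auto simp: r_def K_def)
  have lipK: "x \<le> K * n" if "x \<le> K2 * n" "0 \<le> n" for x n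
    using that mult_right_mono[OF K(3) that(2)] by linarith
  have "tracks r C K"
    unfolding tracks_def
  proof (intro conjI allI impI r(1) r1(2) K(1))
    fix e T t :: real and z1 z2 :: "real \<Rightarrow> real \<times> real"
    assume a: "\<bar>e\<bar> \<le> r \<and> dini_sol e T z1 \<and> dini_sol e T z2 \<and> (\<forall>s\<in>{0..T}. norm (z1 s) \<le> r / 2) \<and>
        K * exp (C * T) * norm (z1 0 - z2 0) < r / 2 \<and> t \<in> {0..T}"
    then have e: "\<bar>e\<bar> \<le> r1" and z1: "dini_sol e T z1" and z2: "dini_sol e T z2" and T: "0 \<le> T"
      and b1: "\<And>s. s \<in> {0..T} \<Longrightarrow> norm (z1 s) \<le> r / 2" and t: "t \<in> {0..T}"
      and small: "K * exp (C * T) * norm (z1 0 - z2 0) < r / 2"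
      using r by auto
    have up: "K1 * exp (C * s) * norm (z1 0 - z2 0) \<le> K * exp (C * T) * norm (z1 0 - z2 0)" if "s \<in> {0..T}" for s
      using that r1 K by (intro mult_right_mono mult_mono) (auto intro: mult_left_mono)
    have n0: "norm (z1 0 - z2 0) < r / 2"
    proof -
      have "1 * 1 \<le> K * exp (C * T)" using K(1) r1(2) T by (intro mult_mono) auto
      then have "norm (z1 0 - z2 0) \<le> K * exp (C * T) * norm (z1 0 - z2 0)"
        using mult_right_mono[of 1 "K * exp (C * T)" "norm (z1 0 - z2 0)"] by simp
      then show ?thesis using small by linarith
    qed
    have b2: "norm (z2 s) \<le> r" if s: "s \<in> {0..T}" for s
    \<comment> \<open>A continuation argument: up to the first time at which \<open>z2\<close>
      reaches norm \<open>r\<close> the dependence estimate is valid, and it puts \<open>z2\<close>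
      within \<open>r / 2\<close> of a point of norm at most \<open>r / 2\<close>.\<close>
    proof (rule ccontr)
      assume "\<not> norm (z2 s) \<le> r"
      then have pos: "norm (z2 s) - r > 0" by simp
      have "norm (z2 0) < r" using n0 b1[of 0] T norm_triangle_ineq2[of "z2 0" "z1 0"] by (simp add: norm_minus_commute)
      then have neg: "norm (z2 0) - r < 0" by simp
      have "continuous_on {0..T} z2" using z2 by (simp add: dini_sol_def)
      then have "continuous_on {0..s} (\<lambda>s. norm (z2 s) - r)"
        using s by (intro continuous_intros) (auto intro: continuous_on_subset)
      then obtain t0 where t0: "0 < t0" "t0 < s" "norm (z2 t0) - r = 0" "\<And>u. 0 \<le> u \<Longrightarrow> u < t0 \<Longrightarrow> norm (z2 u) - r < 0"
        using first_zero[of 0 s "\<lambda>s. norm (z2 s) - r"] neg pos s by auto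
      have "norm (z1 t0 - z2 t0) \<le> K1 * exp (C * t0) * norm (z1 0 - z2 0)"
      proof (rule dep[OF e dini_sol_mono[OF z1] dini_sol_mono[OF z2]])
        fix u assume u: "u \<in> {0..t0}"
        have "norm (z2 u) \<le> r" using t0(3) t0(4)[of u] u by (cases "u = t0") auto
        then show "norm (z1 u) \<le> r1 \<and> norm (z2 u) \<le> r1" using b1[of u] u t0 s r by auto
      qed (use t0 s in auto)
      also have "\<dots> \<le> K * exp (C * T) * norm (z1 0 - z2 0)" using t0 s by (intro up) auto
      finally have "norm (z1 t0 - z2 t0) < r / 2" using small by simp
      then show False using b1[of t0] t0 s norm_triangle_ineq2[of "z2 t0" "z1 t0"] by (simp add: norm_minus_commute)
    qed
    have "norm (z1 t - z2 t) \<le> K1 * exp (C * t) * norm (z1 0 - z2 0)"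
    proof (rule dep[OF e z1 z2 _ t])
      fix s assume s: "s \<in> {0..T}"
      show "norm (z1 s) \<le> r1 \<and> norm (z2 s) \<le> r1" using b1[OF s] b2[OF s] r by auto
    qed
    then show "norm (z1 t - z2 t) \<le> K * exp (C * T) * norm (z1 0 - z2 0)" using up[OF t] by linarith
  next
    fix z z' :: "real \<times> real" and e :: real assume "norm z \<le> r \<and> norm z' \<le> r \<and> \<bar>e\<bar> \<le> r"
    then have "norm z \<le> r2" "norm z' \<le> r2" "\<bar>e\<bar> \<le> r2" using r by auto
    note l = lip[OF this]
    show "\<bar>H z e - H z' e\<bar> \<le> K * norm (z - z')" "\<bar>Lm z e - Lm z' e\<bar> \<le> K * norm (z - z')" "\<bar>W z e - W z' e\<bar> \<le> K * norm (z - z')"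
      by (rule lipK[OF l(1) norm_ge_zero] lipK[OF l(2) norm_ge_zero] lipK[OF l(3) norm_ge_zero])+
  qed
  then show ?thesis by (rule that)
qed

lemma tracksD:
  assumes "tracks r C K"
  shows "r > 0" "C \<ge> 0" "K \<ge> 1"
    and "\<And>e T z1 z2 t. \<bar>e\<bar> \<le> r \<Longrightarrow> dini_sol e T z1 \<Longrightarrow> dini_sol e T z2 \<Longrightarrow> (\<And>s. s \<in> {0..T} \<Longrightarrow> norm (z1 s) \<le> r / 2) \<Longrightarrow>
        K * exp (C * T) * norm (z1 0 - z2 0) < r / 2 \<Longrightarrow> t \<in> {0..T} \<Longrightarrow>
        norm (z1 t - z2 t) \<le> K * exp (C * T) * norm (z1 0 - z2 0)"
    and "\<And>z z' e. norm z \<le> r \<Longrightarrow> norm z' \<le> r \<Longrightarrow> \<bar>e\<bar> \<le> r \<Longrightarrow> \<bar>H z e - H z' e\<bar> \<le> K * norm (z - z')"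
    and "\<And>z z' e. norm z \<le> r \<Longrightarrow> norm z' \<le> r \<Longrightarrow> \<bar>e\<bar> \<le> r \<Longrightarrow> \<bar>Lm z e - Lm z' e\<bar> \<le> K * norm (z - z')"
    and "\<And>z z' e. norm z \<le> r \<Longrightarrow> norm z' \<le> r \<Longrightarrow> \<bar>e\<bar> \<le> r \<Longrightarrow> \<bar>W z e - W z' e\<bar> \<le> K * norm (z - z')"
  using assms unfolding tracks_def by blast+

lemma dini_sol_unique:
  assumes tr: "tracks r C K" and e: "\<bar>e\<bar> \<le> r" and z: "dini_sol e T z1" "dini_sol e T z2"
    and b: "\<And>s. s \<in> {0..T} \<Longrightarrow> norm (z1 s) \<le> r / 2" and eq: "z1 0 = z2 0" and t: "t \<in> {0..T}"
  shows "z1 t = z2 t"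
  using tracksD(4)[OF tr e z b _ t] eq tracksD(1)[OF tr] by simp

text \<open>From either side \<open>H\<close> is driven towards zero with speed at least
  \<open>\<mu>\<close>: below the curve by the lower field, above it by the upper field. A distance
  less than \<open>\<mu> * \<theta>\<close> is used up within time \<open>\<theta>\<close>.\<close>

lemma reach_switching:
  assumes z: "dini_sol e \<theta> z" and \<theta>: "\<theta> > 0" and \<mu>: "\<mu> > 0"
    and L: "\<And>h. h \<in> {0..\<theta>} \<Longrightarrow> Lm (z h) e \<ge> \<mu> \<and> Lm (z h) e + W (z h) e \<le> - \<mu>"
    and H0: "\<bar>H (z 0) e\<bar> < \<mu> * \<theta>"
  shows "\<exists>h\<in>{0..\<theta>}. H (z h) e = 0"
proof (rule ccontr)
  assume no: "\<not> ?thesis"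
  have cz: "continuous_on {0..\<theta>} z" using z by (simp add: dini_sol_def)
  have cH: "continuous_on {0..\<theta>} (\<lambda>h. H (z h) e)" by (rule continuous_on_compose2[OF H_cont[of UNIV] cz]) auto
  define \<sigma> where "\<sigma> = sgn (H (z 0) e)"
  have H00: "H (z 0) e \<noteq> 0" using no \<theta> by auto
  then have \<sigma>: "\<sigma> = 1 \<or> \<sigma> = - 1" "\<sigma> * H (z 0) e = \<bar>H (z 0) e\<bar>" by (auto simp: \<sigma>_def sgn_if)
  have pos: "\<sigma> * H (z h) e > 0" if h: "h \<in> {0..\<theta>}" for h
  proof (rule ccontr)
    assume "\<not> \<sigma> * H (z h) e > 0"
    moreover have "continuous_on {0..h} (\<lambda>h. \<sigma> * H (z h) e)"
      using cH h by (intro continuous_intros) (auto intro: continuous_on_subset)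
    ultimately obtain u where "0 \<le> u" "u \<le> h" "\<sigma> * H (z u) e = 0"
      using IVT2'[of "\<lambda>h. \<sigma> * H (z h) e" h 0 0] \<sigma>(2) h by auto
    then show False using no \<sigma>(1) h by auto
  qed
  \<comment> \<open>As long as \<open>H\<close> has no zero, \<open>\<sigma> * H\<close> is its
    modulus, so \<open>f\<close> does not increase; this is Gronwall's inequality with all constants
    zero.\<close>
  define f where "f h = \<sigma> * H (z h) e + \<mu> * h" for h
  have "f \<theta> \<le> (f 0 + 0 * \<theta>) * exp (0 * \<theta>)"
  proof (rule dini_gronwall[where T = \<theta>])
    show "continuous_on {0..\<theta>} f" unfolding f_def by (intro continuous_intros cH)
    show "f 0 \<ge> 0" using \<sigma>(2) by (simp add: f_def)
    fix t \<eta> :: real assume t: "0 \<le> t" "t < \<theta>" and \<eta>: "\<eta> > 0"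
    define Q where "Q = norm (Fm (z t)) + norm (V (z t)) + 1 + norm (DH (z t, e))"
    have Q: "Q \<ge> 1" by (simp add: Q_def)
    define \<eta>' where "\<eta>' = min 1 (\<eta> / Q)"
    have \<eta>': "\<eta>' > 0" "\<eta>' \<le> 1" "\<eta>' * Q \<le> \<eta>" using \<eta> Q by (auto simp: \<eta>'_def min_def field_simps)
    obtain h0 where h0: "h0 > 0" "\<And>h. 0 < h \<Longrightarrow> h < h0 \<Longrightarrow> \<exists>\<kappa>. filippov_step e z t \<eta>' h \<kappa> \<and>
         \<bar>H (z (t + h)) e - H (z t) e - h * (Lm (z t) e + \<kappa> * W (z t) e)\<bar> \<le> \<eta>' * h * Q"
      unfolding Q_def using dini_sol_H_step[OF z t \<eta>'(1,2)] by blast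
    show "\<exists>h0>0. \<forall>h. 0 < h \<and> h < h0 \<longrightarrow> f (t + h) \<le> f t + h * (0 * f t + 0 + \<eta>)"
    proof (intro exI[of _ h0] conjI allI impI h0(1))
      fix h assume h: "0 < h \<and> h < h0"
      obtain \<kappa> where \<kappa>: "H (z t) e < 0 \<longrightarrow> \<kappa> = 0" "H (z t) e > 0 \<longrightarrow> \<kappa> = 1"
        "\<bar>H (z (t + h)) e - H (z t) e - h * (Lm (z t) e + \<kappa> * W (z t) e)\<bar> \<le> \<eta>' * h * Q"
        using h0(2)[of h] h unfolding filippov_step_def by blast
      have "\<eta>' * h * Q = h * (\<eta>' * Q)" by simp
      also have "\<dots> \<le> h * \<eta>" using \<eta>' h by (intro mult_left_mono) auto
      finally have err: "\<bar>H (z (t + h)) e - H (z t) e - h * (Lm (z t) e + \<kappa> * W (z t) e)\<bar> \<le> h * \<eta>" using \<kappa>(3) by linarith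
      have Lt: "Lm (z t) e \<ge> \<mu>" "Lm (z t) e + W (z t) e \<le> - \<mu>" using L[of t] t by auto
      have "\<sigma> * (Lm (z t) e + \<kappa> * W (z t) e) \<le> - \<mu>"
        using \<sigma>(1) pos[of t] t \<kappa>(1,2) Lt by auto
      then have "h * (\<sigma> * (Lm (z t) e + \<kappa> * W (z t) e)) \<le> h * (- \<mu>)" using h by (intro mult_left_mono) auto
      moreover have "\<sigma> * H (z (t + h)) e - \<sigma> * H (z t) e - h * (\<sigma> * (Lm (z t) e + \<kappa> * W (z t) e)) \<le> h * \<eta>"
        using \<sigma>(1) err by (elim disjE) (simp_all add: abs_le_iff algebra_simps)
      ultimately show "f (t + h) \<le> f t + h * (0 * f t + 0 + \<eta>)" by (simp add: f_def algebra_simps)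
    qed
  qed (use \<theta> in auto)
  then have "\<sigma> * H (z \<theta>) e + \<mu> * \<theta> \<le> \<bar>H (z 0) e\<bar>" using \<sigma>(2) by (simp add: f_def)
  then show False using H0 pos[of \<theta>] \<theta> by simp
qed

text \<open>By assumption \<open>d\<close>, all switching points near the landing point slide into
  the same point \<open>A\<close>. This collapse of an arc to a point makes the convergence finite,
  where a Lipschitz estimate alone would only keep solutions close.\<close>

lemma cycle_stable:
  assumes tr: "tracks r C K" and cl: "close R \<eta> e" and er: "e \<le> r" "R * e \<le> r / 2"
    and x: "slip_arc R e A T1 x" and s: "slide_arc R e (x T1) Ts s" and ret: "s Ts = A"
    and d: "d > 0" "\<And>y. H y e = 0 \<Longrightarrow> norm (y - x T1) \<le> d \<Longrightarrow> \<exists>T s. slide_arc R e y T s \<and> s T = A"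
  shows "finite_time_stable fp gp fm gm H e (cyc T1 (T1 + Ts) x s)"
proof -
  define p where "p = T1 + Ts"
  define \<gamma> where "\<gamma> = cyc T1 p x s"
  note cf = cyc_filippov[OF cl x s ret, folded p_def, folded \<gamma>_def]
  have T: "T1 > 0" "Ts > 0" using x s by (auto simp: slip_arc_def slide_arc_def)
  then have p: "p > 0" "T1 < p" by (auto simp: p_def)
  note r = tracksD(1)[OF tr] and C = tracksD(2)[OF tr] and K = tracksD(3)[OF tr]
  have e: "0 < e" "\<bar>e\<bar> \<le> r" using closeD(1)[OF cl] er by auto
  have \<gamma>r: "norm (\<gamma> t) \<le> r / 2" for t using cf(2)[of t] er by linarith
  define B where "B = x T1"
  have \<gamma>T1: "\<gamma> T1 = B" using cf(4)[of T1] T by (simp add: B_def)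
  have \<gamma>0: "\<gamma> 0 = A" using cf(4)[of 0] T x by (simp add: slip_arc_def)
  have Bn: "norm B \<le> R * e" and HB: "H B e = 0" using x by (auto simp: slip_arc_def B_def)
  have LB: "Lm B e > 0" using s by (auto simp: slide_arc_def B_def)
  have LWB: "Lm B e + W B e < 0" by (rule closeD(11)[OF cl Bn])
  \<comment> \<open>Half of the speeds at the landing point; the other half is the room for their
    variation within distance \<open>d1\<close>.\<close>
  define \<mu> where "\<mu> = min (Lm B e) (- (Lm B e + W B e)) / 2"
  have \<mu>: "\<mu> > 0" "2 * \<mu> \<le> Lm B e" "2 * \<mu> \<le> - (Lm B e + W B e)" using LB LWB by (auto simp: \<mu>_def)
  define d1 where "d1 = Min {d, r / 2, \<mu> / (2 * K)}"
  have d1: "d1 > 0" using d r \<mu> K by (simp add: d1_def)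
  have d1': "d1 \<le> d" "d1 \<le> r / 2" "d1 \<le> \<mu> / (2 * K)" unfolding d1_def by (rule Min_le, simp, simp)+
  have nearB: "Lm y e \<ge> \<mu> \<and> Lm y e + W y e \<le> - \<mu>" if y: "norm (y - B) \<le> d1" for y
  proof -
    have yB: "norm y \<le> r" "norm B \<le> r"
      using y d1' Bn er r norm_triangle_ineq[of "y - B" B] by auto
    have "K * norm (y - B) \<le> K * (\<mu> / (2 * K))" using y d1' K by (intro mult_left_mono) auto
    then have "K * norm (y - B) \<le> \<mu> / 2" using K by simp
    then have "\<bar>Lm y e - Lm B e\<bar> \<le> \<mu> / 2" "\<bar>W y e - W B e\<bar> \<le> \<mu> / 2"
      using tracksD(6,7)[OF tr yB e(2)] by linarith+
    then show ?thesis using \<mu> by (intro conjI) linarith+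
  qed
  have c\<gamma>: "continuous_on {0..} \<gamma>" by (rule filippov_sol_continuous[OF cf(1)])
  have "continuous (at T1 within {0..}) \<gamma>" using c\<gamma> T by (simp add: continuous_on_eq_continuous_within)
  then obtain h1 where h1: "h1 > 0" "\<And>t. t \<in> {0..} \<Longrightarrow> \<bar>t - T1\<bar> < h1 \<Longrightarrow> norm (\<gamma> t - B) < d1 / 2"
    using d1 unfolding continuous_within_eps_delta dist_norm \<gamma>T1 by (metis half_gt_zero real_norm_def)
  define \<theta> where "\<theta> = min 1 (h1 / 2)"
  have \<theta>: "\<theta> > 0" "\<theta> < h1" "\<theta> \<le> 1" using h1 by (auto simp: \<theta>_def)
  define T where "T = 2 * p + 1"
  define k where "k = K * exp (C * T)"
  have k: "k > 0" using K by (simp add: k_def)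
  \<comment> \<open>\<open>k\<close> is the largest amplification of the initial distance up to time
    \<open>T\<close>. The three entries place the solution within \<open>d1 / 2\<close> of the
    cycle, meet the smallness condition of \<open>tracks\<close>, and make \<open>H\<close> at the
    passage of the landing point small enough for \<open>reach_switching\<close>.\<close>
  define \<delta> where "\<delta> = Min {d1 / (2 * k), r / (4 * k), \<mu> * \<theta> / (2 * K * k)}"
  have \<delta>: "\<delta> > 0" using d1 k r \<mu> \<theta> K by (simp add: \<delta>_def)
  have "\<delta> \<le> d1 / (2 * k)" "\<delta> \<le> r / (4 * k)" "\<delta> \<le> \<mu> * \<theta> / (2 * K * k)" unfolding \<delta>_def by (rule Min_le, simp, simp)+
  then have \<delta>': "k * \<delta> \<le> d1 / 2" "k * \<delta> \<le> r / 4" "K * (k * \<delta>) \<le> \<mu> * \<theta> / 2"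
    using k K by (simp_all add: field_simps)
  show ?thesis
    unfolding finite_time_stable_def p_def[symmetric] \<gamma>_def[symmetric]
  proof (rule exI[of _ \<delta>], rule conjI[OF \<delta>], intro allI impI)
    fix z assume a: "filippov_sol fp gp fm gm H e z \<and> infdist (z 0) (orbit \<gamma>) < \<delta>"
    then have z: "filippov_sol fp gp fm gm H e z" by simp
    have "orbit \<gamma> \<noteq> {}" by (auto simp: orbit_def)
    then obtain u where u: "u \<ge> 0" "dist (z 0) (\<gamma> u) < \<delta>"
      using a unfolding infdist_notempty[OF \<open>orbit \<gamma> \<noteq> {}\<close>]
      by (subst (asm) cInf_less_iff) (auto simp: orbit_def)
    define s0 where "s0 = frac_part p u"
    have s0: "0 \<le> s0" "s0 < p" using frac_part_range[OF p(1), of u] by (auto simp: s0_def)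
    have "\<gamma> u = \<gamma> s0"
      unfolding \<gamma>_def cyc_def s0_def using frac_part_eq[OF p(1), of "frac_part p u" 0] frac_part_range[OF p(1), of u] by simp
    then have near0: "norm (\<gamma> (s0 + 0) - z (0 + 0)) < \<delta>" using u by (simp add: dist_norm norm_minus_commute)
    then have kn: "k * norm (\<gamma> (s0 + 0) - z (0 + 0)) \<le> k * \<delta>" using k by (intro mult_left_mono) auto
    have track: "norm (\<gamma> (s0 + t) - z (0 + t)) \<le> k * \<delta>" if "t \<in> {0..T}" for t
    proof -
      have "norm (\<gamma> (s0 + t) - z (0 + t)) \<le> K * exp (C * T) * norm (\<gamma> (s0 + 0) - z (0 + 0))"
        by (rule tracksD(4)[OF tr e(2) dini_sol_filippov[OF cf(1) s0(1)] dini_sol_filippov[OF z order_refl] \<gamma>r _ that])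
           (use kn \<delta>' r in \<open>simp add: k_def\<close>)
      then show ?thesis using kn by (simp add: k_def)
    qed
    \<comment> \<open>The landing point of the following period: this time is positive whatever the
      phase \<open>s0 < p\<close> is, and together with \<open>\<theta>\<close> it stays below
      \<open>T = 2 * p + 1\<close>.\<close>
    define ts where "ts = p + T1 - s0"
    have ts: "0 \<le> ts" "ts + \<theta> \<le> T" "s0 + ts = T1 + p" using s0 T p \<theta> by (auto simp: ts_def T_def)
    have zB: "norm (z (ts + h) - B) \<le> d1" if h: "h \<in> {0..\<theta>}" for h
    proof -
      have "\<gamma> (s0 + (ts + h)) = \<gamma> ((T1 + h) + p)" using ts(3) by (simp add: algebra_simps)
      then have "\<gamma> (s0 + (ts + h)) = \<gamma> (T1 + h)" using cf(6)[of "T1 + h"] by simp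
      moreover have "norm (\<gamma> (T1 + h) - B) < d1 / 2" using h1(2)[of "T1 + h"] h \<theta> T by auto
      moreover have "norm (\<gamma> (s0 + (ts + h)) - z (0 + (ts + h))) \<le> d1 / 2"
        using track[of "ts + h"] ts h \<delta>' by auto
      ultimately show ?thesis
        using norm_triangle_ineq4[of "\<gamma> (T1 + h) - B" "\<gamma> (T1 + h) - z (ts + h)"] by simp
    qed
    have Hts: "\<bar>H (z (ts + 0)) e\<bar> < \<mu> * \<theta>"
    proof -
      have "\<gamma> (s0 + ts) = B" using ts(3) cf(6)[of T1] \<gamma>T1 by simp
      then have n: "norm (z ts - B) \<le> k * \<delta>" using track[of ts] ts \<theta> by (simp add: norm_minus_commute)
      have zr: "norm (z ts) \<le> r" "norm B \<le> r"
        using zB[of 0] \<theta> d1' Bn er r norm_triangle_ineq[of "z ts - B" B] by auto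
      have "\<bar>H (z ts) e\<bar> \<le> K * norm (z ts - B)" using tracksD(5)[OF tr zr e(2)] HB by simp
      also have "\<dots> \<le> K * (k * \<delta>)" using n K by (intro mult_left_mono) auto
      also have "\<dots> \<le> \<mu> * \<theta> / 2" by (rule \<delta>')
      also have "\<dots> < \<mu> * \<theta>" using \<mu> \<theta> by simp
      finally show ?thesis by simp
    qed
    obtain h where h: "h \<in> {0..\<theta>}" "H (z (ts + h)) e = 0"
      using reach_switching[OF dini_sol_filippov[OF z ts(1)] \<theta>(1) \<mu>(1) _ Hts] nearB zB by blast
    define t2 where "t2 = ts + h"
    have t2: "t2 \<ge> 0" using ts h by (simp add: t2_def)
    obtain Tq q where q: "slide_arc R e (z t2) Tq q" "q Tq = A"
      using d(2)[of "z t2"] h zB[OF h(1)] d1' by (force simp: t2_def B_def)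
    have qT: "Tq > 0" "q 0 = z (t2 + 0)" using q by (auto simp: slide_arc_def)
    \<comment> \<open>The slide arc is one solution starting at \<open>z t2\<close>; forward
      uniqueness makes it the only one, so \<open>z\<close> cannot leave the switching curve before
      the fold.\<close>
    have "q Tq = z (t2 + Tq)"
    proof (rule dini_sol_unique[OF tr e(2) slide_arc_dini[OF cl q(1)] dini_sol_filippov[OF z t2] _ qT(2)])
      fix t assume "t \<in> {0..Tq}"
      then have "norm (q t) \<le> R * e" using q(1) by (auto simp: slide_arc_def)
      then show "norm (q t) \<le> r / 2" using er by linarith
    qed (use qT in auto)
    then have zA: "z (t2 + Tq) = A" using q by simp
    define t3 where "t3 = t2 + Tq"
    have t3: "t3 \<ge> 0" using t2 qT by (simp add: t3_def)
    have eq: "z (t3 + t) = \<gamma> (0 + t)" if t: "t \<ge> 0" for t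
      by (rule dini_sol_unique[OF tr e(2) dini_sol_filippov[OF cf(1) order_refl] dini_sol_filippov[OF z t3] \<gamma>r, symmetric, where T = t])
        (use zA \<gamma>0 t in \<open>auto simp: t3_def\<close>)
    \<comment> \<open>Enough whole periods are added to make the time shift
      \<open>real n * p - t3\<close> nonnegative.\<close>
    define n where "n = nat \<lceil>t3 / p\<rceil>"
    have n: "t3 \<le> real n * p"
    proof -
      have "t3 / p \<le> real n" unfolding n_def by linarith
      then show ?thesis using p by (simp add: pos_divide_le_eq)
    qed
    show "\<exists>t0\<ge>0. \<exists>s\<ge>0. \<forall>t\<ge>t0. z t = \<gamma> (t + s)"
    proof (rule exI[of _ t3], rule conjI[OF t3], rule exI[of _ "real n * p - t3"], intro conjI allI impI)
      fix t assume t: "t3 \<le> t"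
      have "z t = \<gamma> (t - t3)" using eq[of "t - t3"] t by simp
      also have "\<dots> = \<gamma> ((t - t3) + real n * p)" using periodic_shift[of \<gamma> p "t - t3" n] cf(6) p t by simp
      finally show "z t = \<gamma> (t + (real n * p - t3))" by (simp add: algebra_simps)
    qed (use n in simp)
  qed
qed

end

text \<open>A periodic orbit close to the cycle coincides with it after finite time, and by
  periodicity each of its points is also visited after that time; the same holds for the points of
  the cycle.\<close>

lemma limit_cycle_if_stable:
  assumes per: "periodic_sol fp gp fm gm H e \<gamma>" and fts: "finite_time_stable fp gp fm gm H e \<gamma>"
  shows "limit_cycle fp gp fm gm H e \<gamma>"
proof -
  obtain \<delta> where \<delta>: "\<delta> > 0" "\<And>z. filippov_sol fp gp fm gm H e z \<Longrightarrow> infdist (z 0) (orbit \<gamma>) < \<delta> \<Longrightarrow>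
        \<exists>t0\<ge>0. \<exists>s\<ge>0. \<forall>t\<ge>t0. z t = \<gamma> (t + s)"
    using fts unfolding finite_time_stable_def by blast
  obtain p where p: "p > 0" "\<And>t. t \<ge> 0 \<Longrightarrow> \<gamma> (t + p) = \<gamma> t" using per unfolding periodic_sol_def by blast
  have "orbit \<zeta> = orbit \<gamma>" if \<zeta>: "periodic_sol fp gp fm gm H e \<zeta>" and sub: "orbit \<zeta> \<subseteq> {q. infdist q (orbit \<gamma>) < \<delta>}" for \<zeta>
  proof -
    have "\<zeta> 0 \<in> orbit \<zeta>" by (auto simp: orbit_def)
    then obtain t0 s where ts: "t0 \<ge> 0" "s \<ge> 0" "\<And>t. t \<ge> t0 \<Longrightarrow> \<zeta> t = \<gamma> (t + s)"
      using \<delta>(2)[of \<zeta>] \<zeta> sub unfolding periodic_sol_def by blast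
    obtain q where q: "q > 0" "\<And>t. t \<ge> 0 \<Longrightarrow> \<zeta> (t + q) = \<zeta> t" using \<zeta> unfolding periodic_sol_def by blast
    obtain n where n: "t0 < real n * q" using reals_Archimedean3[OF q(1)] by blast
    obtain m where m: "t0 + s < real m * p" using reals_Archimedean3[OF p(1)] by blast
    show ?thesis
    proof
      show "orbit \<zeta> \<subseteq> orbit \<gamma>"
        unfolding orbit_def
      proof (rule image_subsetI)
        fix t :: real assume t: "t \<in> {0..}"
        have "\<zeta> t = \<zeta> (t + real n * q)" using periodic_shift[of \<zeta> q t n] q t by simp
        also have "\<dots> = \<gamma> (t + real n * q + s)" using ts(3) n t by simp
        finally show "\<zeta> t \<in> \<gamma> ` {0..}" using ts n t by (intro image_eqI[where x = "t + real n * q + s"]) auto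
      qed
      show "orbit \<gamma> \<subseteq> orbit \<zeta>"
        unfolding orbit_def
      proof (rule image_subsetI)
        fix t :: real assume t: "t \<in> {0..}"
        have "\<gamma> t = \<gamma> (t + real m * p)" using periodic_shift[of \<gamma> p t m] p t by simp
        also have "\<dots> = \<zeta> (t + real m * p - s)" using ts(3)[of "t + real m * p - s"] m t by simp
        finally show "\<gamma> t \<in> \<zeta> ` {0..}" using ts m t by (intro image_eqI[where x = "t + real m * p - s"]) auto
      qed
    qed
  qed
  then show ?thesis using per \<delta>(1) unfolding limit_cycle_def by blast
qed

lemma (in filippov_fold) close_mono:
  assumes cl: "close R \<eta> e" and le: "\<eta> \<le> \<eta>'"
  shows "close R \<eta>' e"
proof -
  note e = closeD(1)[OF cl]
  have up: "x \<le> \<eta>' * n" if "x \<le> \<eta> * n" "n \<ge> 0" for x n using that mult_right_mono[OF le that(2)] by linarith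
  show ?thesis
    unfolding close_def
  proof (intro conjI allI impI e)
    fix z z' :: "real \<times> real" assume "norm z \<le> R * e \<and> norm z' \<le> R * e"
    then have z: "norm z \<le> R * e" "norm z' \<le> R * e" by auto
    show "norm (Fm z - Fm z' - J (z - z')) \<le> \<eta>' * norm (z - z')" by (rule up[OF closeD(2)[OF cl z] norm_ge_zero])
    show "norm (Fm z - J z) \<le> \<eta>' * e" by (rule up[OF closeD(3)[OF cl z(1)] less_imp_le[OF e]])
    show "\<bar>H z e - H z' e - b * snd (z - z')\<bar> \<le> \<eta>' * norm (z - z')" by (rule up[OF closeD(4)[OF cl z] norm_ge_zero])
    show "\<bar>H z e - (b * snd z + c * e)\<bar> \<le> \<eta>' * e" by (rule up[OF closeD(5)[OF cl z(1)] less_imp_le[OF e]])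
    show "\<bar>Lm z e - Lm z' e - ell (z - z')\<bar> \<le> \<eta>' * norm (z - z')" by (rule up[OF closeD(6)[OF cl z] norm_ge_zero])
    show "\<bar>Lm z e - ell z\<bar> \<le> \<eta>' * e" by (rule up[OF closeD(7)[OF cl z(1)] less_imp_le[OF e]])
    show "norm (S z e - S z' e - Sig (z - z')) \<le> \<eta>' * norm (z - z')" by (rule up[OF closeD(8)[OF cl z] norm_ge_zero])
    show "norm (S z e - Sig z) \<le> \<eta>' * e" by (rule up[OF closeD(9)[OF cl z(1)] less_imp_le[OF e]])
    show "W z e < 0" "Lm z e + W z e < 0" by (rule closeD(10)[OF cl z(1)], rule closeD(11)[OF cl z(1)])
  qed
qed

context fold_cycle
begin

text \<open>The perturbed fold is not located by an implicit function argument. A first slide from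
  any switching point near the expected landing point ends in a fold \<open>A\<close>; the slip
  starts there, and by uniqueness of the fold the slide after landing ends in \<open>A\<close>
  again.\<close>

lemma cycle_exists:
  obtains e0 \<gamma> where "e0 > 0"
    "\<And>e. 0 < e \<Longrightarrow> e < e0 \<Longrightarrow> stick_slip_cycle fp gp fm gm H e (\<gamma> e) \<and> limit_cycle fp gp fm gm H e (\<gamma> e) \<and>
        finite_time_stable fp gp fm gm H e (\<gamma> e)"
    "\<And>e t. 0 < e \<Longrightarrow> e < e0 \<Longrightarrow> norm (\<gamma> e t) \<le> R * e"
proof -
  obtain r C K where tr: "tracks r C K" by (rule tracks_exist)
  note r = tracksD(1)[OF tr]
  obtain \<tau> \<eta>1 where \<tau>: "\<tau> > 0" "\<eta>1 > 0"
    and slide': "\<And>e z1. close R \<eta>1 e \<Longrightarrow> H z1 e = 0 \<Longrightarrow> norm (z1 - e *\<^sub>R \<psi> T0) \<le> \<tau> * e \<Longrightarrow>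
       \<exists>T s. slide_arc R e z1 T s"
    by (rule slide) (rule that; blast)
  obtain \<eta>2 where \<eta>2: "\<eta>2 > 0"
    and uniq: "\<And>e z z'. close R \<eta>2 e \<Longrightarrow> norm z \<le> R * e \<Longrightarrow> norm z' \<le> R * e \<Longrightarrow>
       H z e = 0 \<Longrightarrow> Lm z e = 0 \<Longrightarrow> H z' e = 0 \<Longrightarrow> Lm z' e = 0 \<Longrightarrow> z = z'"
    by (rule fold_unique) (rule that; blast)
  obtain \<eta>3 where \<eta>3: "\<eta>3 > 0"
    and start: "\<And>e. close R \<eta>3 e \<Longrightarrow> \<exists>z. H z e = 0 \<and> norm (z - e *\<^sub>R \<psi> T0) \<le> min \<tau> 1 * e"
    using switching_point[of "min \<tau> 1"] \<tau> by auto
  \<comment> \<open>Requiring the slip to land within half of the admissible distance leaves a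
    neighbourhood of the actual landing point from which slides are available; stability needs
    it.\<close>
  have "\<tau> / 2 > 0" using \<tau> by simp
  then obtain \<eta>4 where \<eta>4: "\<eta>4 > 0"
    and slip': "\<And>e z. close R \<eta>4 e \<Longrightarrow> norm z \<le> R * e \<Longrightarrow> H z e = 0 \<Longrightarrow> Lm z e = 0 \<Longrightarrow>
       \<exists>T x. slip_arc R e z T x \<and> norm (x T - e *\<^sub>R \<psi> T0) \<le> \<tau> / 2 * e"
    by (rule slip) (rule that; blast)
  define \<eta> where "\<eta> = min (min \<eta>1 \<eta>2) (min \<eta>3 \<eta>4)"
  have \<eta>: "\<eta> > 0" "\<eta> \<le> \<eta>1" "\<eta> \<le> \<eta>2" "\<eta> \<le> \<eta>3" "\<eta> \<le> \<eta>4" using \<tau> \<eta>2 \<eta>3 \<eta>4 by (auto simp: \<eta>_def)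
  have R0: "R > 0" using R1 by simp
  obtain e1 where e1: "e1 > 0" "\<And>e. 0 < e \<Longrightarrow> e < e1 \<Longrightarrow> close R \<eta> e" using close_small[OF \<eta>(1), of R] R0 by auto
  define e0 where "e0 = min e1 (min r (r / (2 * R)))"
  have e0: "e0 > 0" "e0 \<le> e1" "e0 \<le> r" "e0 \<le> r / (2 * R)" using e1 r R0 by (auto simp: e0_def)
  have ex: "\<exists>\<gamma>. stick_slip_cycle fp gp fm gm H e \<gamma> \<and> limit_cycle fp gp fm gm H e \<gamma> \<and>
        finite_time_stable fp gp fm gm H e \<gamma> \<and> (\<forall>t. norm (\<gamma> t) \<le> R * e)" if e: "0 < e" "e < e0" for e
  proof -
    have cl: "close R \<eta> e" using e1 e e0 by simp
    note cl' = close_mono[OF cl]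
    have er: "e \<le> r" "R * e \<le> r / 2"
    proof -
      show "e \<le> r" using e e0 by simp
      have "R * e \<le> R * (r / (2 * R))" using e e0 R0 by (intro mult_left_mono) auto
      then show "R * e \<le> r / 2" using R0 by simp
    qed
    have sl: "\<exists>T s. slide_arc R e z1 T s" if "H z1 e = 0" "norm (z1 - e *\<^sub>R \<psi> T0) \<le> \<tau> * e" for z1
      by (rule slide'[OF cl'[OF \<eta>(2)] that])
    have fold_end: "norm (s T) \<le> R * e" "H (s T) e = 0" "Lm (s T) e = 0" if "slide_arc R e z1 T s" for z1 T s
      using that by (auto simp: slide_arc_def)
    obtain z1 where z1: "H z1 e = 0" "norm (z1 - e *\<^sub>R \<psi> T0) \<le> min \<tau> 1 * e" using start[OF cl'[OF \<eta>(4)]] by blast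
    have "min \<tau> 1 * e \<le> \<tau> * e" using e by (intro mult_right_mono) auto
    then obtain Ta sa where sa: "slide_arc R e z1 Ta sa" using sl[OF z1(1)] z1(2) by fastforce
    define A where "A = sa Ta"
    note A = fold_end[OF sa, folded A_def]
    have sl_A: "\<exists>T s. slide_arc R e y T s \<and> s T = A" if y: "H y e = 0" "norm (y - e *\<^sub>R \<psi> T0) \<le> \<tau> * e" for y
    proof -
      obtain T s where s: "slide_arc R e y T s" using sl[OF y] by blast
      have "s T = A" by (rule uniq[OF cl'[OF \<eta>(3)] fold_end(1)[OF s] A(1) fold_end(2,3)[OF s] A(2,3)])
      then show ?thesis using s by blast
    qed
    obtain T1 x where x: "slip_arc R e A T1 x" and xT: "norm (x T1 - e *\<^sub>R \<psi> T0) \<le> \<tau> / 2 * e"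
      using slip'[OF cl'[OF \<eta>(5)] A] by blast
    have te: "\<tau> * e > 0" using \<tau> e by simp
    have HB: "H (x T1) e = 0" using x by (simp add: slip_arc_def)
    have "norm (x T1 - e *\<^sub>R \<psi> T0) \<le> \<tau> * e" using xT te by simp
    then obtain Ts s where s: "slide_arc R e (x T1) Ts s" "s Ts = A" using sl_A[OF HB] by blast
    define p where "p = T1 + Ts"
    define \<gamma> where "\<gamma> = cyc T1 p x s"
    note cf = cyc_filippov[OF cl x s, folded p_def, folded \<gamma>_def]
    have T: "T1 > 0" "Ts > 0" using x s by (auto simp: slip_arc_def slide_arc_def)
    have d: "\<exists>T s. slide_arc R e y T s \<and> s T = A" if y: "H y e = 0" "norm (y - x T1) \<le> \<tau> / 2 * e" for y
    proof (rule sl_A[OF y(1)])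
      have "norm (y - e *\<^sub>R \<psi> T0) \<le> norm (y - x T1) + norm (x T1 - e *\<^sub>R \<psi> T0)"
        using norm_triangle_ineq[of "y - x T1" "x T1 - e *\<^sub>R \<psi> T0"] by simp
      then show "norm (y - e *\<^sub>R \<psi> T0) \<le> \<tau> * e" using y(2) xT by simp
    qed
    have "\<tau> / 2 * e > 0" using te by simp
    then have fts: "finite_time_stable fp gp fm gm H e \<gamma>"
      unfolding \<gamma>_def p_def by (rule cycle_stable[OF tr cl er x s _ d])
    have per: "periodic_sol fp gp fm gm H e \<gamma>"
      unfolding periodic_sol_def
    proof (intro conjI)
      show "filippov_sol fp gp fm gm H e \<gamma>" by (rule cf(1))
      show "\<exists>p>0. \<forall>t\<ge>0. \<gamma> (t + p) = \<gamma> t" using cf(6) T by (intro exI[of _ p]) (auto simp: p_def)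
      have "\<gamma> 0 = A" "\<gamma> (T1 / 2) = x (T1 / 2)" using cf(4)[of 0] cf(4)[of "T1 / 2"] T x by (auto simp: slip_arc_def)
      moreover have "H (x (T1 / 2)) e < 0" using x T by (simp add: slip_arc_def)
      ultimately have "\<gamma> (T1 / 2) \<noteq> \<gamma> 0" using A(2) by auto
      then show "\<exists>t\<ge>0. \<gamma> t \<noteq> \<gamma> 0" using T by (intro exI[of _ "T1 / 2"]) auto
    qed
    have "\<forall>t\<in>{T1..T1 + Ts / 2}. H (\<gamma> t) e = 0"
    proof
      fix t assume t: "t \<in> {T1..T1 + Ts / 2}"
      then have "\<gamma> t = s (t - T1)" using T by (intro cf(5)) (auto simp: p_def)
      then show "H (\<gamma> t) e = 0" using s t T by (auto simp: slide_arc_def)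
    qed
    then have "stick_slip_cycle fp gp fm gm H e \<gamma>"
      unfolding stick_slip_cycle_def using per T by (intro conjI exI[of _ T1] exI[of _ "T1 + Ts / 2"]) auto
    then show ?thesis using limit_cycle_if_stable[OF per fts] fts cf(2) by blast
  qed
  then have "\<forall>e\<in>{0<..<e0}. \<exists>\<gamma>. stick_slip_cycle fp gp fm gm H e \<gamma> \<and> limit_cycle fp gp fm gm H e \<gamma> \<and>
        finite_time_stable fp gp fm gm H e \<gamma> \<and> (\<forall>t. norm (\<gamma> t) \<le> R * e)" by simp
  from bchoice[OF this] obtain \<gamma> where \<gamma>: "\<forall>e\<in>{0<..<e0}. stick_slip_cycle fp gp fm gm H e (\<gamma> e) \<and> limit_cycle fp gp fm gm H e (\<gamma> e) \<and>
        finite_time_stable fp gp fm gm H e (\<gamma> e) \<and> (\<forall>t. norm (\<gamma> e t) \<le> R * e)" by blast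
  show ?thesis
    by (rule that[OF e0(1), of \<gamma>]) (use \<gamma> in simp_all)
qed

end

section \<open>The hypotheses of the theorem\<close>

lemma partial_derivatives:
  fixes F :: "real \<times> real \<Rightarrow> real"
  assumes F: "(F has_derivative blinfun_apply D) (at 0)"
  shows "blinfun_apply D z = px F * fst z + py F * snd z"
proof -
  have F': "(F has_derivative blinfun_apply D) (at (0, 0))" using F by (simp add: zero_prod_def)
  have "((\<lambda>x. F (x, 0)) has_derivative (\<lambda>h. blinfun_apply D (h, 0))) (at 0)"
    by (rule has_derivative_compose[OF has_derivative_Pair[OF has_derivative_ident has_derivative_const] F'])
  moreover have "(\<lambda>h. blinfun_apply D (h, 0)) = (*) (blinfun_apply D (1, 0))"
  proof
    fix h :: real
    have "(h, 0) = h *\<^sub>R ((1, 0) :: real \<times> real)" by simp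
    then show "blinfun_apply D (h, 0) = blinfun_apply D (1, 0) * h"
      by (simp only: blinfun.scaleR_right real_scaleR_def mult.commute)
  qed
  ultimately have x: "px F = blinfun_apply D (1, 0)"
    unfolding px_def by (intro DERIV_imp_deriv) (simp only: has_field_derivative_def)
  have "((\<lambda>y. F (0, y)) has_derivative (\<lambda>h. blinfun_apply D (0, h))) (at 0)"
    by (rule has_derivative_compose[OF has_derivative_Pair[OF has_derivative_const has_derivative_ident] F'])
  moreover have "(\<lambda>h. blinfun_apply D (0, h)) = (*) (blinfun_apply D (0, 1))"
  proof
    fix h :: real
    have "(0, h) = h *\<^sub>R ((0, 1) :: real \<times> real)" by simp
    then show "blinfun_apply D (0, h) = blinfun_apply D (0, 1) * h"
      by (simp only: blinfun.scaleR_right real_scaleR_def mult.commute)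
  qed
  ultimately have y: "py F = blinfun_apply D (0, 1)"
    unfolding py_def by (intro DERIV_imp_deriv) (simp only: has_field_derivative_def)
  have "z = fst z *\<^sub>R (1, 0) + snd z *\<^sub>R (0, 1)" by (simp add: prod_eq_iff)
  then have "blinfun_apply D z = fst z * blinfun_apply D (1, 0) + snd z * blinfun_apply D (0, 1)"
    by (metis blinfun.add_right blinfun.scaleR_right real_scaleR_def)
  then show ?thesis by (simp add: x y)
qed

lemma C2_strict_deriv:
  fixes F :: "real \<times> real \<Rightarrow> real"
  assumes "C2 F"
  shows "strict_deriv F (\<lambda>z. px F * fst z + py F * snd z)" "continuous_on UNIV F"
proof -
  obtain D D2 where D: "\<And>x. (F has_derivative blinfun_apply (D x)) (at x)"
    "\<And>x. (D has_derivative blinfun_apply (D2 x)) (at x)"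
    using assms unfolding C2_def by blast
  have "isCont D 0" using D(2) has_derivative_continuous by blast
  from strict_deriv_C1[OF D(1) this] show "strict_deriv F (\<lambda>z. px F * fst z + py F * snd z)"
    unfolding ext[of "blinfun_apply (D 0)", OF partial_derivatives[OF D(1)]] .
  show "continuous_on UNIV F"
    by (intro continuous_at_imp_continuous_on ballI has_derivative_continuous[OF D(1)])
qed

text \<open>Along the limit slide \<open>ell\<close> has this form, with \<open>a\<close> its value
  at the pseudo-equilibrium. If that point repels, the exponential term prevails eventually; if it
  attracts, the constant does. The explicit times come from the bound of \<open>exp x\<close> below
  by \<open>1 + x\<close>.\<close>

lemma exp_affine_neg:
  fixes a m \<mu> :: real
  assumes "(\<mu> > 0 \<and> m < 0) \<or> (\<mu> < 0 \<and> a < 0)"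
  obtains T where "T > 0" "a + m * exp (\<mu> * T) < 0"
  using assms
proof (elim disjE conjE)
  assume \<mu>: "\<mu> > 0" and m: "m < 0"
  define T where "T = (\<bar>a\<bar> / (- m) + 1) / \<mu>"
  have T: "T > 0" using \<mu> m by (simp add: T_def add_nonneg_pos)
  have "\<bar>a\<bar> / (- m) < 1 + \<mu> * T" using \<mu> by (simp add: T_def)
  also have "\<dots> \<le> exp (\<mu> * T)" by (rule exp_ge_add_one_self)
  finally have "\<bar>a\<bar> < exp (\<mu> * T) * (- m)" using m by (subst (asm) pos_divide_less_eq) auto
  then show ?thesis by (intro that[OF T]) (simp add: mult.commute)
next
  assume \<mu>: "\<mu> < 0" and a: "a < 0"
  define T where "T = (\<bar>m\<bar> / (- a) + 1) / (- \<mu>)"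
  have T: "T > 0" using \<mu> a by (simp add: T_def add_nonneg_pos divide_pos_neg)
  have "\<bar>m\<bar> / (- a) < 1 + (- \<mu>) * T" using \<mu> by (simp add: T_def)
  also have "\<dots> \<le> exp ((- \<mu>) * T)" by (rule exp_ge_add_one_self)
  finally have "\<bar>m\<bar> < exp ((- \<mu>) * T) * (- a)" using a by (subst (asm) pos_divide_less_eq) auto
  then have "\<bar>m\<bar> * exp (\<mu> * T) < (exp ((- \<mu>) * T) * (- a)) * exp (\<mu> * T)" by (rule mult_strict_right_mono) simp
  also have "\<dots> = - a" by (simp add: exp_minus)
  finally have "\<bar>m * exp (\<mu> * T)\<bar> < - a" by (simp add: abs_mult)
  then show ?thesis by (intro that[OF T]) linarith
qed

text \<open>Here \<open>b\<close>, \<open>c\<close>, \<open>f\<close>, \<open>g\<close> stand for \<open>H\<^sub>y\<close>, \<open>H\<^sub>\<epsilon>\<close>, \<open>f\<^sup>+\<close>, \<open>g\<^sup>+\<close> at the origin, the \<open>aij\<close> for the Jacobian matrix of the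
  lower field, and \<open>A\<close>, \<open>B\<close>, \<open>a\<close>, \<open>l\<close> for \<open>A'(0)\<close>, \<open>B'(0)\<close>, \<open>a'(0)\<close>, \<open>\<lambda>'(0)\<close>. The third identity evaluates the
  limit sliding velocity at the fold.\<close>

lemma fold_signs:
  fixes b c a11 a12 a21 a22 f g :: real
  defines "D \<equiv> a11 * g - a21 * f" and "\<Delta> \<equiv> a11 * a22 - a12 * a21"
  defines "A \<equiv> c / b * (a22 / a21)" and "B \<equiv> - (c / b)" and "a \<equiv> c / b * ((a12 * g - a22 * f) / D)"
    and "l \<equiv> - (c / b) * (\<Delta> / D)"
  assumes nz: "b \<noteq> 0" "a21 \<noteq> 0" "D \<noteq> 0" and bg: "b * g < 0" and cond: "(a11 * A + a12 * B) * (A - a) * l < 0"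
  shows "c * \<Delta> < 0" "b * a21 * (a11 * A + a12 * B) = c * \<Delta>" "D / g * (b * a21 * (a - A)) = - (c * \<Delta>)"
    "l * (D / g) < 0"
proof -
  have g: "g \<noteq> 0" using bg by auto
  have F: "a11 * A + a12 * B = (c / b) * \<Delta> / a21" using nz by (simp add: A_def B_def \<Delta>_def field_simps)
  have Aa: "A - a = (c / b) * (g * \<Delta>) / (a21 * D)"
  proof -
    have "A - a = (c / b) * (a22 / a21 - (a12 * g - a22 * f) / D)" by (simp add: A_def a_def right_diff_distrib)
    also have "a22 / a21 - (a12 * g - a22 * f) / D = (a22 * D - a21 * (a12 * g - a22 * f)) / (a21 * D)"
      using nz by (simp add: field_simps)
    also have "a22 * D - a21 * (a12 * g - a22 * f) = g * \<Delta>" by (simp add: D_def \<Delta>_def algebra_simps)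
    finally show ?thesis by simp
  qed
  \<comment> \<open>After factoring, everything except \<open>c * \<Delta>\<close> and the positive
    number \<open>- (g / b)\<close> occurs squared, so the condition on three factors amounts to one
    sign.\<close>
  have "(a11 * A + a12 * B) * (A - a) * l = - (c * \<Delta>)\<^sup>2 / (b * a21 * D)\<^sup>2 * (c * \<Delta>) * (g / b)"
    unfolding F Aa l_def using nz by (simp add: field_simps power2_eq_square)
  also have "\<dots> = ((c * \<Delta>) / (b * a21 * D))\<^sup>2 * ((c * \<Delta>) * (- (g / b)))" by (simp add: power_divide)
  finally have "((c * \<Delta>) / (b * a21 * D))\<^sup>2 * ((c * \<Delta>) * (- (g / b))) < 0" using cond by simp
  then have "(c * \<Delta>) * (- (g / b)) < 0" by (metis mult_nonneg_nonneg not_le zero_le_power2)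
  moreover have "- (g / b) > 0" using bg by (auto simp: mult_less_0_iff divide_less_0_iff)
  ultimately show c\<Delta>: "c * \<Delta> < 0" by (metis mult_less_0_iff not_less_iff_gr_or_eq)
  show "b * a21 * (a11 * A + a12 * B) = c * \<Delta>" unfolding F using nz by simp
  have "D / g * (b * a21 * (a - A)) = - (D / g * (b * a21 * (A - a)))" by (simp add: algebra_simps)
  also have "D / g * (b * a21 * (A - a)) = c * \<Delta>" unfolding Aa using nz g by simp
  finally show "D / g * (b * a21 * (a - A)) = - (c * \<Delta>)" .
  have "l * (D / g) = - (c * \<Delta> / (b * g))" unfolding l_def using nz g by (simp add: field_simps)
  then show "l * (D / g) < 0" using divide_neg_neg[OF c\<Delta> bg] by simp
qed

theorem theorem2:
  fixes fp gp fm gm :: "real \<times> real \<Rightarrow> real"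
    and H :: "real \<times> real \<Rightarrow> real \<Rightarrow> real"
    and u0 v0 :: "real \<Rightarrow> real" and T0 :: real
  defines "Ap \<equiv> He H / Hy H * (py gm / px gm)"
    and "Bp \<equiv> - (He H / Hy H)"
    and "ap \<equiv> He H / Hy H * ((py fm * gp (0,0) - py gm * fp (0,0)) /
                               (px fm * gp (0,0) - px gm * fp (0,0)))"
    and "lp \<equiv> - (He H / Hy H) * ((px fm * py gm - py fm * px gm) /
                               (px fm * gp (0,0) - px gm * fp (0,0)))"
  assumes "C2 fp" "C2 gp" "C2 fm" "C2 gm" "C2 (\<lambda>(z, e). H z e)"
    and "fm (0,0) = 0" "gm (0,0) = 0"
    and "H (0,0) 0 = 0" "Hx H = 0" "Hy H \<noteq> 0" "Hy H * gp (0,0) < 0"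
    and "px gm \<noteq> 0"
    and "px fm * gp (0,0) - px gm * fp (0,0) \<noteq> 0"
    and "(px fm * Ap + py fm * Bp) * (Ap - ap) * lp < 0"
    and "\<And>t. (u0 has_real_derivative (px fm * u0 t + py fm * v0 t)) (at t)"
    and "\<And>t. (v0 has_real_derivative (px gm * u0 t + py gm * v0 t)) (at t)"
    and "u0 0 = Ap" "v0 0 = Bp"
    and "T0 > 0" "\<forall>t\<in>{0<..<T0}. Hy H * v0 t + He H < 0" "v0 T0 = Bp"
    and "lp < 0 \<Longrightarrow> min ap Ap < u0 T0 \<and> u0 T0 < max ap Ap"
    and "lp > 0 \<Longrightarrow> u0 T0 \<noteq> Ap"
  shows "\<exists>\<epsilon>0>0. \<exists>\<gamma> :: real \<Rightarrow> real \<Rightarrow> real \<times> real.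
           (\<forall>\<epsilon>\<in>{0<..<\<epsilon>0}. stick_slip_cycle fp gp fm gm H \<epsilon> (\<gamma> \<epsilon>) \<and>
                             limit_cycle fp gp fm gm H \<epsilon> (\<gamma> \<epsilon>) \<and>
                             finite_time_stable fp gp fm gm H \<epsilon> (\<gamma> \<epsilon>)) \<and>
           (\<forall>\<eta>>0. \<exists>\<delta>>0. \<forall>\<epsilon>\<in>{0<..<\<delta>}. \<forall>t\<ge>0. norm (\<gamma> \<epsilon> t) < \<eta>)"
proof -
  define b c where "b = Hy H" "c = He H"
  define a11 a12 a21 a22 where "a11 = px fm" "a12 = py fm" "a21 = px gm" "a22 = py gm"
  define D where "D = a11 * gp 0 - a21 * fp 0"
  define \<Delta> where "\<Delta> = a11 * a22 - a12 * a21"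
  \<comment> \<open>The rate of the limit sliding flow \<open>u' = \<mu> * (u - ap)\<close> on the
    line \<open>v = Bp\<close>.\<close>
  define \<mu> where "\<mu> = D / gp 0"
  note nm = b_c_def a11_a12_a21_a22_def zero_prod_def[symmetric]
  have zero: "fm 0 = 0" "gm 0 = 0" "H 0 0 = 0" using assms(10-12) by (simp_all add: zero_prod_def)
  have nz: "b \<noteq> 0" "a21 \<noteq> 0" "D \<noteq> 0" and bg: "b * gp 0 < 0"
    using assms(14-17) by (simp_all add: nm D_def)
  have g: "gp 0 \<noteq> 0" using bg by auto
  have Ap: "Ap = c / b * (a22 / a21)" and Bp: "Bp = - (c / b)"
    and ap: "ap = c / b * ((a12 * gp 0 - a22 * fp 0) / D)" and lp: "lp = - (c / b) * (\<Delta> / D)"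
    by (simp_all add: Ap_def Bp_def ap_def lp_def nm D_def \<Delta>_def)
  have cond: "(a11 * Ap + a12 * Bp) * (Ap - ap) * lp < 0" using assms(18) by (simp add: nm)
  note signs = fold_signs[where b = b and c = c and ?a11.0 = a11 and ?a12.0 = a12 and ?a21.0 = a21 and ?a22.0 = a22 and f = "fp 0" and g = "gp 0",
      OF nz(1,2) nz(3)[unfolded D_def] bg, folded D_def \<Delta>_def, folded Ap Bp ap lp, OF cond, folded \<mu>_def]
  have \<psi>': "(u0 has_real_derivative (a11 * u0 t + a12 * v0 t)) (at t)"
      "(v0 has_real_derivative (a21 * u0 t + a22 * v0 t)) (at t)" for t
    using assms(19,20)[of t] by (simp_all add: nm)
  have below: "b * v0 t + c < 0" if "0 < t" "t < T0" for t using assms(24) that by (simp add: nm)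
  have Bc: "b * Bp + c = 0" using nz by (simp add: Bp)
  have A0: "a21 * Ap + a22 * Bp = 0" using nz by (simp add: Ap Bp)
  \<comment> \<open>\<open>l1\<close> and \<open>ls\<close> are the values of \<open>ell\<close> at
    the landing point and at the pseudo-equilibrium \<open>(ap, Bp)\<close>; \<open>ell\<close>
    vanishes at the fold and is positive in the sliding region.\<close>
  define l1 where "l1 = b * a21 * (u0 T0 - Ap)"
  define ls where "ls = b * a21 * (ap - Ap)"
  have l1_eq: "b * (a21 * u0 T0 + a22 * v0 T0) = l1"
  proof -
    have eq: "a22 * Bp = - (a21 * Ap)" using A0 by simp
    show ?thesis unfolding assms(25) eq by (simp add: l1_def algebra_simps)
  qed
  \<comment> \<open>\<open>l1\<close> is the derivative of \<open>b * v0 + c\<close> at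
    \<open>T0\<close>, which cannot be negative because the orbit reaches the line from below. It is
    not zero, as the landing point would then be the fold, which the hypotheses exclude for both
    signs of \<open>lp\<close>.\<close>
  have l1: "l1 > 0"
  proof -
    have "l1 \<ge> 0"
    proof (rule ccontr)
      assume "\<not> l1 \<ge> 0"
      moreover have "((\<lambda>t. b * v0 t + c) has_real_derivative l1) (at T0)"
        using \<psi>'(2)[of T0] by (auto intro!: derivative_eq_intros simp: l1_eq[symmetric])
      ultimately obtain d where d: "d > 0" "\<And>h. h > 0 \<Longrightarrow> h < d \<Longrightarrow> b * v0 T0 + c < b * v0 (T0 - h) + c"
        using DERIV_neg_dec_left[of "\<lambda>t. b * v0 t + c" l1 T0] by auto
      define h where "h = min d T0 / 2"
      have "h > 0" "h < d" "h < T0" using d(1) assms(23) by (auto simp: h_def)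
      then show False using d(2)[of h] below[of "T0 - h"] Bc assms(25) by simp
    qed
    moreover have "u0 T0 \<noteq> Ap"
    proof (cases "lp < 0")
      case True then show ?thesis using assms(26) by auto
    next
      case False
      then have "lp > 0" using cond by (cases "lp = 0") auto
      then show ?thesis by (rule assms(27))
    qed
    then have "l1 \<noteq> 0" using nz by (simp add: l1_def)
    ultimately show ?thesis by simp
  qed
  \<comment> \<open>In both cases \<open>\<mu> * ls > 0\<close>. A repelling pseudo-equilibrium thus
    has \<open>ls > 0\<close>, and the interval condition on \<open>u0 T0\<close> gives
    \<open>l1 < ls\<close>; an attracting one has \<open>ls < 0\<close> and lies beyond the
    fold.\<close>
  have side: "(\<mu> > 0 \<and> l1 - ls < 0) \<or> (\<mu> < 0 \<and> ls < 0)"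
  proof (cases "lp < 0")
    case True
    then have \<mu>: "\<mu> > 0" using signs(4) by (simp add: mult_less_0_iff)
    have "\<mu> * ls > 0" using signs(1,3) by (simp add: ls_def)
    then have "ls > 0" using \<mu> by (simp add: zero_less_mult_iff)
    have btw: "min ap Ap < u0 T0" "u0 T0 < max ap Ap" using assms(26)[OF True] by auto
    define \<beta> where "\<beta> = b * a21"
    have \<beta>: "\<beta> \<noteq> 0" "l1 = \<beta> * (u0 T0 - Ap)" "ls = \<beta> * (ap - Ap)" using nz by (auto simp: \<beta>_def l1_def ls_def)
    have "l1 < ls"
    proof (cases "\<beta> > 0")
      case True
      then have "u0 T0 - Ap > 0" using l1 \<beta>(2) zero_less_mult_pos by blast
      then have "u0 T0 - Ap < ap - Ap" using btw by auto
      then show ?thesis unfolding \<beta>(2,3) by (rule mult_strict_left_mono[OF _ True])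
    next
      case False
      then have neg: "\<beta> < 0" using \<beta> by simp
      then have "u0 T0 - Ap < 0" using l1 \<beta>(2) by (metis less_le_not_le linorder_not_le mult_nonpos_nonneg less_imp_le)
      then have "u0 T0 - Ap > ap - Ap" using btw by auto
      then show ?thesis unfolding \<beta>(2,3) by (rule mult_strict_left_mono_neg[OF _ neg])
    qed
    then show ?thesis using \<mu> by simp
  next
    case False
    then have "lp > 0" using cond by (cases "lp = 0") auto
    then have \<mu>: "\<mu> < 0" using signs(4) by (simp add: mult_less_0_iff)
    have "\<mu> * ls > 0" using signs(1,3) by (simp add: ls_def)
    then show ?thesis using \<mu> by (simp add: zero_less_mult_iff)
  qed
  then obtain T2 where T2: "T2 > 0" "ls + (l1 - ls) * exp (\<mu> * T2) < 0" by (rule exp_affine_neg)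
  define \<psi> where "\<psi> t = (u0 t, v0 t)" for t
  \<comment> \<open>The explicit solution of the affine sliding equation that starts at the landing
    point.\<close>
  define \<sigma> where "\<sigma> t = (ap + (u0 T0 - ap) * exp (\<mu> * t), Bp)" for t
  have \<psi>d: "(\<psi> has_vector_derivative (a11 * u0 t + a12 * v0 t, a21 * u0 t + a22 * v0 t)) (at t)" for t
    unfolding \<psi>_def[abs_def] using \<psi>'[of t]
    by (intro has_vector_derivative_Pair) (simp_all add: has_real_derivative_iff_has_vector_derivative)
  have \<sigma>d: "(\<sigma> has_vector_derivative ((u0 T0 - ap) * (exp (\<mu> * t) * \<mu>), 0)) (at t)" for t
    unfolding \<sigma>_def[abs_def]
    by (intro has_vector_derivative_Pair)
       (auto intro!: derivative_eq_intros simp: has_real_derivative_iff_has_vector_derivative[symmetric])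
  \<comment> \<open>The extra unit of time is needed because the perturbed slip may land later than
    \<open>T0\<close>.\<close>
  obtain R1 where R1: "\<And>t. t \<in> {0..T0 + 1} \<Longrightarrow> norm (\<psi> t) \<le> R1"
  proof -
    have "continuous_on {0..T0 + 1} \<psi>"
      by (rule continuous_on_vector_derivative[OF has_vector_derivative_at_within[OF \<psi>d]])
    then have "bounded (\<psi> ` {0..T0 + 1})" by (intro compact_imp_bounded compact_continuous_image) auto
    then show thesis using that unfolding bounded_iff by blast
  qed
  obtain R2 where R2: "\<And>t. t \<in> {0..T2} \<Longrightarrow> norm (\<sigma> t) \<le> R2"
  proof -
    have "continuous_on {0..T2} \<sigma>"
      by (rule continuous_on_vector_derivative[OF has_vector_derivative_at_within[OF \<sigma>d]])
    then have "bounded (\<sigma> ` {0..T2})" by (intro compact_imp_bounded compact_continuous_image) auto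
    then show thesis using that unfolding bounded_iff by blast
  qed
  define R where "R = max R1 R2 + 1"
  obtain DH D2H where DH: "\<And>p. ((\<lambda>(z, e). H z e) has_derivative blinfun_apply (DH p)) (at p)"
    and D2H: "\<And>p. (DH has_derivative blinfun_apply (D2H p)) (at p)" and D2c: "continuous_on UNIV D2H"
    using assms(9) unfolding C2_def by blast
  have DHc: "isCont DH 0" using D2H has_derivative_continuous by blast
  have DH0: "blinfun_apply (DH 0) ((x, y), e) = b * y + c * e" for x y e
  proof -
    have at0: "((\<lambda>(z, e). H z e) has_derivative blinfun_apply (DH 0)) (at ((0, 0), 0))"
      using DH[of 0] by (simp add: zero_prod_def)
    have 1: "((\<lambda>x. H (x, 0) 0) has_derivative (\<lambda>h. blinfun_apply (DH 0) ((h, 0), 0))) (at 0)"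
      using has_derivative_compose[OF has_derivative_Pair[OF has_derivative_Pair[OF has_derivative_ident has_derivative_const] has_derivative_const] at0] by simp
    have 2: "((\<lambda>y. H (0, y) 0) has_derivative (\<lambda>h. blinfun_apply (DH 0) ((0, h), 0))) (at 0)"
      using has_derivative_compose[OF has_derivative_Pair[OF has_derivative_Pair[OF has_derivative_const has_derivative_ident] has_derivative_const] at0] by simp
    have 3: "((\<lambda>e. H (0, 0) e) has_derivative (\<lambda>h. blinfun_apply (DH 0) ((0, 0), h))) (at 0)"
      using has_derivative_compose[OF has_derivative_Pair[OF has_derivative_Pair[OF has_derivative_const has_derivative_const] has_derivative_ident] at0] by simp
    have s1: "(\<lambda>h. blinfun_apply (DH 0) ((h, 0), 0)) = (*) (blinfun_apply (DH 0) ((1, 0), 0))"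
    proof
      fix h :: real
      have "((h, 0), 0) = h *\<^sub>R (((1, 0), 0) :: (real \<times> real) \<times> real)" by simp
      then show "blinfun_apply (DH 0) ((h, 0), 0) = blinfun_apply (DH 0) ((1, 0), 0) * h"
        by (simp only: blinfun.scaleR_right real_scaleR_def mult.commute)
    qed
    have s2: "(\<lambda>h. blinfun_apply (DH 0) ((0, h), 0)) = (*) (blinfun_apply (DH 0) ((0, 1), 0))"
    proof
      fix h :: real
      have "((0, h), 0) = h *\<^sub>R (((0, 1), 0) :: (real \<times> real) \<times> real)" by simp
      then show "blinfun_apply (DH 0) ((0, h), 0) = blinfun_apply (DH 0) ((0, 1), 0) * h"
        by (simp only: blinfun.scaleR_right real_scaleR_def mult.commute)
    qed
    have s3: "(\<lambda>h. blinfun_apply (DH 0) ((0, 0), h)) = (*) (blinfun_apply (DH 0) ((0, 0), 1))"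
    proof
      fix h :: real
      have "((0, 0), h) = h *\<^sub>R (((0, 0), 1) :: (real \<times> real) \<times> real)" by simp
      then show "blinfun_apply (DH 0) ((0, 0), h) = blinfun_apply (DH 0) ((0, 0), 1) * h"
        by (simp only: blinfun.scaleR_right real_scaleR_def mult.commute)
    qed
    have x: "Hx H = blinfun_apply (DH 0) ((1, 0), 0)" unfolding Hx_def
      by (rule DERIV_imp_deriv) (use 1 in \<open>simp only: has_field_derivative_def s1\<close>)
    have y: "b = blinfun_apply (DH 0) ((0, 1), 0)" unfolding b_c_def Hy_def
      by (rule DERIV_imp_deriv) (use 2 in \<open>simp only: has_field_derivative_def s2\<close>)
    have e: "c = blinfun_apply (DH 0) ((0, 0), 1)" unfolding b_c_def He_def
      by (rule DERIV_imp_deriv) (use 3 in \<open>simp only: has_field_derivative_def s3\<close>)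
    have "((x, y), e) = ((x, 0), 0) + ((0, y), 0) + ((0, 0), e)" by simp
    then have "blinfun_apply (DH 0) ((x, y), e) =
        blinfun_apply (DH 0) ((x, 0), 0) + blinfun_apply (DH 0) ((0, y), 0) + blinfun_apply (DH 0) ((0, 0), e)"
      by (simp only: blinfun.add_right)
    then show ?thesis using fun_cong[OF s1, of x] fun_cong[OF s2, of y] fun_cong[OF s3, of e] x y e assms(13) by simp
  qed
  interpret ff: filippov_fold fp gp fm gm H DH "blinfun_apply (D2H 0)"
    "\<lambda>z. (px fp * fst z + py fp * snd z, px gp * fst z + py gp * snd z)" b c a11 a12 a21 a22
  proof
    show "strict_deriv DH (blinfun_apply (D2H 0))"
      by (rule strict_deriv_C1[OF D2H]) (use D2c continuous_on_eq_continuous_at[OF open_UNIV] in blast)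
    show "strict_deriv (\<lambda>z. (fm z, gm z)) (\<lambda>z. (a11 * fst z + a12 * snd z, a21 * fst z + a22 * snd z))"
      unfolding nm by (rule strict_deriv_Pair[OF C2_strict_deriv(1)[OF assms(7)] C2_strict_deriv(1)[OF assms(8)]])
    show "strict_deriv (\<lambda>z. (fp z, gp z)) (\<lambda>z. (px fp * fst z + py fp * snd z, px gp * fst z + py gp * snd z))"
      by (rule strict_deriv_Pair[OF C2_strict_deriv(1)[OF assms(5)] C2_strict_deriv(1)[OF assms(6)]])
    show "continuous_on UNIV (\<lambda>z. (fm z, gm z))" "continuous_on UNIV (\<lambda>z. (fp z, gp z))"
      by (intro continuous_on_Pair C2_strict_deriv(2) assms(5-8))+
  qed (use DH DHc DH0 zero nz bg in auto)
  have Sig: "ff.Sig (\<sigma> t) = ((u0 T0 - ap) * (exp (\<mu> * t) * \<mu>), 0)" for t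
  proof -
    define u where "u = ap + (u0 T0 - ap) * exp (\<mu> * t)"
    define k where "k = c / b"
    have Da: "D * ap = k * (a12 * gp 0 - a22 * fp 0)" using nz by (simp add: ap k_def)
    have Bk: "Bp = - k" by (simp add: Bp k_def)
    have "a11 * u + a12 * Bp - (a21 * u + a22 * Bp) / gp 0 * fp 0 = (D * u - D * ap) / gp 0"
      using g unfolding Da Bk by (simp add: D_def field_simps)
    also have "\<dots> = \<mu> * (u - ap)" by (simp add: \<mu>_def right_diff_distrib diff_divide_distrib)
    finally show ?thesis
      using nz g by (simp add: ff.Sig_def ff.J_def ff.ell_def ff.Fp_def \<sigma>_def u_def[symmetric])
        (simp add: u_def)
  qed
  interpret fc: fold_cycle fp gp fm gm H DH "blinfun_apply (D2H 0)"
    "\<lambda>z. (px fp * fst z + py fp * snd z, px gp * fst z + py gp * snd z)" b c a11 a12 a21 a22 \<psi> \<sigma> T0 T2 R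
  proof
    show "(\<psi> has_vector_derivative ff.J (\<psi> t)) (at t)" for t using \<psi>d[of t] by (simp add: ff.J_def \<psi>_def)
    show "(\<sigma> has_vector_derivative ff.Sig (\<sigma> t)) (at t)" for t unfolding Sig by (rule \<sigma>d)
    show "b * snd (\<psi> 0) + c = 0" "ff.ell (\<psi> 0) = 0" using Bc A0 assms(21,22) by (simp_all add: \<psi>_def ff.ell_def)
    \<comment> \<open>The second summand vanishes because the lower field is tangent to the line at
      the fold; the first one is \<open>c * \<Delta>\<close>, whose sign makes the fold
      visible.\<close>
    have "ff.ell (ff.J (\<psi> 0)) = b * a21 * (a11 * Ap + a12 * Bp) + b * a22 * (a21 * Ap + a22 * Bp)"
      using assms(21,22) by (simp add: \<psi>_def ff.ell_def ff.J_def algebra_simps)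
    then show "ff.ell (ff.J (\<psi> 0)) < 0" using signs(1,2) A0 by simp
    show "b * snd (\<psi> T0) + c = 0" using Bc assms(25) by (simp add: \<psi>_def)
    show "ff.ell (\<psi> T0) > 0" using l1 l1_eq by (simp add: \<psi>_def ff.ell_def)
    show "\<sigma> 0 = \<psi> T0" using assms(25) by (simp add: \<sigma>_def \<psi>_def)
    have "ff.ell (\<sigma> T2) = b * a21 * (ap + (u0 T0 - ap) * exp (\<mu> * T2)) + b * (a22 * Bp)"
      by (simp add: ff.ell_def \<sigma>_def algebra_simps)
    also have "a22 * Bp = - (a21 * Ap)" using A0 by simp
    also have "b * a21 * (ap + (u0 T0 - ap) * exp (\<mu> * T2)) + b * (- (a21 * Ap)) = ls + (l1 - ls) * exp (\<mu> * T2)"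
      by (simp add: ls_def l1_def algebra_simps)
    finally show "ff.ell (\<sigma> T2) < 0" using T2 by simp
    show "norm (\<psi> t) \<le> R - 1" if "t \<in> {0..T0 + 1}" for t using R1[OF that] by (simp add: R_def)
    show "norm (\<sigma> t) \<le> R - 1" if "t \<in> {0..T2}" for t using R2[OF that] by (simp add: R_def)
    show "T0 > 0" "T2 > 0" by (fact assms(23), fact T2(1))
    show "b * snd (\<psi> t) + c < 0" if "0 < t" "t < T0" for t using below[OF that] by (simp add: \<psi>_def)
  qed
  obtain e0 \<gamma> where e0: "e0 > 0"
    and cyc: "\<And>e. 0 < e \<Longrightarrow> e < e0 \<Longrightarrow> stick_slip_cycle fp gp fm gm H e (\<gamma> e) \<and> limit_cycle fp gp fm gm H e (\<gamma> e) \<and>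
        finite_time_stable fp gp fm gm H e (\<gamma> e)"
    and small: "\<And>e t. 0 < e \<Longrightarrow> e < e0 \<Longrightarrow> norm (\<gamma> e t) \<le> R * e"
    by (rule fc.cycle_exists) (rule that; assumption)
  show ?thesis
  proof (intro exI[of _ e0] exI[of _ \<gamma>] conjI e0)
    show "\<forall>\<epsilon>\<in>{0<..<e0}. stick_slip_cycle fp gp fm gm H \<epsilon> (\<gamma> \<epsilon>) \<and> limit_cycle fp gp fm gm H \<epsilon> (\<gamma> \<epsilon>) \<and>
        finite_time_stable fp gp fm gm H \<epsilon> (\<gamma> \<epsilon>)" using cyc by simp
    show "\<forall>\<eta>>0. \<exists>\<delta>>0. \<forall>\<epsilon>\<in>{0<..<\<delta>}. \<forall>t\<ge>0. norm (\<gamma> \<epsilon> t) < \<eta>"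
    proof (intro allI impI)
      fix \<eta> :: real assume \<eta>: "\<eta> > 0"
      have R: "R > 0" using fc.R1 by simp
      show "\<exists>\<delta>>0. \<forall>\<epsilon>\<in>{0<..<\<delta>}. \<forall>t\<ge>0. norm (\<gamma> \<epsilon> t) < \<eta>"
      proof (intro exI[of _ "min e0 (\<eta> / R)"] conjI ballI allI impI)
        fix \<epsilon> t assume e: "\<epsilon> \<in> {0<..<min e0 (\<eta> / R)}"
        then have "R * \<epsilon> < \<eta>" using R by (simp add: pos_less_divide_eq mult.commute)
        then show "norm (\<gamma> \<epsilon> t) < \<eta>" using small[of \<epsilon> t] e by simp
      qed (use e0 \<eta> R in simp)
    qed
  qed
qed

end
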